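(* (A) Let $d$ be even. For almost every contracting similitude $A=\vartheta^{-1}\mathcal{O}$ of $\mathbb{R}^d$, for every digit set $\mathcal{D}$ that is cyclic for $A$ and every probability vector $\boldsymbol{p}>0$, the homogeneous self-similar measure $\mu=\mu(A,\mathcal{D},\boldsymbol{p})$ in $\mathbb{R}^d$ has power Fourier decay, i.e. $\mu\in\mathscr{D}_d$. (B) More precisely, for $d=2s$ with $s\ge 1$, let $\mathcal{O}$ be an orthogonal matrix with distinct non-real eigenvalues $e^{\pm 2\pi i\alpha_j}$. Using a linear conjugacy and the identification $\mathbb{R}^{2s}\cong\mathbb{C}^s$, we can assume without loss of generality that $\mathcal{O}$ is the diagonal complex $s\times s$ matrix $$\mathcal{O}=\mathrm{Diag}[e^{-2\pi i\alpha_1},\ldots,e^{-2\pi i\alpha_s}],\qquad \alpha_j\in(0,1/2).$$ Suppose that the digit set $\mathcal{D}=\{0,a_1,\ldots,a_m\}$, with $a_j=(a_j^{(1)},\ldots,a_j^{(s)})\in\mathbb{C}^s$, is cyclic for $A$ (equivalently, for every $k\in\{1,\ldots,s\}$ there exists $a_j$ with $a_j^{(k)}\ne 0$). Fix $\vartheta>1$ and $\boldsymbol{p}>0$, and let $\ell\in\{1,\ldots,s\}$. Then for every list $\{\alpha_j\}_{j\in\{1,\ldots,s\}\setminus\{\ell\}}$ of distinct numbers in $(0,1/2)$ there exists a set $\mathcal{E}_\ell\subset\vartheta\cdot\mathbb{T}^+$ of zero Hausdorff dimension such that for all $\alpha_\ell\in(0,1/2)$, distinct from the other $\alpha_j$ and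 with $e^{2\pi i\alpha_\ell}\notin\vartheta^{-1}\cdot\mathcal{E}_\ell$, the Fourier transform of $\mu=\mu(\vartheta^{-1}\mathcal{O},\mathcal{D},\boldsymbol{p})$ has uniform power decay in the direction of vectors $\xi\in\mathbb{R}^{2s}$ satisfying $$|\xi_{2\ell-1}+i\xi_{2\ell}|=\max_{j\le s}|\xi_{2j-1}+i\xi_{2j}|;$$ that is, there exist $C,\gamma>0$ such that $|\widehat{\mu}(\xi)|\le C|\xi|^{-\gamma}$ for all such $\xi$ with $|\xi|\ge 1$.
   Context: For a contracting similitude $A=\vartheta^{-1}\mathcal{O}$ of $\mathbb{R}^d$ ($\vartheta>1$, $\mathcal{O}\in O(d,\mathbb{R})$), a digit set $\mathcal{D}=\{a_0=0,a_1,\ldots,a_m\}$ ($m\ge 1$) and a probability vector $\boldsymbol{p}=(p_0,\ldots,p_m)$, $\mu(A,\mathcal{D},\boldsymbol{p})$ is the unique Borel probability measure $\mu$ with $\mu=\sum_{j=0}^m p_j(\mu\circ f_j^{-1})$, where $f_j(x)=Ax+a_j$. Write $\boldsymbol{p}>0$ if all $p_j>0$. $\mathcal{D}$ is cyclic for $A$ if $\mathbb{R}^d$ is the smallest $A$-invariant subspace containing $\mathcal{D}$. "Almost every" contracting similitude $A=\vartheta^{-1}\mathcal{O}$ is with respect to the measure $\mathcal{L}^1|_{(0,1)}\times m_d$ in the variables $(\vartheta^{-1},\mathcal{O})$, where $\mathcal{L}^1$ is Lebesgue measure and $m_d$ is Haar measure on $O(d,\mathbb{R})$. $\mathbb{T}^+=\{e^{2\pi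 i\alpha}:\alpha\in(0,\tfrac12)\}$. The identification $\mathbb{R}^{2s}\cong\mathbb{C}^s$ sends $x$ to $(x_1+ix_2,\ldots,x_{2s-1}+ix_{2s})$; a complex diagonal matrix with unimodular entries acts on $\mathbb{R}^{2s}$ as an orthogonal matrix. Fourier transform: $\widehat{\mu}(\xi)=\int e^{-2\pi i\langle\xi,x\rangle}\,d\mu(x)$. $\mathscr{D}_d$ is the set of finite positive Borel measures $\nu$ on $\mathbb{R}^d$ such that for some $\gamma>0$, $|\widehat\nu(\xi)|=O_\nu(|\xi|^{-\gamma})$ as $|\xi|\to\infty$. *)

theory Defs
  imports "HOL-Probability.Probability" "HOL-Library.Landau_Symbols"
begin

text \<open>
  The space \<open>\<real>\<^sup>2\<^sup>s = \<complex>\<^sup>s\<close> is represented by \<open>complex ^ 's\<close>, regarded as a \<^emph>\<open>real\<close> Euclidean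
  space: there \<open>\<xi> \<bullet> x = (\<Sum>j. Re (\<xi>$j) * Re (x$j) + Im (\<xi>$j) * Im (x$j))\<close>, the \<open>j\<close>-th component
  \<open>\<xi> $ j\<close> is \<open>\<xi>\<^bsub>2j-1\<^esub> + \<i> \<xi>\<^bsub>2j\<^esub>\<close>, and \<open>norm\<close>, \<open>borel\<close>, \<open>linear\<close>, \<open>subspace\<close> are those of \<open>\<real>\<^sup>2\<^sup>s\<close>.
\<close>


section \<open>Self-similar measures\<close>

definition similitude :: "real \<Rightarrow> 'k::real_algebra_1 ^ 'n ^ 'n \<Rightarrow> 'k ^ 'n \<Rightarrow> 'k ^ 'n" where
  "similitude r Q = (\<lambda>x. r *\<^sub>R (Q *v x))"

definition cyclic_for :: "('a::real_vector \<Rightarrow> 'a) \<Rightarrow> 'a set \<Rightarrow> bool" where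
  "cyclic_for A D \<longleftrightarrow> (\<forall>S. subspace S \<and> A ` S \<subseteq> S \<and> D \<subseteq> S \<longrightarrow> S = UNIV)"

definition positive_prob_vector :: "nat \<Rightarrow> (nat \<Rightarrow> real) \<Rightarrow> bool" where
  "positive_prob_vector m p \<longleftrightarrow> (\<forall>j\<le>m. p j > 0) \<and> (\<Sum>j\<le>m. p j) = 1"

text \<open>
  For a contraction \<open>A\<close> and a probability vector \<open>p\<close> there is exactly one such \<open>\<mu>\<close>, namely
  \<open>\<mu>(A, {a 0, \<dots>, a m}, p)\<close>.
\<close>
definition is_self_similar_measure ::
    "('a::euclidean_space \<Rightarrow> 'a) \<Rightarrow> nat \<Rightarrow> (nat \<Rightarrow> 'a) \<Rightarrow> (nat \<Rightarrow> real) \<Rightarrow> 'a measure \<Rightarrow> bool" where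
  "is_self_similar_measure A m a p \<mu> \<longleftrightarrow>
     prob_space \<mu> \<and> sets \<mu> = sets borel \<and>
     (\<forall>B\<in>sets borel. measure \<mu> B = (\<Sum>j\<le>m. p j * measure \<mu> ((\<lambda>x. A x + a j) -` B)))"


section \<open>Fourier decay\<close>

definition fourier :: "'a::euclidean_space measure \<Rightarrow> 'a \<Rightarrow> complex" where
  "fourier \<mu> \<xi> = (\<integral>x. exp (- (2 * of_real pi * \<i> * of_real (\<xi> \<bullet> x))) \<partial>\<mu>)"

definition power_decay_measures :: "'a::euclidean_space measure set" where
  "power_decay_measures = {\<nu>. finite_measure \<nu> \<and> sets \<nu> = sets borel \<and>
     (\<exists>\<gamma>>0. (\<lambda>\<xi>. cmod (fourier \<nu> \<xi>)) \<in> O[at_infinity](\<lambda>\<xi>. norm \<xi> powr (-\<gamma>)))}"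


section \<open>Haar measure on the orthogonal group\<close>

text \<open>Normalised to total mass 1; Haar measure is determined uniquely by these properties.\<close>
definition is_haar_orthogonal :: "(real ^ 'n ^ 'n) measure \<Rightarrow> bool" where
  "is_haar_orthogonal H \<longleftrightarrow>
     prob_space H \<and> sets H = sets (restrict_space borel {Q. orthogonal_matrix Q}) \<and>
     (\<forall>R. orthogonal_matrix R \<longrightarrow> distr H H (\<lambda>Q. R ** Q) = H)"


section \<open>Diagonal unitary matrices and complex eigenvalues\<close>

definition rotation_diag :: "('s \<Rightarrow> real) \<Rightarrow> complex ^ 's ^ 's" where
  "rotation_diag \<alpha> = (\<chi> i j. if i = j then cis (- (2 * pi * \<alpha> j)) else 0)"

definition complex_eigenvalues :: "real ^ 'n ^ 'n \<Rightarrow> complex set" where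
  "complex_eigenvalues Q = {z. \<exists>v. v \<noteq> 0 \<and> map_matrix complex_of_real Q *v v = z *s v}"

definition T_plus :: "complex set" where
  "T_plus = {cis (2 * pi * \<alpha>) | \<alpha>. 0 < \<alpha> \<and> \<alpha> < 1 / 2}"


section \<open>Hausdorff dimension\<close>

definition hausdorff_premeasure :: "real \<Rightarrow> real \<Rightarrow> 'a::metric_space set \<Rightarrow> ennreal" where
  "hausdorff_premeasure t \<delta> E =
     (INF U\<in>{U :: nat \<Rightarrow> 'a set. E \<subseteq> (\<Union>i. U i) \<and> (\<forall>i. bounded (U i) \<and> diameter (U i) \<le> \<delta>)}.
        \<Sum>i. ennreal (diameter (U i) powr t))"

definition hausdorff_measure :: "real \<Rightarrow> 'a::metric_space set \<Rightarrow> ennreal" where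
  "hausdorff_measure t E = (SUP \<delta>\<in>{0<..}. hausdorff_premeasure t \<delta> E)"

text \<open>
  Only exponents \<open>t > 0\<close> are used, since \<open>0 powr 0 = 0\<close> would make the formula above wrong for \<open>t = 0\<close>;
  this does not change the infimum.
\<close>
definition hausdorff_dim :: "'a::metric_space set \<Rightarrow> ennreal" where
  "hausdorff_dim E = (INF t\<in>{t. 0 < t \<and> hausdorff_measure t E = 0}. ennreal t)"

end

theory Submission
  imports Defs "HOL-Computational_Algebra.Fundamental_Theorem_Algebra"
begin

text \<open>
  Let \<open>A = \<theta>\<^sup>-\<^sup>1 M\<close> with \<open>M\<close> orthogonal, and write a large frequency as \<open>B\<^sup>N \<zeta>\<close> with
  \<open>B = \<theta> M\<close> and \<open>1 \<le> |\<zeta>| \<le> \<theta>\<close>. Self-similarity bounds the Fourier transform by a product of \<open>N\<close>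
  mask values, and the \<open>n\<close>-th factor is bounded away from 1 unless every
  \<open>y n = \<langle>B\<^sup>n \<zeta>, a\<^sub>j\<rangle>\<close> is near an integer. So power decay follows if a positive proportion of the
  indices is bad, i.e. \<open>y n\<close> is far from the integers for some fixed \<open>j\<close>.

  The sequence \<open>y\<close> is an exponential sum \<open>\<Sum>i. b\<^sub>i \<lambda>\<^sub>i\<^sup>n\<close> whose frequencies depend on one parameter
  \<open>t\<close>. The difference of two such sequences, for parameters \<open>t\<close> and \<open>t'\<close>, is annihilated by
  \<open>\<Prod>i. (T - \<lambda>\<^sub>i(t)) (T - \<lambda>\<^sub>i(t'))\<close>, where \<open>T\<close> is the shift. Hence the roundings of
  \<open>y\<close> up to \<open>n\<close> leave boundedly many choices for the next one, and only one choice if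
  the last few indices are good: few sequences of roundings have few bad indices. Annihilating all
  \<open>\<lambda>\<^sub>i(t')\<close> and all but one \<open>\<lambda>\<^sub>i(t)\<close> shows that the roundings up to \<open>N\<close> determine \<open>t\<close> up to
  \<open>O(\<theta>\<^sup>-\<^sup>N)\<close>. The exceptional parameters therefore form a set of Hausdorff dimension zero.

  In part (B) the parameter is \<open>t = \<theta> e\<^sup>2\<^sup>\<pi>\<^sup>i\<^sup>\<beta>\<close>. In part (A) it is the contraction ratio: for every
  fixed orthogonal matrix the exceptional ratios have dimension zero, so Fubini applies to any
  measure on the orthogonal group.
\<close>


section \<open>Counting roundings of exponential sums\<close>

text \<open>Dimension zero results from a competition of rates. Allowing a smaller proportion of bad
  indices pushes the number of prefixes of length N below a multiple of s ^ N for any s > 1, while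
  parameters sharing a prefix stay within O(L ^ (- N)) for a fixed L > 1. Counting and shrinking
  need uniform constants, whereas cyclicity and distinctness of the frequencies are qualitative.
  Hence each class of sequences carries a natural number q that bounds all sizes and, through 1 / (q
  + 1), all lower bounds; the exceptional set is a union over q of intersections, over a rarity
  level k, of limsup sets in N. The classes contain all sequences of a given size rather than those
  of one digit set, because in (A) a single null set has to serve all digit sets. In (B) only the
  pair t, \<open>cnj t\<close> moves, so the coefficient of t itself must be bounded below: the
  maximality of the l-th component of \<xi> provides this. In (A) every frequency scales with the
  ratio, so one large coefficient anywhere suffices, and cyclicity with compactness yields
  it.\<close>

fun diff_op :: "complex list \<Rightarrow> (nat \<Rightarrow> complex) \<Rightarrow> nat \<Rightarrow> complex" where
  "diff_op [] y = y"
| "diff_op (z # zs) y = diff_op zs (\<lambda>n. y (Suc n) - z * y n)"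

lemma diff_op_diff: "diff_op zs (\<lambda>n. f n - g n) n = diff_op zs f n - diff_op zs g n"
proof (induction zs arbitrary: f g)
  case (Cons z zs)
  have "diff_op (z # zs) (\<lambda>n. f n - g n) n
      = diff_op zs (\<lambda>n. (f (Suc n) - z * f n) - (g (Suc n) - z * g n)) n"
    by (simp add: algebra_simps)
  then show ?case by (simp only: Cons.IH diff_op.simps)
qed simp

text \<open>\<open>diff_op zs\<close> is the product of the commuting operators T - z for z in
  \<open>zs\<close>, and T - z multiplies a geometric sequence with ratio \<open>l i\<close> by
  \<open>l i - z\<close>. So listing a frequency among the roots deletes its term.\<close>

lemma diff_op_exp_sum:
  "diff_op zs (\<lambda>n. \<Sum>i\<in>I. b i * l i ^ n) n = (\<Sum>i\<in>I. b i * (\<Prod>z\<leftarrow>zs. l i - z) * l i ^ n)"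
proof (induction zs arbitrary: b)
  case (Cons z zs)
  have "diff_op (z # zs) (\<lambda>n. \<Sum>i\<in>I. b i * l i ^ n) n
      = diff_op zs (\<lambda>n. \<Sum>i\<in>I. (b i * (l i - z)) * l i ^ n) n"
    by (simp add: sum_distrib_left sum_subtractf[symmetric] algebra_simps)
  also have "\<dots> = (\<Sum>i\<in>I. (b i * (l i - z)) * (\<Prod>z\<leftarrow>zs. l i - z) * l i ^ n)"
    by (rule Cons.IH)
  finally show ?case by (simp add: mult.assoc)
qed simp

lemma norm_diff_op_le:
  assumes "\<And>z. z \<in> set zs \<Longrightarrow> cmod z \<le> R" "0 \<le> R"
    and "\<And>j. j \<le> length zs \<Longrightarrow> cmod (y (n + j)) \<le> e"
  shows "cmod (diff_op zs y n) \<le> (1 + R) ^ length zs * e"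
  using assms
proof (induction zs arbitrary: y e)
  case (Cons z zs)
  have e: "0 \<le> e" using Cons.prems(3)[of 0] norm_ge_zero order_trans by blast
  have "cmod (y (Suc (n + j)) - z * y (n + j)) \<le> (1 + R) * e" if "j \<le> length zs" for j
  proof -
    have "cmod (z * y (n + j)) \<le> R * e"
      unfolding norm_mult using Cons.prems that by (intro mult_mono) auto
    then show ?thesis
      using norm_triangle_ineq4[of "y (Suc (n + j))" "z * y (n + j)"] Cons.prems(3)[of "Suc j"] that
      by (simp add: algebra_simps)
  qed
  then have "cmod (diff_op zs (\<lambda>n. y (Suc n) - z * y n) n) \<le> (1 + R) ^ length zs * ((1 + R) * e)"
    using Cons.prems by (intro Cons.IH) auto
  then show ?case by (simp add: mult.assoc mult.left_commute)
qed force

text \<open>The operator is monic of degree \<open>length zs\<close>: its coefficients have absolute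
  sum at most \<open>(1 + R) ^ length zs\<close>, of which the leading 1 belongs to the last entry.
  Where the operator vanishes, the preceding entries therefore control the last one.\<close>

lemma norm_diff_op_minus_last_le:
  assumes "\<And>z. z \<in> set zs \<Longrightarrow> cmod z \<le> R" "0 \<le> R" "0 \<le> e"
    and "\<And>j. j < length zs \<Longrightarrow> cmod (y (n + j)) \<le> e"
  shows "cmod (diff_op zs y n - y (n + length zs)) \<le> ((1 + R) ^ length zs - 1) * e"
  using assms
proof (induction zs arbitrary: y e)
  case (Cons z zs)
  let ?y = "\<lambda>n. y (Suc n) - z * y n"
  have zy: "cmod (z * y (n + j)) \<le> R * e" if "j \<le> length zs" for j
    unfolding norm_mult using Cons.prems that by (intro mult_mono) auto
  have "cmod (?y (n + j)) \<le> (1 + R) * e" if "j < length zs" for j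
    using norm_triangle_ineq4[of "y (Suc (n + j))" "z * y (n + j)"] Cons.prems(4)[of "Suc j"] that
      zy[of j] by (simp add: algebra_simps)
  then have "cmod (diff_op zs ?y n - ?y (n + length zs)) \<le> ((1 + R) ^ length zs - 1) * ((1 + R) * e)"
    using Cons.prems by (intro Cons.IH) auto
  moreover have "diff_op (z # zs) y n - y (n + length (z # zs))
      = (diff_op zs ?y n - ?y (n + length zs)) - z * y (n + length zs)" by simp
  ultimately have "cmod (diff_op (z # zs) y n - y (n + length (z # zs)))
      \<le> ((1 + R) ^ length zs - 1) * ((1 + R) * e) + R * e"
    using order_trans[OF norm_triangle_ineq4 add_mono[OF _ zy[OF order_refl]]] by (simp only:)
  then show ?case by (simp add: algebra_simps)
qed simp

text \<open>The cosine stands in for the distance to the nearest integer: it is continuous in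
  \<open>y n\<close>, which later keeps exceptional sets closed, and it is the quantity that enters
  the estimate of the digit mask.\<close>

definition bad_indices :: "real \<Rightarrow> nat \<Rightarrow> (nat \<Rightarrow> real) \<Rightarrow> nat set" where
  "bad_indices \<kappa> N y = {n. n < N \<and> cos (2 * pi * y n) < \<kappa>}"

section \<open>Prefixes of roundings and their number\<close>

definition round_prefix :: "nat \<Rightarrow> (nat \<Rightarrow> real) \<Rightarrow> int list" where
  "round_prefix N y = map (\<lambda>n. round (y n)) [0..<N]"

lemma round_prefix_eq_iff: "round_prefix N y = round_prefix N y' \<longleftrightarrow> (\<forall>n<N. round (y n) = round (y' n))"
  by (auto simp: round_prefix_def)

lemma abs_minus_round_le: "\<bar>y - of_int (round y)\<bar> \<le> (1/2 :: real)"
  using of_int_round_abs_le[of y] by (simp add: abs_minus_commute)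

lemma near_integer_if_cos_ge:
  fixes y \<rho> :: real
  assumes "cos (2 * pi * \<rho>) \<le> cos (2 * pi * y)" "0 \<le> \<rho>" "\<rho> \<le> 1/2"
  shows "\<bar>y - of_int (round y)\<bar> \<le> \<rho>"
proof -
  define d where "d = \<bar>y - of_int (round y)\<bar>"
  have "cos (2 * pi * y) = cos (2 * pi * (y - of_int (round y)) + of_int (round y) * (2 * pi))"
    by (simp add: algebra_simps)
  also have "\<dots> = cos (2 * pi * (y - of_int (round y)))"
    by (simp add: cos_add mult.commute[of "of_int _"])
  also have "\<dots> = cos (2 * pi * d)"
    unfolding d_def by (simp add: abs_if)
       (metis cos_minus minus_diff_eq mult_minus_right)
  finally have "cos (2 * pi * \<rho>) \<le> cos (2 * pi * d)" using assms by simp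
  moreover have "d \<le> 1/2" "0 \<le> d" unfolding d_def using abs_minus_round_le by auto
  ultimately have "2 * pi * d \<le> 2 * pi * \<rho>"
    using assms by (subst (asm) cos_mono_le_eq) auto
  then show ?thesis by (simp add: d_def)
qed

lemma card_int_le_if_close:
  fixes S :: "int set"
  assumes "\<And>x x'. x \<in> S \<Longrightarrow> x' \<in> S \<Longrightarrow> \<bar>x - x'\<bar> \<le> int B"
  shows "finite S \<and> card S \<le> 2 * B + 1"
proof (cases "S = {}")
  case False
  then obtain x where x: "x \<in> S" by blast
  have sub: "S \<subseteq> {x - int B..x + int B}"
    using assms[OF _ x] by (force simp: abs_le_iff)
  then have "card S \<le> card {x - int B..x + int B}" by (intro card_mono) auto
  with sub show ?thesis by (auto intro: finite_subset)
qed simp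

text \<open>The binomial theorem, summed over subsets instead of cardinalities; it turns a weight x
  per bad index into the growth rate 1 + x.\<close>

lemma sum_Pow_power:
  fixes x :: real
  assumes "finite A"
  shows "(\<Sum>S\<in>Pow A. x ^ card S) = (1 + x) ^ card A"
  using assms
proof (induction A rule: finite_induct)
  case (insert a A)
  have "(\<Sum>S\<in>Pow (insert a A). x ^ card S)
      = (\<Sum>S\<in>Pow A. x ^ card S) + (\<Sum>S\<in>insert a ` Pow A. x ^ card S)"
    unfolding Pow_insert using insert by (intro sum.union_disjoint) auto
  also have "(\<Sum>S\<in>insert a ` Pow A. x ^ card S) = (\<Sum>S\<in>Pow A. x ^ card (insert a S))"
    using insert by (subst sum.reindex) (auto simp: inj_on_def)
  also have "\<dots> = (\<Sum>S\<in>Pow A. x * x ^ card S)"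
    using insert by (intro sum.cong) (auto simp: card_insert_if finite_subset)
  finally show ?case using insert by (simp add: sum_distrib_left[symmetric] algebra_simps)
qed simp

text \<open>Once the bad indices are prescribed, a prefix extends in one way except just after a bad index.\<close>

lemma card_prefixes_given_bad:
  fixes Y :: "(nat \<Rightarrow> real) set" and C M \<rho> :: real
  assumes ext: "\<forall>y\<in>Y. \<forall>y'\<in>Y. \<forall>n. \<forall>e\<ge>0. (\<forall>j<W. \<bar>y (n + j) - y' (n + j)\<bar> \<le> e)
      \<longrightarrow> \<bar>y (n + W) - y' (n + W)\<bar> \<le> C * e"
    and init: "\<forall>y\<in>Y. \<forall>n<W. \<bar>y n\<bar> \<le> M"
    and \<rho>: "0 \<le> \<rho>" "\<rho> \<le> 1/2" "2 * C * \<rho> + 2 * \<rho> < 1" and \<kappa>: "cos (2 * pi * \<rho>) \<le> \<kappa>"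
    and B: "C + 1 \<le> real B" "2 * M + 1 \<le> real B"
  shows "finite (round_prefix N ` {y \<in> Y. bad_indices \<kappa> N y = S}) \<and>
    card (round_prefix N ` {y \<in> Y. bad_indices \<kappa> N y = S})
      \<le> (2 * B + 1) ^ card {n. n < N \<and> (n < W \<or> (\<exists>j\<in>S. j \<le> n \<and> n \<le> j + W))}"
proof (induction N arbitrary: S)
  case 0
  have "round_prefix 0 ` {y \<in> Y. bad_indices \<kappa> 0 y = S} \<subseteq> {[]}" by (auto simp: round_prefix_def)
  then show ?case
    by (auto intro: finite_subset dest: card_mono[rotated])
next
  case (Suc N)
  \<comment> \<open>Prefixes of length N do not see the index N, so the bad set prescribed for them
    is S without N.\<close>
  define S' where "S' = S - {N}"
  define X where "X = round_prefix N ` {y \<in> Y. bad_indices \<kappa> N y = S'}"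
  define F where "F xs = {k. \<exists>y\<in>Y. bad_indices \<kappa> (Suc N) y = S \<and> round_prefix N y = xs \<and> round (y N) = k}" for xs
  define E where "E = {n. n < N \<and> (n < W \<or> (\<exists>j\<in>S'. j \<le> n \<and> n \<le> j + W))}"
  let ?free = "N < W \<or> (\<exists>j\<in>S. j \<le> N \<and> N \<le> j + W)"
  have X: "finite X" "card X \<le> (2 * B + 1) ^ card E" using Suc.IH[of S'] by (auto simp: X_def E_def)
  have sub: "round_prefix (Suc N) ` {y \<in> Y. bad_indices \<kappa> (Suc N) y = S} \<subseteq> (\<Union>xs\<in>X. (\<lambda>k. xs @ [k]) ` F xs)"
  proof (clarsimp simp: X_def F_def)
    fix y assume y: "y \<in> Y" "S = bad_indices \<kappa> (Suc N) y"
    have "bad_indices \<kappa> N y = S'" unfolding S'_def y by (auto simp: bad_indices_def less_Suc_eq)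
    moreover have "round_prefix (Suc N) y = round_prefix N y @ [round (y N)]" by (simp add: round_prefix_def)
    ultimately show "\<exists>x. x \<in> Y \<and> bad_indices \<kappa> N x = S' \<and>
        round_prefix (Suc N) y \<in> (\<lambda>k. round_prefix N x @ [k]) `
          {k. \<exists>ya\<in>Y. bad_indices \<kappa> (Suc N) ya = bad_indices \<kappa> (Suc N) y \<and>
              round_prefix N ya = round_prefix N x \<and> round (ya N) = k}"
      using y by blast
  qed
  \<comment> \<open>Two admissible next roundings differ by at most B in the free case and coincide
    otherwise, which leaves 2 * 0 + 1 = 1 choice in \<open>card_int_le_if_close\<close>.\<close>
  have close: "\<bar>k - k'\<bar> \<le> int (if ?free then B else 0)" if kk: "k \<in> F xs" "k' \<in> F xs" for k k' xs
  proof -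
    obtain y y' where y: "y \<in> Y" "bad_indices \<kappa> (Suc N) y = S" "round_prefix N y = xs" "round (y N) = k"
      and y': "y' \<in> Y" "bad_indices \<kappa> (Suc N) y' = S" "round_prefix N y' = xs" "round (y' N) = k'"
      using kk unfolding F_def by blast
    have r: "round (y n) = round (y' n)" if "n < N" for n
      using y(3) y'(3) that round_prefix_eq_iff[of N y y'] by simp
    have k: "real_of_int \<bar>k - k'\<bar> \<le> \<bar>y N - of_int k\<bar> + \<bar>y N - y' N\<bar> + \<bar>y' N - of_int k'\<bar>"
      unfolding of_int_abs of_int_diff by linarith
    have h: "\<bar>y N - of_int k\<bar> \<le> 1/2" "\<bar>y' N - of_int k'\<bar> \<le> 1/2"
      using abs_minus_round_le y(4) y'(4) by blast+
    show ?thesis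
    proof (cases "N < W")
      case True
      then have "real_of_int \<bar>k - k'\<bar> \<le> 1/2 + (M + M) + 1/2"
        using k h init[rule_format, OF y(1) True] init[rule_format, OF y'(1) True] abs_triangle_ineq4[of "y N" "y' N"] by linarith
      then have "real_of_int \<bar>k - k'\<bar> \<le> real B" using B by linarith
      then show ?thesis using True by simp
    next
      case False
      define n where "n = N - W"
      have n: "N = n + W" using False by (simp add: n_def)
      \<comment> \<open>In the window of W indices before N both sequences have the same roundings,
        so an error e on either side gives a difference of at most 2 * e, which \<open>ext\<close>
        carries to the index N.\<close>
      have gen: "\<bar>y N - y' N\<bar> \<le> C * (2 * e)"
        if "\<And>j. j < N \<Longrightarrow> n \<le> j \<Longrightarrow> \<bar>y j - of_int (round (y j))\<bar> \<le> e \<and> \<bar>y' j - of_int (round (y' j))\<bar> \<le> e"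
          "0 \<le> e" for e
        unfolding n
      proof (rule ext[THEN bspec, OF y(1), THEN bspec, OF y'(1), rule_format])
          fix j assume j: "j < W"
          have "\<bar>y (n + j) - of_int (round (y (n + j)))\<bar> \<le> e \<and> \<bar>y' (n + j) - of_int (round (y' (n + j)))\<bar> \<le> e"
            using that(1)[of "n + j"] j n by auto
          then show "\<bar>y (n + j) - y' (n + j)\<bar> \<le> 2 * e"
            using r[of "n + j"] j n by (auto simp: abs_le_iff)
      qed (use that in auto)
      show ?thesis
      proof (cases ?free)
        case True
        \<comment> \<open>Rounding errors never exceed 1/2, so a bound survives even after bad
          indices; this is the origin of \<open>C + 1 \<le> real B\<close>.\<close>
        have "\<bar>y N - y' N\<bar> \<le> C * (2 * (1/2))" by (rule gen[OF conjI[OF abs_minus_round_le abs_minus_round_le]]) simp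
        then have "real_of_int \<bar>k - k'\<bar> \<le> 1/2 + C + 1/2"
          using k h by linarith
        then have "real_of_int \<bar>k - k'\<bar> \<le> real B" using B by linarith
        then show ?thesis using True by simp
      next
        case nf: False
        \<comment> \<open>A bad index at N itself also counts as free: here the errors at N must be
          at most \<rho> as well, so that the two roundings differ by at most
          \<open>2 * C * \<rho> + 2 * \<rho> < 1\<close> and are equal integers.\<close>
        have good: "\<bar>y j - of_int (round (y j))\<bar> \<le> \<rho> \<and> \<bar>y' j - of_int (round (y' j))\<bar> \<le> \<rho>"
          if "j \<le> N" "n \<le> j" for j
        proof -
          have "j \<notin> S" using nf that n by auto
          then have "j \<notin> bad_indices \<kappa> (Suc N) y" "j \<notin> bad_indices \<kappa> (Suc N) y'"
            by (simp_all only: y(2) y'(2) not_False_eq_True)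
          then have "\<kappa> \<le> cos (2 * pi * y j)" "\<kappa> \<le> cos (2 * pi * y' j)"
            using that(1) by (simp_all add: bad_indices_def not_less)
          with \<kappa> show ?thesis
            by (intro conjI near_integer_if_cos_ge[OF _ \<rho>(1,2)]) linarith+
        qed
        have "\<bar>y N - y' N\<bar> \<le> C * (2 * \<rho>)" by (rule gen[OF good \<rho>(1)]) auto
        then have "real_of_int \<bar>k - k'\<bar> < 1"
          using k good[of N, unfolded y(4) y'(4)] \<rho> n by linarith
        then have "\<bar>k - k'\<bar> < 1" by linarith
        then show ?thesis using nf by simp
      qed
    qed
  qed
  have F: "finite (F xs)" "card (F xs) \<le> (2 * B + 1) ^ (if ?free then 1 else 0)" for xs
    using card_int_le_if_close[of "F xs" "if ?free then B else 0"] close[of _ xs] by (auto split: if_splits)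
  have fin: "finite (\<Union>xs\<in>X. (\<lambda>k. xs @ [k]) ` F xs)" using X F by auto
  have "card (round_prefix (Suc N) ` {y \<in> Y. bad_indices \<kappa> (Suc N) y = S})
      \<le> card (\<Union>xs\<in>X. (\<lambda>k. xs @ [k]) ` F xs)" using fin sub by (rule card_mono)
  also have "\<dots> \<le> (\<Sum>xs\<in>X. card ((\<lambda>k. xs @ [k]) ` F xs))" using X by (intro card_UN_le) auto
  also have "\<dots> \<le> (\<Sum>xs\<in>X. (2 * B + 1) ^ (if ?free then 1 else 0))"
    using F by (intro sum_mono order_trans[OF card_image_le]) auto
  also have "\<dots> \<le> (2 * B + 1) ^ card E * (2 * B + 1) ^ (if ?free then 1 else 0)"
    using X by (simp add: mult_right_mono)
  also have "\<dots> = (2 * B + 1) ^ (card E + (if ?free then 1 else 0))" by (simp add: power_add)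
  also have "\<dots> \<le> (2 * B + 1) ^ card {n. n < Suc N \<and> (n < W \<or> (\<exists>j\<in>S. j \<le> n \<and> n \<le> j + W))}"
  proof (rule power_increasing)
    let ?E = "{n. n < Suc N \<and> (n < W \<or> (\<exists>j\<in>S. j \<le> n \<and> n \<le> j + W))}"
    have "E \<union> (if ?free then {N} else {}) \<subseteq> ?E" by (auto simp: E_def S'_def)
    moreover have "finite ?E" by simp
    ultimately have "card (E \<union> (if ?free then {N} else {})) \<le> card ?E" by (intro card_mono)
    moreover have "card (E \<union> (if ?free then {N} else {})) = card E + (if ?free then 1 else 0)"
      by (subst card_Un_disjoint) (auto simp: E_def)
    ultimately show "card E + (if ?free then 1 else 0) \<le> card ?E" by linarith
  qed simp
  finally show ?case using finite_subset[OF sub fin] by blast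
qed

lemma card_after_bad_le:
  assumes "finite S"
  shows "card {n. n < N \<and> (n < W \<or> (\<exists>j\<in>S. j \<le> n \<and> n \<le> j + W))} \<le> W + card S * (W + 1)"
proof -
  have "card {n. n < N \<and> (n < W \<or> (\<exists>j\<in>S. j \<le> n \<and> n \<le> j + W))} \<le> card ({..<W} \<union> (\<Union>j\<in>S. {j..j + W}))"
    using assms by (intro card_mono) auto
  also have "\<dots> \<le> card {..<W} + card (\<Union>j\<in>S. {j..j + W})" by (rule card_Un_le)
  also have "card (\<Union>j\<in>S. {j..j + W}) \<le> (\<Sum>j\<in>S. card {j..j + W})" using assms by (rule card_UN_le)
  finally show ?thesis by simp
qed

text \<open>A Chernoff-type estimate. A bad set S costs \<open>b ^ ((W + 1) * card S)\<close>,
  written as \<open>h ^ card S * x ^ card S\<close>: the first factor is at most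
  \<open>h powr (\<delta>0 * N)\<close> because S is small, and the second sums over all subsets of
  the indices to \<open>(1 + x) ^ N\<close>. Both rates are at most 1 + x, and x is chosen with
  \<open>(1 + x) * (1 + x) \<le> s\<close>.\<close>

lemma card_prefixes_few_bad:
  fixes Y :: "(nat \<Rightarrow> real) set" and C M s :: real
  assumes ext: "\<forall>y\<in>Y. \<forall>y'\<in>Y. \<forall>n. \<forall>e\<ge>0. (\<forall>j<W. \<bar>y (n + j) - y' (n + j)\<bar> \<le> e)
      \<longrightarrow> \<bar>y (n + W) - y' (n + W)\<bar> \<le> C * e"
    and init: "\<forall>y\<in>Y. \<forall>n<W. \<bar>y n\<bar> \<le> M" and "1 < s" "0 \<le> C"
  obtains \<kappa>0 \<delta>0 D :: real where "\<kappa>0 < 1" "0 < \<delta>0" "0 < D"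
    "\<And>\<kappa> \<delta> N. \<kappa>0 \<le> \<kappa> \<Longrightarrow> \<delta> \<le> \<delta>0 \<Longrightarrow>
      finite (round_prefix N ` {y \<in> Y. real (card (bad_indices \<kappa> N y)) \<le> \<delta> * N}) \<and>
      real (card (round_prefix N ` {y \<in> Y. real (card (bad_indices \<kappa> N y)) \<le> \<delta> * N})) \<le> D * s ^ N"
proof -
  \<comment> \<open>Chosen so that \<open>2 * C * \<rho> + 2 * \<rho>\<close> equals 1/2.\<close>
  define \<rho> where "\<rho> = 1 / (4 * (C + 1))"
  have "2 * C * \<rho> + 2 * \<rho> = 2 * ((C + 1) * \<rho>)" by (simp add: algebra_simps)
  also have "(C + 1) * \<rho> = 1/4" using \<open>0 \<le> C\<close> by (simp add: \<rho>_def)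
  finally have \<rho>: "0 < \<rho>" "\<rho> \<le> 1/4" "2 * C * \<rho> + 2 * \<rho> < 1"
    using \<open>0 \<le> C\<close> by (auto simp: \<rho>_def divide_le_eq)
  have \<kappa>0: "cos (2 * pi * \<rho>) < 1"
  proof -
    have "cos (2 * pi * \<rho>) < cos 0" using \<rho> by (intro cos_monotone_0_pi) auto
    then show ?thesis by simp
  qed
  obtain B where B: "max (C + 1) (2 * M + 1) \<le> real B" using real_arch_simple by blast
  define b where "b = real (2 * B + 1)"
  have b: "1 \<le> b" by (simp add: b_def)
  define x where "x = min 1 (sqrt s - 1)"
  have "1 < sqrt s" using \<open>1 < s\<close> by simp
  then have x: "0 < x" "x \<le> 1" "1 + x \<le> sqrt s" by (auto simp: x_def)
  have x2: "(1 + x) * (1 + x) \<le> s" using mult_mono[OF x(3) x(3)] x \<open>1 < s\<close> by auto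
  define h where "h = b ^ (W + 1) / x"
  have h: "1 \<le> h" using one_le_power[OF b, of "W+1"] x by (auto simp: h_def field_simps)
  \<comment> \<open>Makes \<open>h powr \<delta>0\<close> at most 1 + x; the summand 1 keeps the
    denominator positive when h = 1.\<close>
  define \<delta>0 where "\<delta>0 = ln (1 + x) / (ln h + 1)"
  have \<delta>0: "0 < \<delta>0" using x h by (auto simp: \<delta>0_def intro!: divide_pos_pos add_nonneg_pos)
  have h\<delta>: "h powr \<delta>0 \<le> 1 + x"
  proof -
    have "\<delta>0 * ln h \<le> \<delta>0 * (ln h + 1)" using \<delta>0 by simp
    also have "\<dots> = ln (1 + x)" using h by (auto simp: \<delta>0_def add_nonneg_eq_0_iff)
    finally have "exp (\<delta>0 * ln h) \<le> exp (ln (1 + x))" by simp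
    then show ?thesis using h x by (simp add: powr_def)
  qed
  have main: "finite (round_prefix N ` {y \<in> Y. real (card (bad_indices \<kappa> N y)) \<le> \<delta> * N}) \<and>
     real (card (round_prefix N ` {y \<in> Y. real (card (bad_indices \<kappa> N y)) \<le> \<delta> * N})) \<le> b ^ W * s ^ N"
    if \<kappa>: "cos (2 * pi * \<rho>) \<le> \<kappa>" and \<delta>: "\<delta> \<le> \<delta>0" for \<kappa> \<delta> N
  proof -
    let ?A = "round_prefix N ` {y \<in> Y. real (card (bad_indices \<kappa> N y)) \<le> \<delta> * N}"
    let ?P = "{S \<in> Pow {..<N}. real (card S) \<le> \<delta> * N}"
    let ?G = "\<lambda>S. round_prefix N ` {y \<in> Y. bad_indices \<kappa> N y = S}"
    have G: "finite (?G S) \<and> card (?G S) \<le> (2 * B + 1) ^ card {n. n < N \<and> (n < W \<or> (\<exists>j\<in>S. j \<le> n \<and> n \<le> j + W))}" for S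
      by (rule card_prefixes_given_bad[OF ext init, where \<rho> = \<rho>]) (use \<rho> \<kappa> B in auto)
    have G': "real (card (?G S)) \<le> b ^ W * (h powr \<delta>0) ^ N * x ^ card S" if "S \<in> ?P" for S
    proof -
      have fS: "finite S" using that by (auto intro: finite_subset)
      have "card (?G S) \<le> (2 * B + 1) ^ (W + card S * (W + 1))"
        using G[of S] card_after_bad_le[OF fS, of N W]
        by (meson le_add2 order_trans power_increasing)
      then have "real (card (?G S)) \<le> b ^ (W + card S * (W + 1))"
        unfolding b_def of_nat_power[symmetric] of_nat_le_iff .
      also have "\<dots> = b ^ W * (h ^ card S * x ^ card S)"
        using x by (simp only: power_add power_mult mult.commute[of "card S"])
          (simp add: h_def power_mult_distrib[symmetric] mult.commute)
      also have "h ^ card S = h powr real (card S)" using h by (simp add: powr_realpow)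
      also have "h powr real (card S) \<le> h powr (\<delta>0 * N)"
        using that h mult_right_mono[OF \<delta>, of "real N"] by (intro powr_mono) auto
      also have "h powr (\<delta>0 * N) = (h powr \<delta>0) ^ N" using h by (simp add: powr_powr[symmetric] powr_realpow)
      finally show ?thesis using b x by (simp add: mult.assoc mult_left_mono mult_right_mono)
    qed
    have sub: "?A \<subseteq> (\<Union>S\<in>?P. ?G S)"
    proof
      fix xs assume "xs \<in> ?A"
      then obtain y where "y \<in> Y" "real (card (bad_indices \<kappa> N y)) \<le> \<delta> * N" "xs = round_prefix N y" by auto
      moreover have "bad_indices \<kappa> N y \<in> Pow {..<N}" by (auto simp: bad_indices_def)
      ultimately show "xs \<in> (\<Union>S\<in>?P. ?G S)" by blast
    qed
    have fP: "finite ?P" by simp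
    have fin: "finite (\<Union>S\<in>?P. ?G S)" using G by auto
    have "card ?A \<le> card (\<Union>S\<in>?P. ?G S)" using fin sub by (rule card_mono)
    also have "\<dots> \<le> (\<Sum>S\<in>?P. card (?G S))" using fP by (rule card_UN_le)
    finally have "real (card ?A) \<le> (\<Sum>S\<in>?P. real (card (?G S)))"
      by (simp only: of_nat_le_iff of_nat_sum[symmetric])
    also have "\<dots> \<le> (\<Sum>S\<in>?P. b ^ W * (h powr \<delta>0) ^ N * x ^ card S)" using G' by (rule sum_mono)
    also have "\<dots> \<le> (\<Sum>S\<in>Pow {..<N}. b ^ W * (h powr \<delta>0) ^ N * x ^ card S)"
      using b x by (intro sum_mono2) auto
    also have "\<dots> = b ^ W * (h powr \<delta>0) ^ N * (1 + x) ^ N"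
      by (simp add: sum_distrib_left[symmetric] sum_Pow_power)
    also have "\<dots> \<le> b ^ W * (1 + x) ^ N * (1 + x) ^ N"
      using h\<delta> b x by (intro mult_right_mono mult_left_mono power_mono) auto
    also have "\<dots> = b ^ W * ((1 + x) * (1 + x)) ^ N" by (simp add: power_mult_distrib)
    also have "\<dots> \<le> b ^ W * s ^ N" using x2 b x by (intro mult_left_mono power_mono) auto
    finally show ?thesis using finite_subset[OF sub fin] by blast
  qed
  have "0 < b ^ W" using b by simp
  from that[OF \<kappa>0 \<delta>0 this main] show thesis .
qed


section \<open>Sets of Hausdorff dimension zero\<close>

text \<open>Vanishing Hausdorff content: the diameters carry no individual bound. For t > 0 this
  already forces measure zero. Finite covers may be padded by empty sets, since their diameter 0
  contributes \<open>0 powr t = 0\<close>.\<close>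

definition hausdorff_null :: "real \<Rightarrow> 'a::metric_space set \<Rightarrow> bool" where
  "hausdorff_null t E \<longleftrightarrow> (\<forall>\<epsilon>>0. \<exists>U :: nat \<Rightarrow> 'a set. E \<subseteq> (\<Union>i. U i) \<and> (\<forall>i. bounded (U i)) \<and>
     (\<Sum>i. ennreal (diameter (U i) powr t)) \<le> ennreal \<epsilon>)"

lemma ennreal_le_suminf:
  fixes f :: "nat \<Rightarrow> ennreal"
  shows "f i \<le> suminf f"
  using sum_le_suminf[OF summableI, of "{i}" f] by simp

lemma ennreal_eq_0_if_le:
  fixes x :: ennreal
  assumes "\<And>\<epsilon>. 0 < \<epsilon> \<Longrightarrow> x \<le> ennreal \<epsilon>"
  shows "x = 0"
proof -
  have "x \<le> 0" by (rule ennreal_le_epsilon) (use assms in simp)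
  then show ?thesis by simp
qed

lemma hausdorff_nullE:
  fixes E :: "'a::metric_space set"
  assumes "hausdorff_null t E" "0 < \<epsilon>"
  obtains U :: "nat \<Rightarrow> 'a set" where "E \<subseteq> (\<Union>i. U i)" "\<And>i. bounded (U i)"
    "(\<Sum>i. ennreal (diameter (U i) powr t)) \<le> ennreal \<epsilon>"
proof -
  from assms have "\<exists>U :: nat \<Rightarrow> 'a set. E \<subseteq> (\<Union>i. U i) \<and> (\<forall>i. bounded (U i)) \<and>
     (\<Sum>i. ennreal (diameter (U i) powr t)) \<le> ennreal \<epsilon>" unfolding hausdorff_null_def by simp
  then show thesis by (elim exE conjE) (rule that; simp)
qed

text \<open>If the whole sum is at most \<open>\<delta> powr t\<close>, so is each term, and every
  covering set automatically has diameter at most \<delta>.\<close>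

lemma hausdorff_measure_eq_0_if_null:
  fixes E :: "'a::metric_space set"
  assumes E: "hausdorff_null t E" and t: "0 < t"
  shows "hausdorff_measure t E = 0"
proof -
  have "hausdorff_premeasure t \<delta> E = 0" if \<delta>: "\<delta> > 0" for \<delta>
  proof -
    have "hausdorff_premeasure t \<delta> E \<le> ennreal \<epsilon>" if \<epsilon>: "0 < \<epsilon>" for \<epsilon>
    proof -
      define \<eta> where "\<eta> = min \<epsilon> (\<delta> powr t)"
      have \<eta>: "0 < \<eta>" using \<delta> \<epsilon> by (simp add: \<eta>_def)
      obtain U :: "nat \<Rightarrow> 'a set" where U: "E \<subseteq> (\<Union>i. U i)" "\<And>i. bounded (U i)"
        "(\<Sum>i. ennreal (diameter (U i) powr t)) \<le> ennreal \<eta>"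
        by (rule hausdorff_nullE[OF E \<eta>]) (rule that)
      have "diameter (U i) \<le> \<delta>" for i
      proof -
        have "ennreal (diameter (U i) powr t) \<le> (\<Sum>i. ennreal (diameter (U i) powr t))"
          by (rule ennreal_le_suminf)
        also have "\<dots> \<le> ennreal (\<delta> powr t)" using U(3) by (rule order_trans) (simp add: \<eta>_def ennreal_leI)
        finally have "diameter (U i) powr t \<le> \<delta> powr t" by simp
        then show ?thesis using powr_less_mono2[OF t, of \<delta> "diameter (U i)"] \<delta> by fastforce
      qed
      then have "hausdorff_premeasure t \<delta> E \<le> (\<Sum>i. ennreal (diameter (U i) powr t))"
        unfolding hausdorff_premeasure_def using U by (intro INF_lower) auto
      also have "\<dots> \<le> ennreal \<epsilon>" using U(3) by (rule order_trans) (simp add: \<eta>_def ennreal_leI)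
      finally show ?thesis .
    qed
    then show ?thesis by (rule ennreal_eq_0_if_le)
  qed
  then show ?thesis by (auto simp: hausdorff_measure_def intro!: antisym SUP_least)
qed

lemma hausdorff_dim_eq_0_if_null:
  assumes "\<And>t. 0 < t \<Longrightarrow> hausdorff_null t E"
  shows "hausdorff_dim E = 0"
proof -
  have "hausdorff_dim E \<le> ennreal \<epsilon>" if "0 < \<epsilon>" for \<epsilon>
    unfolding hausdorff_dim_def
    using that hausdorff_measure_eq_0_if_null[OF assms[OF that] that] by (intro INF_lower) simp
  then show ?thesis by (rule ennreal_eq_0_if_le)
qed

lemma suminf_prod_decode:
  fixes f :: "nat \<times> nat \<Rightarrow> ennreal"
  shows "(\<Sum>i. f (prod_decode i)) = (\<Sum>i. \<Sum>j. f (i, j))"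
proof -
  have "(\<Sum>i. f (prod_decode i)) = (\<integral>\<^sup>+i. f (prod_decode i) \<partial>count_space UNIV)"
    by (simp add: nn_integral_count_space_nat)
  also have "\<dots> = (\<integral>\<^sup>+x. f x \<partial>count_space UNIV)"
    by (rule nn_integral_bij_count_space) (rule bij_prod_decode)
  also have "\<dots> = (\<integral>\<^sup>+i. \<integral>\<^sup>+j. f (i, j) \<partial>count_space UNIV \<partial>count_space UNIV)"
    by (rule nn_integral_fst_count_space[symmetric])
  finally show ?thesis by (simp add: nn_integral_count_space_nat)
qed

lemma hausdorff_null_UN:
  fixes E :: "nat \<Rightarrow> 'a::metric_space set"
  assumes "\<And>q. hausdorff_null t (E q)"
  shows "hausdorff_null t (\<Union>q. E q)"
  unfolding hausdorff_null_def
proof (intro allI impI)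
  fix \<epsilon> :: real assume \<epsilon>: "0 < \<epsilon>"
  have "\<exists>U :: nat \<Rightarrow> 'a set. E q \<subseteq> (\<Union>i. U i) \<and> (\<forall>i. bounded (U i)) \<and>
     (\<Sum>i. ennreal (diameter (U i) powr t)) \<le> ennreal (\<epsilon> * (1/2) ^ Suc q)" for q
    using assms[of q] \<epsilon> unfolding hausdorff_null_def by simp
  then obtain U :: "nat \<Rightarrow> nat \<Rightarrow> 'a set" where U: "\<And>q. E q \<subseteq> (\<Union>i. U q i)" "\<And>q i. bounded (U q i)"
    "\<And>q. (\<Sum>i. ennreal (diameter (U q i) powr t)) \<le> ennreal (\<epsilon> * (1/2) ^ Suc q)"
    by metis
  have "(\<Sum>i. ennreal (diameter (case prod_decode i of (q, j) \<Rightarrow> U q j) powr t))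
      = (\<Sum>q. \<Sum>i. ennreal (diameter (U q i) powr t))"
    using suminf_prod_decode[of "\<lambda>x. ennreal (diameter (case x of (q, j) \<Rightarrow> U q j) powr t)"] by simp
  also have "\<dots> \<le> (\<Sum>q. ennreal (\<epsilon> * (1/2) ^ Suc q))" using U(3) by (intro suminf_le) auto
  also have "\<dots> = ennreal \<epsilon>"
    using sums_mult[OF power_half_series, of \<epsilon>] \<epsilon> by (intro suminf_ennreal_eq) auto
  finally have "(\<Sum>i. ennreal (diameter (case prod_decode i of (q, j) \<Rightarrow> U q j) powr t)) \<le> ennreal \<epsilon>" .
  moreover have "(\<Union>q. E q) \<subseteq> (\<Union>i. case prod_decode i of (q, j) \<Rightarrow> U q j)"
  proof
    fix x assume "x \<in> (\<Union>q. E q)"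
    then obtain q j where "x \<in> U q j" using U(1) by blast
    then show "x \<in> (\<Union>i. case prod_decode i of (q, j) \<Rightarrow> U q j)"
      by (intro UN_I[of "prod_encode (q, j)"]) auto
  qed
  moreover have "bounded (case prod_decode i of (q, j) \<Rightarrow> U q j)" for i
    using U(2) by (simp split: prod.split)
  ultimately show "\<exists>U :: nat \<Rightarrow> 'a set. (\<Union>q. E q) \<subseteq> (\<Union>i. U i) \<and> (\<forall>i. bounded (U i)) \<and>
     (\<Sum>i. ennreal (diameter (U i) powr t)) \<le> ennreal \<epsilon>" 
    by (intro exI[of _ "\<lambda>i. case prod_decode i of (q, j) \<Rightarrow> U q j"] conjI allI)
qed

lemma hausdorff_null_subset: "hausdorff_null t E \<Longrightarrow> F \<subseteq> E \<Longrightarrow> hausdorff_null t F"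
  unfolding hausdorff_null_def by (meson order_trans)

text \<open>The convergence half of Borel-Cantelli, for covers: the covers of all \<open>T N\<close>
  with N past a large n together cover the limsup set, and the N-th one costs at most a constant
  times \<open>(s / L powr t) ^ N\<close>, a convergent geometric series.\<close>

lemma hausdorff_null_limsup:
  fixes T :: "nat \<Rightarrow> 'a::metric_space set" and D D' s L t :: real
  assumes cov: "\<And>N. N \<ge> N0 \<Longrightarrow> \<exists>\<U>. finite \<U> \<and> real (card \<U>) \<le> D * s ^ N \<and> T N \<subseteq> \<Union>\<U> \<and>
      (\<forall>X\<in>\<U>. bounded X \<and> diameter X \<le> D' / L ^ N)"
    and t: "0 < t" and s: "0 < s" "s < L powr t" and pos: "0 < D" "0 < D'" "0 < L"
  shows "hausdorff_null t {x. \<exists>\<^sub>\<infinity>N. x \<in> T N}"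
  unfolding hausdorff_null_def
proof (intro allI impI)
  fix \<epsilon> :: real assume \<epsilon>: "0 < \<epsilon>"
  define u where "u = s / L powr t"
  have u: "0 < u" "u < 1" using s pos by (auto simp: u_def)
  have "(\<lambda>n. D * D' powr t * u ^ n / (1 - u)) \<longlonglongrightarrow> D * D' powr t * 0 / (1 - u)"
    using u by (intro tendsto_intros) auto
  then have "eventually (\<lambda>n. D * D' powr t * u ^ n / (1 - u) < \<epsilon>) sequentially"
    using \<epsilon> by (intro order_tendstoD) auto
  then obtain n where n: "N0 \<le> n" "D * D' powr t * u ^ n / (1 - u) < \<epsilon>"
    using eventually_happens[OF eventually_conj[OF eventually_ge_at_top[of N0]]] by auto
  define \<U> where "\<U> N = (SOME \<U>. finite \<U> \<and> real (card \<U>) \<le> D * s ^ N \<and> T N \<subseteq> \<Union>\<U> \<and>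
      (\<forall>X\<in>\<U>. bounded X \<and> diameter X \<le> D' / L ^ N))" for N
  have \<U>: "finite (\<U> N)" "real (card (\<U> N)) \<le> D * s ^ N" "T N \<subseteq> \<Union>(\<U> N)"
    "\<And>X. X \<in> \<U> N \<Longrightarrow> bounded X" "\<And>X. X \<in> \<U> N \<Longrightarrow> diameter X \<le> D' / L ^ N" if "N \<ge> N0" for N
    using someI_ex[OF cov[OF that]] unfolding \<U>_def[symmetric] by auto
  define f :: "nat \<Rightarrow> nat \<Rightarrow> 'a set" where "f N = (SOME f. bij_betw f {0..<card (\<U> N)} (\<U> N))" for N
  have f: "bij_betw (f N) {0..<card (\<U> N)} (\<U> N)" if "N \<ge> N0" for N
    unfolding f_def by (rule someI_ex[OF ex_bij_betw_nat_finite[OF \<U>(1)[OF that]]])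
  define U where "U k j = (if j < card (\<U> (n + k)) then f (n + k) j else {})" for k j
  have fU: "f (n + k) j \<in> \<U> (n + k)" if "j < card (\<U> (n + k))" for k j
    using f[of "n + k"] that n by (auto simp: bij_betw_def)
  have bd: "bounded (U k j)" for k j
    using \<U>(4)[of "n + k", OF _ fU[of j k]] n by (auto simp: U_def)
  have dm: "diameter (U k j) powr t \<le> (D' / L ^ (n + k)) powr t" if "j < card (\<U> (n + k))" for k j
    using \<U>(5)[of "n + k", OF _ fU[of j k]] n that t bd[of k j] by (intro powr_mono2) (auto simp: U_def diameter_ge_0)
  have inner: "(\<Sum>j. ennreal (diameter (U k j) powr t)) \<le> ennreal (D * D' powr t * u ^ n * u ^ k)" for k
  proof -
    have "(\<Sum>j. ennreal (diameter (U k j) powr t)) = (\<Sum>j<card (\<U> (n + k)). ennreal (diameter (U k j) powr t))"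
      by (rule suminf_finite) (auto simp: U_def)
    also have "\<dots> = ennreal (\<Sum>j<card (\<U> (n + k)). diameter (U k j) powr t)" by simp
    also have "\<dots> \<le> ennreal (D * D' powr t * u ^ n * u ^ k)"
    proof (rule ennreal_leI)
      have "(\<Sum>j<card (\<U> (n + k)). diameter (U k j) powr t)
          \<le> (\<Sum>j<card (\<U> (n + k)). (D' / L ^ (n + k)) powr t)" using dm by (intro sum_mono) auto
      also have "\<dots> = real (card (\<U> (n + k))) * (D' / L ^ (n + k)) powr t" by simp
      also have "\<dots> \<le> (D * s ^ (n + k)) * (D' / L ^ (n + k)) powr t"
        using \<U>(2)[of "n + k"] n by (intro mult_right_mono) auto
      also have "(D' / L ^ (n + k)) powr t = D' powr t / (L powr t) ^ (n + k)"
        using pos by (simp add: powr_divide powr_powr powr_realpow[symmetric] mult.commute)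
      finally show "(\<Sum>j<card (\<U> (n + k)). diameter (U k j) powr t) \<le> D * D' powr t * u ^ n * u ^ k"
        by (simp add: u_def power_divide power_add field_simps)
    qed
    finally show ?thesis .
  qed
  have "(\<Sum>i. ennreal (diameter (case prod_decode i of (k, j) \<Rightarrow> U k j) powr t))
      = (\<Sum>k. \<Sum>i. ennreal (diameter (U k i) powr t))"
    using suminf_prod_decode[of "\<lambda>x. ennreal (diameter (case x of (q, j) \<Rightarrow> U q j) powr t)"] by simp
  also have "\<dots> \<le> (\<Sum>k. ennreal (D * D' powr t * u ^ n * u ^ k))" using inner by (intro suminf_le) auto
  also have "\<dots> = ennreal (D * D' powr t * u ^ n * (1 / (1 - u)))"
    using u pos by (intro suminf_ennreal_eq sums_mult geometric_sums) auto
  also have "\<dots> \<le> ennreal \<epsilon>" using n by (intro ennreal_leI) simp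
  finally have "(\<Sum>i. ennreal (diameter (case prod_decode i of (k, j) \<Rightarrow> U k j) powr t)) \<le> ennreal \<epsilon>" .
  moreover have "{x. \<exists>\<^sub>\<infinity>N. x \<in> T N} \<subseteq> (\<Union>i. case prod_decode i of (k, j) \<Rightarrow> U k j)"
  proof
    fix x assume "x \<in> {x. \<exists>\<^sub>\<infinity>N. x \<in> T N}"
    then obtain N where N: "n \<le> N" "x \<in> T N" by (auto simp: INFM_nat_le)
    then obtain X where X: "X \<in> \<U> N" "x \<in> X" using \<U>(3)[of N] n by auto
    then have "X \<in> f N ` {0..<card (\<U> N)}" using bij_betw_imp_surj_on[OF f[of N]] n N by simp
    then obtain j where j: "j < card (\<U> N)" "f N j = X" by auto
    then have "x \<in> U (N - n) j" using X N by (simp add: U_def)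
    then show "x \<in> (\<Union>i. case prod_decode i of (k, j) \<Rightarrow> U k j)"
      by (intro UN_I[of "prod_encode (N - n, j)"]) auto
  qed
  moreover have "bounded (case prod_decode i of (k, j) \<Rightarrow> U k j)" for i
    using bd by (simp split: prod.split)
  ultimately show "\<exists>U :: nat \<Rightarrow> 'a set. {x. \<exists>\<^sub>\<infinity>N. x \<in> T N} \<subseteq> (\<Union>i. U i) \<and> (\<forall>i. bounded (U i)) \<and>
     (\<Sum>i. ennreal (diameter (U i) powr t)) \<le> ennreal \<epsilon>" 
    by (intro exI[of _ "\<lambda>i. case prod_decode i of (k, j) \<Rightarrow> U k j"] conjI allI)
qed

text \<open>A set of diameter D lies in the interval of length 2 * D centred at any of its points,
  whence covers of total size \<epsilon> / 2.\<close>

lemma emeasure_lborel_eq_0_if_null: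
  fixes E :: "real set"
  assumes "hausdorff_null 1 E" "E \<in> sets lborel"
  shows "emeasure lborel E = 0"
proof -
  have "emeasure lborel E \<le> ennreal \<epsilon>" if \<epsilon>: "0 < \<epsilon>" for \<epsilon>
  proof -
    obtain U :: "nat \<Rightarrow> real set" where U: "E \<subseteq> (\<Union>i. U i)" "\<And>i. bounded (U i)"
      "(\<Sum>i. ennreal (diameter (U i) powr 1)) \<le> ennreal (\<epsilon> / 2)"
      by (rule hausdorff_nullE[OF assms(1) half_gt_zero[OF \<epsilon>]]) (rule that)
    have "\<exists>x. U i \<subseteq> cball x (diameter (U i))" for i
    proof (cases "U i = {}")
      case False
      then obtain x where "x \<in> U i" by blast
      then have "U i \<subseteq> cball x (diameter (U i))" using diameter_bounded_bound[OF U(2)] by auto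
      then show ?thesis by blast
    qed auto
    then obtain x where x: "\<And>i. U i \<subseteq> cball (x i) (diameter (U i))" by metis
    have "E \<subseteq> (\<Union>i. cball (x i) (diameter (U i)))" using U(1) x by fastforce
    then have "emeasure lborel E \<le> emeasure lborel (\<Union>i. cball (x i) (diameter (U i)))"
      by (intro emeasure_mono) (auto intro!: sets.countable_UN borel_closed)
    also have "\<dots> \<le> (\<Sum>i. emeasure lborel (cball (x i) (diameter (U i))))"
      by (intro emeasure_subadditive_countably) (auto intro!: borel_closed)
    also have "\<dots> = (\<Sum>i. ennreal 2 * ennreal (diameter (U i) powr 1))"
      using diameter_ge_0[OF U(2)]
      by (intro suminf_cong) (simp add: cball_eq_atLeastAtMost ennreal_mult[symmetric] del: ennreal_numeral)
    also have "\<dots> = ennreal 2 * (\<Sum>i. ennreal (diameter (U i) powr 1))"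
      by (rule ennreal_suminf_cmult)
    also have "\<dots> \<le> ennreal 2 * ennreal (\<epsilon> / 2)" using U(3) by (rule mult_left_mono) simp
    also have "\<dots> = ennreal \<epsilon>" using \<epsilon> by (simp add: ennreal_mult[symmetric] del: ennreal_numeral)
    finally show ?thesis .
  qed
  then show ?thesis by (rule ennreal_eq_0_if_le)
qed


section \<open>The Erdos--Kahane argument\<close>

lemma diff_op_eq_0:
  assumes "finite I" and y: "\<And>n. y n = (\<Sum>i\<in>I. b i * l i ^ n)" and sub: "l ` I \<subseteq> set zs"
  shows "diff_op zs y n = 0"
proof -
  have "(\<Prod>z\<leftarrow>zs. l i - z) = 0" if "i \<in> I" for i
    using sub that by (auto simp: prod_list_zero_iff)
  moreover have "y = (\<lambda>n. \<Sum>i\<in>I. b i * l i ^ n)" using y by blast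
  ultimately show ?thesis by (simp add: diff_op_exp_sum)
qed

lemma prod_list_diff_map: "distinct is \<Longrightarrow> (\<Prod>z\<leftarrow>map l is. x - z) = (\<Prod>i\<in>set is. x - l i :: complex)"
  by (simp add: prod.distinct_set_conv_list o_def)

text \<open>With the frequencies of both sequences as roots the operator has degree
  \<open>2 * card I\<close> and kills the difference; being monic, it then expresses the last
  difference by the window before it.\<close>

lemma exp_sums_extend:
  fixes l l' :: "'i \<Rightarrow> complex" and y y' :: "nat \<Rightarrow> real"
  assumes I: "finite I" and R: "0 \<le> R" "\<And>i. i \<in> I \<Longrightarrow> cmod (l i) \<le> R" "\<And>i. i \<in> I \<Longrightarrow> cmod (l' i) \<le> R"
    and y: "\<And>n. of_real (y n) = (\<Sum>i\<in>I. b i * l i ^ n)"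
    and y': "\<And>n. of_real (y' n) = (\<Sum>i\<in>I. b' i * l' i ^ n)"
    and close: "\<And>j. j < 2 * card I \<Longrightarrow> \<bar>y (n + j) - y' (n + j)\<bar> \<le> e" and e: "0 \<le> e"
  shows "\<bar>y (n + 2 * card I) - y' (n + 2 * card I)\<bar> \<le> ((1 + R) ^ (2 * card I) - 1) * e"
proof -
  obtain "is" where i: "set is = I" "distinct is" using finite_distinct_list[OF I] by blast
  define zs where "zs = map l is @ map l' is"
  have len: "length zs = 2 * card I" using distinct_card[OF i(2)] i(1) by (simp add: zs_def)
  have "diff_op zs (\<lambda>n. of_real (y n)) n = 0" "diff_op zs (\<lambda>n. of_real (y' n)) n = 0"
    by (rule diff_op_eq_0[OF I y], use i in \<open>auto simp: zs_def\<close>)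
       (rule diff_op_eq_0[OF I y'], use i in \<open>auto simp: zs_def\<close>)
  then have 0: "diff_op zs (\<lambda>n. of_real (y n) - of_real (y' n)) n = 0" by (simp add: diff_op_diff)
  have "cmod (diff_op zs (\<lambda>n. of_real (y n) - of_real (y' n)) n - (of_real (y (n + length zs)) - of_real (y' (n + length zs))))
      \<le> ((1 + R) ^ length zs - 1) * e"
  proof (rule norm_diff_op_minus_last_le)
    show "cmod z \<le> R" if "z \<in> set zs" for z using that i R by (auto simp: zs_def)
    show "cmod (of_real (y (n + j)) - of_real (y' (n + j))) \<le> e" if "j < length zs" for j
      using close[of j] that by (simp add: len flip: of_real_diff)
  qed (use R e in auto)
  then show ?thesis unfolding 0 len by (simp add: norm_minus_commute flip: of_real_diff)
qed

text \<open>Applied to differences bounded by 1, the operator leaves one term: \<open>b u\<close>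
  times the two products in \<open>sep\<close> times \<open>l u ^ n\<close>. The first three factors
  each contribute one \<kappa> to the lower bound, hence \<open>\<kappa> ^ 3\<close>, and the growth
  of \<open>l u ^ n\<close> forces d to be of order L ^ (- N).\<close>

lemma exp_sums_params_close:
  fixes l l' :: "'i \<Rightarrow> complex" and y y' :: "nat \<Rightarrow> real"
  assumes I: "finite I" and R: "0 \<le> R" "\<And>i. i \<in> I \<Longrightarrow> cmod (l i) \<le> R" "\<And>i. i \<in> I \<Longrightarrow> cmod (l' i) \<le> R"
    and y: "\<And>n. of_real (y n) = (\<Sum>i\<in>I. b i * l i ^ n)"
    and y': "\<And>n. of_real (y' n) = (\<Sum>i\<in>I. b' i * l' i ^ n)"
    and close: "\<And>j. j < N \<Longrightarrow> \<bar>y j - y' j\<bar> \<le> 1" and N: "2 * card I \<le> N"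
    and u: "u \<in> I" "\<kappa> \<le> cmod (b u)" "0 < \<kappa>" and L: "0 < L" "L \<le> cmod (l u)"
    and sep: "\<kappa> * d \<le> cmod (\<Prod>i\<in>I. l u - l' i)" "\<kappa> \<le> cmod (\<Prod>i\<in>I - {u}. l u - l i)" and d: "0 \<le> d"
  shows "d \<le> (1 + R) ^ (2 * card I) * L ^ (2 * card I) / \<kappa> ^ 3 / L ^ N"
proof -
  obtain "is" where i: "set is = I" "distinct is" using finite_distinct_list[OF I] by blast
  obtain js where j: "set js = I - {u}" "distinct js" using finite_distinct_list[of "I - {u}"] I by blast
  define zs where "zs = map l' is @ map l js"
  \<comment> \<open>The operator has degree \<open>2 * card I - 1\<close>, so at n it reads the
    indices n to N - 1, the last window inside the common prefix.\<close>
  define n where "n = N - 2 * card I"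
  have len: "Suc (length zs) = 2 * card I"
    using distinct_card[OF i(2)] distinct_card[OF j(2)] i(1) j(1) u card_Suc_Diff1[OF I u(1)]
    by (simp add: zs_def)
  have "diff_op zs (\<lambda>n. of_real (y' n)) n = 0"
    by (rule diff_op_eq_0[OF I y']) (use i in \<open>auto simp: zs_def\<close>)
  moreover have "diff_op zs (\<lambda>n. of_real (y n)) n = (\<Sum>v\<in>I. b v * (\<Prod>z\<leftarrow>zs. l v - z) * l v ^ n)"
    unfolding y by (rule diff_op_exp_sum)
  moreover have "\<dots> = (\<Sum>v\<in>{u}. b v * (\<Prod>z\<leftarrow>zs. l v - z) * l v ^ n)"
  proof (rule sum.mono_neutral_right[OF I])
    show "\<forall>v\<in>I - {u}. b v * (\<Prod>z\<leftarrow>zs. l v - z) * l v ^ n = 0"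
      using j by (auto simp: zs_def prod_list_zero_iff)
  qed (use u in auto)
  moreover have "(\<Prod>z\<leftarrow>zs. l u - z) = (\<Prod>i\<in>I. l u - l' i) * (\<Prod>i\<in>I - {u}. l u - l i)"
    using prod_list_diff_map[OF i(2), of "l u" l'] prod_list_diff_map[OF j(2), of "l u" l] i j
    by (simp add: zs_def)
  ultimately have eq: "diff_op zs (\<lambda>n. of_real (y n) - of_real (y' n)) n
      = b u * ((\<Prod>i\<in>I. l u - l' i) * (\<Prod>i\<in>I - {u}. l u - l i)) * l u ^ n"
    by (simp add: diff_op_diff)
  have "cmod (diff_op zs (\<lambda>n. of_real (y n) - of_real (y' n)) n) \<le> (1 + R) ^ length zs * 1"
  proof (rule norm_diff_op_le)
    show "cmod z \<le> R" if "z \<in> set zs" for z using that i j R by (auto simp: zs_def)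
    show "cmod (of_real (y (n + j)) - of_real (y' (n + j))) \<le> 1" if "j \<le> length zs" for j
      using close[of "n + j"] that N len by (simp add: n_def flip: of_real_diff)
  qed (use R in auto)
  also have "\<dots> \<le> (1 + R) ^ (2 * card I)" using len R by (simp add: power_increasing)
  finally have "cmod (b u) * (cmod (\<Prod>i\<in>I. l u - l' i) * cmod (\<Prod>i\<in>I - {u}. l u - l i)) * cmod (l u) ^ n
      \<le> (1 + R) ^ (2 * card I)" unfolding eq norm_mult norm_power .
  moreover have "\<kappa> * ((\<kappa> * d) * \<kappa>) * L ^ n
      \<le> cmod (b u) * (cmod (\<Prod>i\<in>I. l u - l' i) * cmod (\<Prod>i\<in>I - {u}. l u - l i)) * cmod (l u) ^ n"
    using u L sep d by (intro mult_mono power_mono) auto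
  ultimately have "\<kappa> ^ 3 * d * L ^ n \<le> (1 + R) ^ (2 * card I)"
    by (simp add: power3_eq_cube mult_ac)
  then have "\<kappa> ^ 3 * d * L ^ n * L ^ (2 * card I) \<le> (1 + R) ^ (2 * card I) * L ^ (2 * card I)"
    using L by (intro mult_right_mono) auto
  moreover have "L ^ n * L ^ (2 * card I) = L ^ N" using N by (simp add: n_def flip: power_add)
  ultimately have "\<kappa> ^ 3 * d * L ^ N \<le> (1 + R) ^ (2 * card I) * L ^ (2 * card I)"
    by (simp add: mult.assoc)
  then show ?thesis using u L by (simp add: field_simps)
qed

lemma diameter_le_if_dist_le:
  fixes X :: "'a::metric_space set"
  assumes "\<And>x y. x \<in> X \<Longrightarrow> y \<in> X \<Longrightarrow> dist x y \<le> d" "0 \<le> d"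
  shows "bounded X \<and> diameter X \<le> d"
proof
  show "bounded X" using assms unfolding bounded_def by (cases "X = {}") blast+
  show "diameter X \<le> d" using assms by (auto simp: diameter_def intro!: cSUP_least)
qed

text \<open>One index k drives both the threshold and the allowed proportion, and both demands
  tighten as k grows. Failure for a single k means a positive proportion of indices that are bad by
  a definite margin.\<close>

definition rarely_bad :: "nat \<Rightarrow> nat \<Rightarrow> (nat \<Rightarrow> real) \<Rightarrow> bool" where
  "rarely_bad k N y \<longleftrightarrow> real (card (bad_indices (1 - 1 / (real k + 1)) N y)) \<le> real N / (real k + 1)"

text \<open>An abstract family covers both parts: I indexes all frequencies, U those that can
  separate parameters. The constants \<kappa>, L, R and M are common to the whole class Y, so prefix
  counts and diameters are uniform. For each \<tau> one suitable k gives a null set that contains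
  the intersection.\<close>

theorem erdos_kahane:
  fixes lam :: "'p::metric_space \<Rightarrow> 'i \<Rightarrow> complex" and Y :: "('p \<times> (nat \<Rightarrow> real)) set"
  assumes I: "finite I" "U \<subseteq> I" and R: "0 \<le> R" "\<And>t i. t \<in> P \<Longrightarrow> i \<in> I \<Longrightarrow> cmod (lam t i) \<le> R"
    and L: "1 < L" "\<And>t u. t \<in> P \<Longrightarrow> u \<in> U \<Longrightarrow> L \<le> cmod (lam t u)" and \<kappa>: "0 < \<kappa>"
    and sep: "\<And>t t' u. t \<in> P \<Longrightarrow> t' \<in> P \<Longrightarrow> u \<in> U \<Longrightarrow> \<kappa> * dist t t' \<le> cmod (\<Prod>i\<in>I. lam t u - lam t' i)"
      "\<And>t u. t \<in> P \<Longrightarrow> u \<in> U \<Longrightarrow> \<kappa> \<le> cmod (\<Prod>i\<in>I - {u}. lam t u - lam t i)"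
    and Y: "\<And>t y. (t, y) \<in> Y \<Longrightarrow> t \<in> P"
      "\<And>t y. (t, y) \<in> Y \<Longrightarrow> \<exists>b. (\<forall>n. of_real (y n) = (\<Sum>i\<in>I. b i * lam t i ^ n)) \<and> (\<exists>u\<in>U. \<kappa> \<le> cmod (b u))"
      "\<And>t y n. (t, y) \<in> Y \<Longrightarrow> n < 2 * card I \<Longrightarrow> \<bar>y n\<bar> \<le> M"
    and \<tau>: "0 < \<tau>"
  shows "hausdorff_null \<tau> (\<Inter>k. {t. \<exists>\<^sub>\<infinity>N. \<exists>y. (t, y) \<in> Y \<and> rarely_bad k N y})"
proof -
  define W where "W = 2 * card I"
  define C where "C = (1 + R) ^ W - 1"
  \<comment> \<open>With a rate strictly between 1 and \<open>L powr \<tau>\<close>, about s ^ N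
    covering sets of diameter of order L ^ (- N) are summable at exponent \<tau>.\<close>
  define s where "s = (1 + L powr \<tau>) / 2"
  have "1 < L powr \<tau>" using L \<tau> by simp
  then have s: "1 < s" "s < L powr \<tau>" by (auto simp: s_def)
  have "0 \<le> C" using R by (simp add: C_def)
  have ext: "\<forall>y\<in>snd ` Y. \<forall>y'\<in>snd ` Y. \<forall>n. \<forall>e\<ge>0. (\<forall>j<W. \<bar>y (n + j) - y' (n + j)\<bar> \<le> e)
      \<longrightarrow> \<bar>y (n + W) - y' (n + W)\<bar> \<le> C * e"
  proof (intro ballI allI impI)
    fix y y' n and e :: real
    assume y: "y \<in> snd ` Y" "y' \<in> snd ` Y" and e: "0 \<le> e" "\<forall>j<W. \<bar>y (n + j) - y' (n + j)\<bar> \<le> e"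
    obtain t t' where t: "(t, y) \<in> Y" "(t', y') \<in> Y" using y by force
    obtain b b' where b: "\<And>n. of_real (y n) = (\<Sum>i\<in>I. b i * lam t i ^ n)"
      "\<And>n. of_real (y' n) = (\<Sum>i\<in>I. b' i * lam t' i ^ n)"
      using Y(2)[OF t(1)] Y(2)[OF t(2)] by auto
    show "\<bar>y (n + W) - y' (n + W)\<bar> \<le> C * e" unfolding C_def W_def
      by (rule exp_sums_extend[OF I(1) R(1) _ _ b]) (use e t Y(1) R(2) W_def in auto)
  qed
  have init: "\<forall>y\<in>snd ` Y. \<forall>n<W. \<bar>y n\<bar> \<le> M" using Y(3) by (auto simp: W_def)
  obtain \<kappa>0 \<delta>0 D :: real where D: "\<kappa>0 < 1" "0 < \<delta>0" "0 < D"
    "\<And>\<kappa> \<delta> N. \<kappa>0 \<le> \<kappa> \<Longrightarrow> \<delta> \<le> \<delta>0 \<Longrightarrow>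
      finite (round_prefix N ` {y \<in> snd ` Y. real (card (bad_indices \<kappa> N y)) \<le> \<delta> * N}) \<and>
      real (card (round_prefix N ` {y \<in> snd ` Y. real (card (bad_indices \<kappa> N y)) \<le> \<delta> * N})) \<le> D * s ^ N"
    by (rule card_prefixes_few_bad[OF ext init s(1) \<open>0 \<le> C\<close>]) (rule that)
  obtain k :: nat where k: "max (1 / (1 - \<kappa>0)) (1 / \<delta>0) \<le> real k" using real_arch_simple by blast
  have k': "\<kappa>0 \<le> 1 - 1 / (real k + 1)" "1 / (real k + 1) \<le> \<delta>0"
  proof -
    have "1 \<le> real k * (1 - \<kappa>0)" "1 \<le> real k * \<delta>0" using k D by (auto simp: divide_le_eq)
    then have "1 \<le> (real k + 1) * (1 - \<kappa>0)" "1 \<le> (real k + 1) * \<delta>0" using D by (auto simp: algebra_simps)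
    then show "\<kappa>0 \<le> 1 - 1 / (real k + 1)" "1 / (real k + 1) \<le> \<delta>0" by (auto simp: field_simps)
  qed
  define D' where "D' = (1 + R) ^ W * L ^ W / \<kappa> ^ 3"
  have D': "0 < D'" using R L \<kappa> by (auto simp: D'_def intro!: divide_pos_pos mult_pos_pos)
  have "hausdorff_null \<tau> {t. \<exists>\<^sub>\<infinity>N. t \<in> {t. \<exists>y. (t, y) \<in> Y \<and> rarely_bad k N y}}"
  proof (rule hausdorff_null_limsup[where ?N0.0 = W])
    fix N assume N: "W \<le> N"
    let ?X = "round_prefix N ` {y \<in> snd ` Y. rarely_bad k N y}"
    \<comment> \<open>The covering sets collect the parameters that realise a given prefix; a
      parameter with several sequences may lie in several of them.\<close>
    let ?V = "\<lambda>xs. {t. \<exists>y. (t, y) \<in> Y \<and> rarely_bad k N y \<and> round_prefix N y = xs}"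
    have X: "finite ?X" "real (card ?X) \<le> D * s ^ N"
      using D(4)[OF k', of N] by (simp_all add: rarely_bad_def)
    have "bounded (?V xs) \<and> diameter (?V xs) \<le> D' / L ^ N" for xs
    proof (rule diameter_le_if_dist_le)
      fix t t' assume "t \<in> ?V xs" "t' \<in> ?V xs"
      then obtain y y' where y: "(t, y) \<in> Y" "(t', y') \<in> Y" "round_prefix N y = round_prefix N y'" by auto
      obtain b u where b: "\<And>n. of_real (y n) = (\<Sum>i\<in>I. b i * lam t i ^ n)" "u \<in> U" "\<kappa> \<le> cmod (b u)"
        using Y(2)[OF y(1)] by auto
      obtain b' where b': "\<And>n. of_real (y' n) = (\<Sum>i\<in>I. b' i * lam t' i ^ n)"
        using Y(2)[OF y(2)] by auto
      have "\<bar>y j - y' j\<bar> \<le> 1" if "j < N" for j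
      proof -
        have "round (y j) = round (y' j)" using y(3) that by (simp add: round_prefix_eq_iff)
        then show ?thesis using abs_minus_round_le[of "y j"] abs_minus_round_le[of "y' j"] by linarith
      qed
      then show "dist t t' \<le> D' / L ^ N" unfolding D'_def W_def
        by (intro exp_sums_params_close[OF I(1) R(1) _ _ b(1) b', of N u])
          (use y Y(1) R(2) b L I N \<kappa> sep W_def in auto)
    qed (use D' L in auto)
    moreover have "real (card (?V ` ?X)) \<le> D * s ^ N"
      using X card_image_le[OF X(1), of ?V] by linarith
    moreover have "{t. \<exists>y. (t, y) \<in> Y \<and> rarely_bad k N y} \<subseteq> \<Union>(?V ` ?X)" by force
    ultimately show "\<exists>\<U>. finite \<U> \<and> real (card \<U>) \<le> D * s ^ N \<and>
        {t. \<exists>y. (t, y) \<in> Y \<and> rarely_bad k N y} \<subseteq> \<Union>\<U> \<and> (\<forall>X\<in>\<U>. bounded X \<and> diameter X \<le> D' / L ^ N)"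
      using X(1) by (intro exI[of _ "?V ` ?X"] conjI) blast+
  qed (use s \<tau> D D' L in auto)
  then show ?thesis by (rule hausdorff_null_subset) auto
qed


section \<open>Fourier decay of self-similar measures\<close>

text \<open>Self-similarity says that \<mu> is the law of \<open>A x + a j\<close>, with j
  distributed by p and x distributed by \<mu>, independently. Change of variables and Fubini on this
  product give the formula for all bounded g at once.\<close>

lemma self_similar_integral:
  fixes A :: "'a::euclidean_space \<Rightarrow> 'a" and g :: "'a \<Rightarrow> complex"
  assumes ss: "is_self_similar_measure A m a p \<mu>" and p: "positive_prob_vector m p"
    and A: "A \<in> borel_measurable borel" and g: "g \<in> borel_measurable borel" "\<And>x. cmod (g x) \<le> B"
  shows "(\<integral>x. g x \<partial>\<mu>) = (\<Sum>j\<le>m. of_real (p j) * (\<integral>x. g (A x + a j) \<partial>\<mu>))"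
proof -
  interpret \<mu>: prob_space \<mu> using ss by (simp add: is_self_similar_measure_def)
  have sets\<mu> [measurable_cong]: "sets \<mu> = sets borel" using ss by (simp add: is_self_similar_measure_def)
  define P where "P = point_measure {..m} (\<lambda>j. ennreal (p j))"
  have pp: "0 \<le> p j" if "j \<le> m" for j using p that by (auto simp: positive_prob_vector_def less_imp_le)
  interpret P: prob_space P
    unfolding P_def
  proof (rule prob_space_point_measure)
    have "(\<Sum>j\<le>m. ennreal (p j)) = ennreal (\<Sum>j\<le>m. p j)" using pp by (intro sum_ennreal) auto
    then show "(\<Sum>j\<le>m. ennreal (p j)) = 1" using p by (simp add: positive_prob_vector_def)
  qed auto
  interpret PM: pair_prob_space P \<mu> ..
  define h where "h = (\<lambda>(j, x). A x + a j)"
  have setsP: "sets P = sets (count_space {..m})" by (simp add: P_def sets_point_measure)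
  have hm: "h \<in> P \<Otimes>\<^sub>M \<mu> \<rightarrow>\<^sub>M borel"
  proof -
    have "h \<in> count_space {..m} \<Otimes>\<^sub>M \<mu> \<rightarrow>\<^sub>M borel"
    proof (rule measurable_pair_measure_countable1)
      fix j show "(\<lambda>y. h (j, y)) \<in> \<mu> \<rightarrow>\<^sub>M borel" unfolding h_def using A by simp
    qed auto
    then show ?thesis
      using measurable_cong_sets[OF sets_pair_measure_cong[OF setsP refl] refl] by blast
  qed
  have eq: "\<mu> = distr (P \<Otimes>\<^sub>M \<mu>) borel h"
  proof (rule measure_eqI)
    fix X assume X: "X \<in> sets \<mu>"
    have X': "X \<in> sets borel" using X sets\<mu> by simp
    have "emeasure (distr (P \<Otimes>\<^sub>M \<mu>) borel h) X = emeasure (P \<Otimes>\<^sub>M \<mu>) (h -` X \<inter> space (P \<Otimes>\<^sub>M \<mu>))"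
      using hm X' by (rule emeasure_distr)
    also have "\<dots> = (\<integral>\<^sup>+j. emeasure \<mu> (Pair j -` (h -` X \<inter> space (P \<Otimes>\<^sub>M \<mu>))) \<partial>P)"
      using measurable_sets[OF hm X'] by (rule \<mu>.emeasure_pair_measure_alt)
    also have "\<dots> = (\<Sum>j\<le>m. emeasure \<mu> (Pair j -` (h -` X \<inter> space (P \<Otimes>\<^sub>M \<mu>))) * ennreal (p j))"
      unfolding P_def by (subst nn_integral_point_measure_finite) (auto simp: mult.commute)
    also have "\<dots> = (\<Sum>j\<le>m. ennreal (p j * measure \<mu> ((\<lambda>x. A x + a j) -` X)))"
    proof (rule sum.cong)
      fix j assume j: "j \<in> {..m}"
      have "Pair j -` (h -` X \<inter> space (P \<Otimes>\<^sub>M \<mu>)) = (\<lambda>x. A x + a j) -` X"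
        using j sets_eq_imp_space_eq[OF sets\<mu>] by (auto simp: h_def space_pair_measure P_def space_point_measure)
      then show "emeasure \<mu> (Pair j -` (h -` X \<inter> space (P \<Otimes>\<^sub>M \<mu>))) * ennreal (p j)
          = ennreal (p j * measure \<mu> ((\<lambda>x. A x + a j) -` X))"
        using pp j by (simp add: \<mu>.emeasure_eq_measure ennreal_mult'[symmetric] mult.commute)
    qed simp
    also have "\<dots> = ennreal (\<Sum>j\<le>m. p j * measure \<mu> ((\<lambda>x. A x + a j) -` X))"
      using pp by (intro sum_ennreal) auto
    also have "(\<Sum>j\<le>m. p j * measure \<mu> ((\<lambda>x. A x + a j) -` X)) = measure \<mu> X"
      using ss X' by (auto simp: is_self_similar_measure_def)
    finally show "emeasure \<mu> X = emeasure (distr (P \<Otimes>\<^sub>M \<mu>) borel h) X"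
      by (simp add: \<mu>.emeasure_eq_measure)
  qed (use sets\<mu> in simp)
  have int: "integrable (P \<Otimes>\<^sub>M \<mu>) (\<lambda>x. g (h x))"
    using g(2) measurable_compose[OF hm g(1)]
    by (intro PM.P.integrable_const_bound[where B = B]) auto
  have "(\<integral>x. g x \<partial>\<mu>) = (\<integral>x. g x \<partial>distr (P \<Otimes>\<^sub>M \<mu>) borel h)" using eq by simp
  also have "\<dots> = (\<integral>x. g (h x) \<partial>(P \<Otimes>\<^sub>M \<mu>))" using hm g(1) by (rule integral_distr)
  also have "\<dots> = (\<integral>j. \<integral>x. g (h (j, x)) \<partial>\<mu> \<partial>P)" using PM.integral_fst'[OF int] by simp
  also have "\<dots> = (\<Sum>j\<le>m. p j *\<^sub>R (\<integral>x. g (h (j, x)) \<partial>\<mu>))"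
    unfolding P_def using pp by (intro lebesgue_integral_point_measure_finite) auto
  finally show ?thesis by (simp add: h_def scaleR_conv_of_real)
qed

text \<open>The Fourier transform of the discrete measure that puts mass \<open>p j\<close> at
  \<open>a j\<close>.\<close>

definition digit_mask :: "nat \<Rightarrow> (nat \<Rightarrow> 'a::euclidean_space) \<Rightarrow> (nat \<Rightarrow> real) \<Rightarrow> 'a \<Rightarrow> complex" where
  "digit_mask m a p \<xi> = (\<Sum>j\<le>m. of_real (p j) * cis (- (2 * pi * (\<xi> \<bullet> a j))))"

lemma fourier_eq_cis: "fourier \<mu> \<xi> = (\<integral>x. cis (- (2 * pi * (\<xi> \<bullet> x))) \<partial>\<mu>)"
  unfolding fourier_def by (simp add: cis_conv_exp mult_ac)

text \<open>The measure \<mu> is the convolution of the digit distribution with the image of \<mu>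
  under A; \<open>adj\<close> identifies \<eta> as the adjoint of A applied to \<xi>.\<close>

lemma fourier_self_similar:
  fixes A :: "'a::euclidean_space \<Rightarrow> 'a"
  assumes ss: "is_self_similar_measure A m a p \<mu>" and p: "positive_prob_vector m p"
    and A: "A \<in> borel_measurable borel" and adj: "\<And>x. \<xi> \<bullet> A x = \<eta> \<bullet> x"
  shows "fourier \<mu> \<xi> = digit_mask m a p \<xi> * fourier \<mu> \<eta>"
proof -
  have [measurable]: "(\<lambda>x. cis (- (2 * pi * (\<xi> \<bullet> x)))) \<in> borel_measurable borel" for \<xi> :: 'a
    unfolding cis_conv_exp by measurable
  have "fourier \<mu> \<xi> = (\<Sum>j\<le>m. of_real (p j) * (\<integral>x. cis (- (2 * pi * (\<xi> \<bullet> (A x + a j)))) \<partial>\<mu>))"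
    unfolding fourier_eq_cis by (rule self_similar_integral[OF ss p A, where B = 1]) auto
  also have "\<dots> = (\<Sum>j\<le>m. of_real (p j) * (\<integral>x. cis (- (2 * pi * (\<xi> \<bullet> a j))) * cis (- (2 * pi * (\<eta> \<bullet> x))) \<partial>\<mu>))"
    by (simp add: inner_add_right adj cis_mult algebra_simps)
  finally show ?thesis by (simp add: digit_mask_def fourier_eq_cis sum_distrib_right mult.assoc)
qed

lemma norm_fourier_le_1: "prob_space \<mu> \<Longrightarrow> cmod (fourier \<mu> \<xi>) \<le> 1"
  unfolding fourier_eq_cis
  using integral_norm_bound[of \<mu> "\<lambda>x. cis (- (2 * pi * (\<xi> \<bullet> x)))"] by (simp add: prob_space.prob_space)

lemma norm_digit_mask_le_1: "positive_prob_vector m p \<Longrightarrow> cmod (digit_mask m a p \<xi>) \<le> 1"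
  unfolding digit_mask_def positive_prob_vector_def
  by (rule order_trans[OF norm_sum]) (simp add: norm_mult less_imp_le)

text \<open>Only the digits 0 and j are played against each other; the rest is bounded by its total
  mass. The squared modulus of the pair is
  \<open>(p 0 + p j)\<^sup>2 - 2 * p 0 * p j * (1 - cos x)\<close>, and because
  \<open>p 0 + p j \<le> 1\<close> it is at most the square of
  \<open>p 0 + p j - p 0 * p j * (1 - \<kappa>)\<close>.\<close>

lemma norm_digit_mask_le:
  assumes p: "positive_prob_vector m p" and a: "a 0 = 0" and j: "1 \<le> j" "j \<le> m"
    and \<kappa>: "cos (2 * pi * (\<xi> \<bullet> a j)) \<le> \<kappa>" "\<kappa> \<le> 1"
  shows "cmod (digit_mask m a p \<xi>) \<le> 1 - p 0 * p j * (1 - \<kappa>)"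
proof -
  define x where "x = - (2 * pi * (\<xi> \<bullet> a j))"
  let ?f = "\<lambda>j. of_real (p j) * cis (- (2 * pi * (\<xi> \<bullet> a j)))"
  have pos: "0 < p i" if "i \<le> m" for i using p that by (auto simp: positive_prob_vector_def)
  have p0: "0 < p 0" "0 < p j" using pos j by auto
  have split: "(\<Sum>i\<le>m. f i) = f 0 + f j + (\<Sum>i\<in>{..m} - {0, j}. f i)" for f :: "nat \<Rightarrow> 'b::comm_monoid_add"
    using j by (subst sum.subset_diff[of "{0, j}"]) (auto simp: add.commute)
  have one: "p 0 + p j + (\<Sum>i\<in>{..m} - {0, j}. p i) = 1"
    using p split[of p] by (auto simp: positive_prob_vector_def)
  moreover have "0 \<le> (\<Sum>i\<in>{..m} - {0, j}. p i)" using pos by (intro sum_nonneg) (auto simp: less_imp_le)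
  ultimately have le1: "p 0 + p j \<le> 1" by linarith
  have "(cmod (of_real (p 0) + of_real (p j) * cis x))\<^sup>2 = (p 0 + p j)\<^sup>2 - 2 * p 0 * p j * (1 - cos x)"
  proof -
    have "(cmod (of_real (p 0) + of_real (p j) * cis x))\<^sup>2 = (p 0 + p j * cos x)\<^sup>2 + (p j * sin x)\<^sup>2"
      by (simp add: cmod_power2)
    also have "\<dots> = (p 0)\<^sup>2 + 2 * p 0 * p j * cos x + (p j)\<^sup>2 * ((sin x)\<^sup>2 + (cos x)\<^sup>2)"
      by algebra
    finally show ?thesis unfolding sin_cos_squared_add by (simp add: power2_eq_square algebra_simps)
  qed
  also have "\<dots> \<le> (p 0 + p j)\<^sup>2 - 2 * p 0 * p j * (1 - \<kappa>)"
    using \<kappa> p0 by (simp add: x_def)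
  also have "\<dots> \<le> (p 0 + p j - p 0 * p j * (1 - \<kappa>))\<^sup>2"
  proof -
    have "(p 0 + p j) * (p 0 * p j * (1 - \<kappa>)) \<le> 1 * (p 0 * p j * (1 - \<kappa>))"
      using le1 p0 \<kappa> by (intro mult_right_mono) auto
    then show ?thesis
      using zero_le_power2[of "p 0 * p j * (1 - \<kappa>)"] unfolding power2_diff by linarith
  qed
  finally have "cmod (of_real (p 0) + of_real (p j) * cis x) \<le> \<bar>p 0 + p j - p 0 * p j * (1 - \<kappa>)\<bar>"
    by (simp add: abs_le_square_iff[symmetric])
  \<comment> \<open>The quantity inside the absolute value is nonnegative: 1 - \<kappa> is at most
    2, so the subtracted product is at most \<open>2 * p 0\<close> and at most
    \<open>2 * p j\<close>, hence at most their mean.\<close>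
  also have "\<dots> = p 0 + p j - p 0 * p j * (1 - \<kappa>)"
  proof -
    have "p 0 * (p j * (1 - \<kappa>)) \<le> p 0 * 2" 
    proof (intro mult_left_mono)
      have "- 1 \<le> \<kappa>" using \<kappa> cos_ge_minus_one[of "2 * pi * (\<xi> \<bullet> a j)"] by linarith
      then have "p j * (1 - \<kappa>) \<le> 1 * 2" using p0 le1 \<kappa> by (intro mult_mono) auto
      then show "p j * (1 - \<kappa>) \<le> 2" by simp
    qed (use p0 in auto)
    moreover have "p j * (p 0 * (1 - \<kappa>)) \<le> p j * 2" 
    proof (intro mult_left_mono)
      have "- 1 \<le> \<kappa>" using \<kappa> cos_ge_minus_one[of "2 * pi * (\<xi> \<bullet> a j)"] by linarith
      then have "p 0 * (1 - \<kappa>) \<le> 1 * 2" using p0 le1 \<kappa> by (intro mult_mono) auto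
      then show "p 0 * (1 - \<kappa>) \<le> 2" by simp
    qed (use p0 in auto)
    ultimately show ?thesis by (simp add: algebra_simps)
  qed
  finally have two: "cmod (?f 0 + ?f j) \<le> p 0 + p j - p 0 * p j * (1 - \<kappa>)" by (simp add: a x_def)
  have "cmod (\<Sum>i\<in>{..m} - {0, j}. ?f i) \<le> (\<Sum>i\<in>{..m} - {0, j}. p i)"
    using pos by (intro sum_norm_le) (auto simp: norm_mult less_imp_le)
  then show ?thesis
    unfolding digit_mask_def split[of ?f] using two norm_triangle_ineq[of "?f 0 + ?f j" "\<Sum>i\<in>{..m} - {0, j}. ?f i"] one
    by linarith
qed

text \<open>The set Z confines the frequencies: a cone around one coordinate in (B), the whole space
  in (A). Large frequencies are scaled back, so Z must be stable under the inverse of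
  \<open>\<lambda>x. \<theta> *\<^sub>R M x\<close>. Uniformity of k and N0 in \<zeta> becomes
  uniformity of C and \<gamma>.\<close>

lemma fourier_decay_if_not_rarely_bad:
  fixes M :: "'a::euclidean_space \<Rightarrow> 'a"
  assumes M: "orthogonal_transformation M" and \<theta>: "1 < \<theta>"
    and ss: "is_self_similar_measure (\<lambda>x. (1 / \<theta>) *\<^sub>R M x) m a p \<mu>"
    and p: "positive_prob_vector m p" and a: "a 0 = 0"
    and Z: "\<And>x. \<theta> *\<^sub>R M x \<in> Z \<Longrightarrow> x \<in> Z"
    and bad: "\<And>N \<zeta>. N0 \<le> N \<Longrightarrow> \<zeta> \<in> Z \<Longrightarrow> 1 \<le> norm \<zeta> \<Longrightarrow> norm \<zeta> \<le> \<theta>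
        \<Longrightarrow> \<exists>j\<le>m. \<not> rarely_bad k N (\<lambda>n. ((\<lambda>x. \<theta> *\<^sub>R M x) ^^ n) \<zeta> \<bullet> a j)"
  shows "\<exists>C>0. \<exists>\<gamma>>0. \<forall>\<xi>\<in>Z. 1 \<le> norm \<xi> \<longrightarrow> cmod (fourier \<mu> \<xi>) \<le> C * norm \<xi> powr (- \<gamma>)"
proof -
  define B where "B = (\<lambda>x. \<theta> *\<^sub>R M x)"
  have prob: "prob_space \<mu>" using ss by (simp add: is_self_similar_measure_def)
  have normB: "norm (B x) = \<theta> * norm x" for x using \<theta> M by (simp add: B_def orthogonal_transformation_norm)
  have normBn: "norm ((B ^^ n) x) = \<theta> ^ n * norm x" for n x by (induction n) (simp_all add: normB)
  have Mm: "(\<lambda>x. (1 / \<theta>) *\<^sub>R M x) \<in> borel_measurable borel"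
    using M by (intro borel_measurable_continuous_onI continuous_intros linear_continuous_on)
      (simp add: orthogonal_transformation_def linear_conv_bounded_linear)
  have step: "fourier \<mu> (B \<eta>) = digit_mask m a p (B \<eta>) * fourier \<mu> \<eta>" for \<eta>
    using \<theta> M by (intro fourier_self_similar[OF ss p Mm]) (simp add: B_def orthogonal_transformation_def)
  have surjB: "\<exists>\<eta>. \<xi> = B \<eta>" for \<xi>
  proof -
    obtain \<eta> where "(1 / \<theta>) *\<^sub>R \<xi> = M \<eta>" using orthogonal_transformation_surj[OF M] by (metis surjD)
    then have "\<xi> = B \<eta>" using \<theta> unfolding B_def by (simp flip: \<open>(1 / \<theta>) *\<^sub>R \<xi> = M \<eta>\<close>)
    then show ?thesis ..
  qed
  \<comment> \<open>The factors at n = 0 to N are split off; the transform that remains, at the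
    preimage of \<zeta>, is bounded by 1.\<close>
  have prod: "cmod (fourier \<mu> ((B ^^ N) \<zeta>)) \<le> (\<Prod>n<Suc N. cmod (digit_mask m a p ((B ^^ n) \<zeta>)))" for N \<zeta>
  proof (induction N)
    case 0
    obtain \<eta> where \<eta>: "\<zeta> = B \<eta>" using surjB by blast
    show ?case
      using mult_left_mono[OF norm_fourier_le_1[OF prob, of \<eta>], of "cmod (digit_mask m a p \<zeta>)"]
      by (simp add: \<eta> step norm_mult)
  next
    case (Suc N)
    show ?case
      using mult_left_mono[OF Suc.IH, of "cmod (digit_mask m a p ((B ^^ Suc N) \<zeta>))"]
      by (simp add: step norm_mult mult.commute)
  qed
  have pos: "0 < p i" if "i \<le> m" for i using p that by (auto simp: positive_prob_vector_def)
  \<comment> \<open>The loss of a bad factor in \<open>norm_digit_mask_le\<close>, for the least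
    favourable digit. Halving it keeps 1 - c positive, so that its logarithm to base \<theta> makes
    sense.\<close>
  define c' where "c' = p 0 * Min (p ` {..m}) * (1 / (real k + 1))"
  define c where "c = c' / 2"
  have Min: "0 < Min (p ` {..m})" "\<And>j. j \<le> m \<Longrightarrow> Min (p ` {..m}) \<le> p j" using pos by auto
  have le1: "p j \<le> 1" if "j \<le> m" for j
  proof -
    have "p j \<le> (\<Sum>i\<le>m. p i)" using that pos by (intro member_le_sum) (auto simp: less_imp_le)
    then show ?thesis using p by (simp add: positive_prob_vector_def)
  qed
  have "c' \<le> 1 * 1 * 1"
    unfolding c'_def using Min(1) order_trans[OF Min(2) le1, of 0] le1[of 0] pos[of 0]
    by (intro mult_mono mult_nonneg_nonneg less_imp_le[OF Min(1)]) auto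
  moreover have "0 < c'" unfolding c'_def using Min(1) pos[of 0] by (intro mult_pos_pos) auto
  ultimately have c: "0 < c" "c < 1" "c \<le> c'" by (auto simp: c_def)
  define g where "g = - log \<theta> (1 - c)"
  have g: "0 < g" "1 - c = \<theta> powr (- g)" using c \<theta> by (auto simp: g_def)
  define \<gamma> where "\<gamma> = g / (real k + 1)"
  have \<gamma>: "0 < \<gamma>" using g by (simp add: \<gamma>_def)
  have main: "cmod (fourier \<mu> ((B ^^ N) \<zeta>)) \<le> \<theta> powr (- (\<gamma> * real N))"
    if N: "N0 \<le> N" and \<zeta>: "\<zeta> \<in> Z" "1 \<le> norm \<zeta>" "norm \<zeta> \<le> \<theta>" for N \<zeta>
  proof -
    obtain j where j: "j \<le> m" "\<not> rarely_bad k N (\<lambda>n. (B ^^ n) \<zeta> \<bullet> a j)" using bad[OF N \<zeta>] by (auto simp: B_def)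
    let ?S = "bad_indices (1 - 1 / (real k + 1)) N (\<lambda>n. (B ^^ n) \<zeta> \<bullet> a j)"
    have S: "real N / (real k + 1) < real (card ?S)" using j by (simp add: rarely_bad_def)
    \<comment> \<open>The digit 0 yields the zero sequence, whose cosine 1 is never bad.\<close>
    have j1: "1 \<le> j"
    proof (rule ccontr)
      assume "\<not> 1 \<le> j"
      then have "j = 0" by simp
      then have "?S = {}" using a by (auto simp: bad_indices_def not_less)
      then show False using S by (simp add: divide_less_0_iff)
    qed
    have factor: "cmod (digit_mask m a p ((B ^^ n) \<zeta>)) \<le> (if n \<in> ?S then 1 - c else 1)" for n
    proof (cases "n \<in> ?S")
      case True
      then have "cmod (digit_mask m a p ((B ^^ n) \<zeta>)) \<le> 1 - p 0 * p j * (1 - (1 - 1 / (real k + 1)))"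
        using j by (intro norm_digit_mask_le[where a = a, OF p a j1]) (auto simp: bad_indices_def)
      moreover have "c \<le> p 0 * p j * (1 / (real k + 1))"
      proof -
        have "c \<le> p 0 * Min (p ` {..m}) * (1 / (real k + 1))" using c(3) unfolding c'_def .
        also have "\<dots> \<le> p 0 * p j * (1 / (real k + 1))"
          using Min(2) j less_imp_le[OF pos[of 0]] by (intro mult_right_mono mult_left_mono) auto
        finally show ?thesis .
      qed
      ultimately show ?thesis using True by simp
    qed (simp add: norm_digit_mask_le_1[OF p])
    have "cmod (fourier \<mu> ((B ^^ N) \<zeta>)) \<le> (\<Prod>n<Suc N. cmod (digit_mask m a p ((B ^^ n) \<zeta>)))" by (rule prod)
    also have "\<dots> \<le> (\<Prod>n<Suc N. if n \<in> ?S then 1 - c else 1)" using factor by (intro prod_mono) auto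
    also have "\<dots> = (1 - c) ^ card ({..<Suc N} \<inter> ?S)" by (simp add: prod.If_cases del: prod.lessThan_Suc)
    also have "{..<Suc N} \<inter> ?S = ?S" by (auto simp: bad_indices_def)
    also have "(1 - c) ^ card ?S = (1 - c) powr real (card ?S)" using c by (simp add: powr_realpow)
    also have "\<dots> \<le> (1 - c) powr (real N / (real k + 1))" using S c by (intro powr_mono') auto
    also have "\<dots> = \<theta> powr (- (\<gamma> * real N))" by (simp add: g(2) powr_powr \<gamma>_def)
    finally show ?thesis .
  qed
  \<comment> \<open>The exponent pays for
    \<open>norm \<xi> \<le> \<theta> powr (real N + 1)\<close>, one step more than the N used
    factors, and for the N below N0, where only the trivial bound 1 is available.\<close>
  define C where "C = \<theta> powr (\<gamma> * (real N0 + 1))"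
  have norm_form: "\<exists>N \<zeta>. \<xi> = (B ^^ N) \<zeta> \<and> \<zeta> \<in> Z \<and> 1 \<le> norm \<zeta> \<and> norm \<zeta> \<le> \<theta>"
    if "\<xi> \<in> Z" "1 \<le> norm \<xi>" "norm \<xi> \<le> \<theta> ^ n" for n \<xi>
    using that
  proof (induction n arbitrary: \<xi>)
    case 0
    then show ?case using \<theta> by (intro exI[of _ 0] exI[of _ \<xi>]) auto
  next
    case (Suc n)
    show ?case
    proof (cases "norm \<xi> \<le> \<theta>")
      case True
      then show ?thesis using Suc.prems by (intro exI[of _ 0] exI[of _ \<xi>]) auto
    next
      case False
      obtain \<eta> where \<eta>: "\<xi> = B \<eta>" using surjB by blast
      have "\<eta> \<in> Z" using Z Suc.prems(1) unfolding \<eta> by (simp add: B_def)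
      moreover have "1 \<le> norm \<eta>" "norm \<eta> \<le> \<theta> ^ n" using False Suc.prems(3) \<theta> by (simp_all add: \<eta> normB)
      ultimately obtain N \<zeta> where "\<eta> = (B ^^ N) \<zeta>" "\<zeta> \<in> Z" "1 \<le> norm \<zeta>" "norm \<zeta> \<le> \<theta>"
        using Suc.IH by blast
      then show ?thesis by (intro exI[of _ "Suc N"] exI[of _ \<zeta>]) (simp add: \<eta>)
    qed
  qed
  have "cmod (fourier \<mu> \<xi>) \<le> C * norm \<xi> powr (- \<gamma>)" if \<xi>: "\<xi> \<in> Z" "1 \<le> norm \<xi>" for \<xi>
  proof -
    obtain n where "norm \<xi> < \<theta> ^ n" using real_arch_pow[OF \<theta>] by blast
    then obtain N \<zeta> where \<zeta>: "\<xi> = (B ^^ N) \<zeta>" "\<zeta> \<in> Z" "1 \<le> norm \<zeta>" "norm \<zeta> \<le> \<theta>"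
      using norm_form[OF \<xi>] by (meson less_imp_le)
    have le: "norm \<xi> \<le> \<theta> powr (real N + 1)"
      using \<zeta> \<theta> mult_left_mono[OF \<zeta>(4), of "\<theta> ^ N"] by (simp add: normBn powr_add powr_realpow)
    have "\<xi> \<noteq> 0" using \<xi>(2) by auto
    then have low: "\<theta> powr (- (\<gamma> * (real N + 1))) \<le> norm \<xi> powr (- \<gamma>)"
      using powr_mono2'[OF _ _ le, of "- \<gamma>"] \<gamma> \<xi> \<theta> by (simp add: powr_powr mult.commute)
    show ?thesis
    proof (cases "N0 \<le> N")
      case True
      have "cmod (fourier \<mu> \<xi>) \<le> \<theta> powr (- (\<gamma> * real N))" using main[OF True \<zeta>(2-4)] \<zeta>(1) by simp
      also have "\<dots> = \<theta> powr \<gamma> * \<theta> powr (- (\<gamma> * (real N + 1)))" by (simp add: algebra_simps flip: powr_add)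
      also have "\<dots> \<le> C * norm \<xi> powr (- \<gamma>)"
        unfolding C_def using low \<gamma> \<theta> by (intro mult_mono powr_mono) (auto simp: algebra_simps)
      finally show ?thesis .
    next
      case False
      have "cmod (fourier \<mu> \<xi>) \<le> 1" by (rule norm_fourier_le_1[OF prob])
      also have "\<dots> = \<theta> powr (\<gamma> * (real N + 1)) * \<theta> powr (- (\<gamma> * (real N + 1)))"
        using \<theta> by (simp flip: powr_add)
      also have "\<dots> \<le> C * norm \<xi> powr (- \<gamma>)"
        unfolding C_def using low False \<gamma> \<theta> by (intro mult_mono powr_mono mult_left_mono) auto
      finally show ?thesis .
    qed
  qed
  then show ?thesis using \<gamma> \<theta> by (intro exI[of _ C] conjI exI[of _ \<gamma>]) (auto simp: C_def)
qed

lemma power_decay_measuresI: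
  assumes ss: "is_self_similar_measure A m a p \<mu>"
    and decay: "\<exists>C>0. \<exists>\<gamma>>0. \<forall>\<xi>. 1 \<le> norm \<xi> \<longrightarrow> cmod (fourier \<mu> \<xi>) \<le> C * norm \<xi> powr (- \<gamma>)"
  shows "\<mu> \<in> power_decay_measures"
proof -
  obtain C \<gamma> where \<gamma>: "0 < \<gamma>" "\<And>\<xi>. 1 \<le> norm \<xi> \<Longrightarrow> cmod (fourier \<mu> \<xi>) \<le> C * norm \<xi> powr (- \<gamma>)"
    using decay by blast
  have "(\<lambda>\<xi>. cmod (fourier \<mu> \<xi>)) \<in> O[at_infinity](\<lambda>\<xi>. norm \<xi> powr (-\<gamma>))"
    using \<gamma> by (intro bigoI[of _ C]) (auto simp: eventually_at_infinity intro!: exI[of _ 1])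
  then show ?thesis
    using ss \<gamma> unfolding power_decay_measures_def is_self_similar_measure_def
    by (auto intro: prob_space.finite_measure)
qed


section \<open>Diagonal rotations\<close>

lemma rotation_diag_mult_nth: "(rotation_diag \<alpha> *v x) $ k = cis (- (2 * pi * \<alpha> k)) * x $ k"
  by (simp add: matrix_vector_mult_def rotation_diag_def if_distrib[of "\<lambda>z. z * _"] cong: if_cong)

lemma orthogonal_transformation_rotation_diag: "orthogonal_transformation ((*v) (rotation_diag \<alpha>))"
  unfolding orthogonal_transformation
proof
  show "linear ((*v) (rotation_diag \<alpha>))"
    by (rule linearI) (simp_all add: vec_eq_iff rotation_diag_mult_nth algebra_simps)
  show "\<forall>x. norm (rotation_diag \<alpha> *v x) = norm x"
    by (simp add: norm_vec_def rotation_diag_mult_nth norm_mult)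
qed

lemma cis_2pi_eq_iff:
  assumes "x \<in> {0<..<1/2}" "y \<in> {0<..<1/2}"
  shows "cis (2 * pi * x) = cis (2 * pi * y) \<longleftrightarrow> x = y"
proof
  assume "cis (2 * pi * x) = cis (2 * pi * y)"
  then have "cos (2 * pi * x) = cos (2 * pi * y)" by (auto simp: complex_eq_iff)
  moreover have "2 * pi * x \<le> pi" "2 * pi * y \<le> pi" using assms by auto
  ultimately have "2 * pi * x = 2 * pi * y" using assms by (intro cos_inj_pi[of "2 * pi * x" "2 * pi * y"]) simp_all
  then show "x = y" by simp
qed simp

lemma Im_cis_2pi_pos: "x \<in> {0<..<1/2} \<Longrightarrow> 0 < Im (cis (2 * pi * x))"
  by (auto intro!: sin_gt_zero)

text \<open>Distinct angles are separated by the real quadratic factors \<open>X\<^sup>2 - 2 cos (2\<pi>\<alpha>\<^sub>j) X + 1\<close>,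
  so a real invariant subspace contains each complex coordinate axis that it does not avoid.\<close>

lemma rotation_invariant_subspace_eq_UNIV:
  fixes \<alpha> :: "'s::finite \<Rightarrow> real"
  assumes \<alpha>: "inj \<alpha>" "range \<alpha> \<subseteq> {0<..<1/2}"
    and S: "subspace S" "\<And>x. x \<in> S \<Longrightarrow> rotation_diag \<alpha> *v x \<in> S" and nz: "\<And>k. \<exists>x\<in>S. x $ k \<noteq> 0"
  shows "S = UNIV"
proof -
  let ?R = "\<lambda>x. rotation_diag \<alpha> *v x"
  define z where "z k = cis (- (2 * pi * \<alpha> k))" for k
  have Rnth: "?R x $ k = z k * x $ k" for x k by (simp add: rotation_diag_mult_nth z_def)
  have \<alpha>': "\<alpha> k \<in> {0<..<1/2}" for k using \<alpha>(2) by (simp add: image_subset_iff)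
  have Im_z: "Im (z k) < 0" for k using Im_cis_2pi_pos[OF \<alpha>'[of k]] by (simp add: z_def)
  have z_eq: "z j = z k \<longleftrightarrow> j = k" for j k
  proof -
    have "z j = z k \<longleftrightarrow> cis (2 * pi * \<alpha> j) = cis (2 * pi * \<alpha> k)" by (simp add: z_def complex_eq_iff)
    also have "\<dots> \<longleftrightarrow> j = k" using cis_2pi_eq_iff[OF \<alpha>' \<alpha>'] \<alpha>(1) by (auto dest: injD)
    finally show ?thesis .
  qed
  have ex: "\<exists>x\<in>S. x $ k \<noteq> 0 \<and> (\<forall>j\<in>F. x $ j = 0)" if "finite F" "k \<notin> F" for F k
    using that
  proof (induction F rule: finite_induct)
    case empty
    then show ?case using nz by auto
  next
    case (insert j F)
    then obtain x where x: "x \<in> S" "x $ k \<noteq> 0" "\<forall>j\<in>F. x $ j = 0" by auto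
    \<comment> \<open>The quadratic factor of j, evaluated at the rotation, annihilates coordinate
      j. All \<open>z i\<close> lie in the lower half-plane, so \<open>z k\<close> equals neither
      \<open>z j\<close> nor its conjugate and coordinate k survives.\<close>
    define y where "y = ?R (?R x) - (2 * Re (z j)) *\<^sub>R ?R x + x"
    have ynth: "y $ i = (z i - z j) * (z i - cnj (z j)) * x $ i" for i
    proof -
      have "z j * cnj (z j) = 1" by (simp add: z_def cis_cnj cis_mult)
      moreover have "z j + cnj (z j) = of_real (2 * Re (z j))" by (rule complex_add_cnj)
      ultimately have "(z i - z j) * (z i - cnj (z j)) = z i * z i - of_real (2 * Re (z j)) * z i + 1"
        by (simp add: algebra_simps flip: distrib_left)
      moreover have "y $ i = z i * (z i * x $ i) - of_real (2 * Re (z j)) * (z i * x $ i) + x $ i"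
        unfolding y_def vector_add_component vector_minus_component vector_scaleR_component Rnth
        by (simp only: scaleR_conv_of_real)
      then have "y $ i = (z i * z i - of_real (2 * Re (z j)) * z i + 1) * x $ i"
        by (simp only: distrib_right left_diff_distrib mult.assoc mult_1_left)
      ultimately show ?thesis by (simp only:)
    qed
    have "y \<in> S" unfolding y_def using x S by (intro subspace_add subspace_diff subspace_scale) auto
    moreover have "z k \<noteq> cnj (z j)" using Im_z[of k] Im_z[of j] by (auto simp: complex_eq_iff)
    ultimately show ?case using insert.prems x z_eq by (intro bexI[of _ y]) (auto simp: ynth)
  qed
  have axis: "axis k c \<in> S" for k c
  proof -
    obtain x where x: "x \<in> S" "x $ k \<noteq> 0" "\<forall>j\<in>- {k}. x $ j = 0" using ex[of "- {k}" k] by auto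
    define w where "w = c / x $ k"
    \<comment> \<open>Since \<open>z k\<close> is not real, every complex w is a real combination of
      1 and \<open>z k\<close>; the same combination of x and its rotation has k-th coordinate
      c.\<close>
    define v where "v = Im w / Im (z k)"
    define y where "y = (Re w - v * Re (z k)) *\<^sub>R x + v *\<^sub>R ?R x"
    have "y \<in> S" unfolding y_def using x S by (intro subspace_add subspace_scale) auto
    moreover have "of_real (Re w - v * Re (z k)) + of_real v * z k = w"
      using Im_z[of k] by (simp add: complex_eq_iff v_def)
    moreover have "y $ k = of_real (Re w - v * Re (z k)) * x $ k + of_real v * (z k * x $ k)"
      unfolding y_def vector_add_component vector_scaleR_component Rnth by (simp only: scaleR_conv_of_real)
    then have "y $ k = (of_real (Re w - v * Re (z k)) + of_real v * z k) * x $ k"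
      by (simp only: distrib_right mult.assoc)
    ultimately have "y \<in> S" "y $ k = w * x $ k" by (simp_all only:)
    then have "y = axis k c" using x(2,3) by (auto simp: vec_eq_iff axis_def w_def y_def Rnth)
    with \<open>y \<in> S\<close> show ?thesis by simp
  qed
  show "S = UNIV"
  proof (intro UNIV_eq_I[symmetric])
    fix x :: "complex ^ 's"
    have "x = (\<Sum>k\<in>UNIV. axis k (x $ k))" by (simp add: vec_eq_iff axis_def)
    also have "\<dots> \<in> S" using S(1) axis by (intro subspace_sum) auto
    finally show "x \<in> S" .
  qed
qed

text \<open>The vectors with vanishing k-th coordinate form an invariant subspace, so a coordinate
  on which all digits vanish obstructs cyclicity. Conversely, an invariant subspace containing the
  digits satisfies \<open>rotation_invariant_subspace_eq_UNIV\<close>.\<close>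

lemma cyclic_rotation_iff:
  fixes \<alpha> :: "'s::finite \<Rightarrow> real" and a :: "nat \<Rightarrow> complex ^ 's"
  assumes \<alpha>: "inj \<alpha>" "range \<alpha> \<subseteq> {0<..<1/2}" and \<theta>: "0 < \<theta>" and a: "a 0 = 0"
  shows "cyclic_for (similitude (1 / \<theta>) (rotation_diag \<alpha>)) (a ` {..m}) \<longleftrightarrow> (\<forall>k. \<exists>j\<in>{1..m}. a j $ k \<noteq> 0)"
proof
  assume cyc: "cyclic_for (similitude (1 / \<theta>) (rotation_diag \<alpha>)) (a ` {..m})"
  show "\<forall>k. \<exists>j\<in>{1..m}. a j $ k \<noteq> 0"
  proof (rule ccontr)
    assume "\<not> ?thesis"
    then obtain k where k: "\<And>j. j \<in> {1..m} \<Longrightarrow> a j $ k = 0" by blast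
    define S :: "(complex ^ 's) set" where "S = {x. x $ k = 0}"
    have "subspace S" by (simp add: subspace_def S_def)
    moreover have "similitude (1 / \<theta>) (rotation_diag \<alpha>) ` S \<subseteq> S"
      by (auto simp: S_def similitude_def rotation_diag_mult_nth)
    moreover have "a j \<in> S" if "j \<le> m" for j 
    proof (cases "j = 0")
      case False
      then have "j \<in> {1..m}" using that by auto
      then show ?thesis using k by (simp add: S_def)
    qed (simp add: S_def a)
    then have "a ` {..m} \<subseteq> S" by auto
    ultimately have "S = UNIV" using cyc unfolding cyclic_for_def by blast
    then have "axis k 1 \<in> S" by simp
    then show False by (simp add: S_def axis_def)
  qed
next
  assume nz: "\<forall>k. \<exists>j\<in>{1..m}. a j $ k \<noteq> 0"
  show "cyclic_for (similitude (1 / \<theta>) (rotation_diag \<alpha>)) (a ` {..m})"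
    unfolding cyclic_for_def
  proof (intro allI impI, elim conjE)
    fix S assume S: "subspace S" "similitude (1 / \<theta>) (rotation_diag \<alpha>) ` S \<subseteq> S" "a ` {..m} \<subseteq> S"
    show "S = UNIV"
    proof (rule rotation_invariant_subspace_eq_UNIV[OF \<alpha> S(1)])
      show "rotation_diag \<alpha> *v x \<in> S" if "x \<in> S" for x
        using subspace_scale[OF S(1), of "similitude (1 / \<theta>) (rotation_diag \<alpha>) x" \<theta>] S(2) that \<theta>
        by (auto simp: similitude_def)
      show "\<exists>x\<in>S. x $ k \<noteq> 0" for k using nz S(3) by (metis atLeastAtMost_iff atMost_iff image_subset_iff)
    qed
  qed
qed

text \<open>Real orbit sequences involve each frequency together with its conjugate; the Boolean
  tells the two apart. Only the pair at l moves with the parameter t.\<close>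

definition pair_freq :: "'s \<Rightarrow> ('s \<Rightarrow> complex) \<Rightarrow> complex \<Rightarrow> 's \<times> bool \<Rightarrow> complex" where
  "pair_freq l z t = (\<lambda>(k, s). let w = (if k = l then t else z k) in if s then w else cnj w)"

lemma pair_freq_simps [simp]:
  "pair_freq l z t (l, True) = t" "pair_freq l z t (l, False) = cnj t"
  "k \<noteq> l \<Longrightarrow> pair_freq l z t (k, True) = z k" "k \<noteq> l \<Longrightarrow> pair_freq l z t (k, False) = cnj (z k)"
  by (simp_all add: pair_freq_def)

definition other_factor :: "'s::finite \<Rightarrow> ('s \<Rightarrow> complex) \<Rightarrow> complex \<Rightarrow> complex" where
  "other_factor l z t = (\<Prod>k\<in>- {l}. (t - z k) * (t - cnj (z k)))"

text \<open>The factor \<open>t - t'\<close> is the parameter distance required by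
  \<open>erdos_kahane\<close>; the remaining factors have to be kept away from 0.\<close>

lemma prod_pair_freq:
  "(\<Prod>i\<in>UNIV. t - pair_freq l z t' i) = (t - t') * (t - cnj t') * other_factor l z t"
  "(\<Prod>i\<in>UNIV - {(l, True)}. t - pair_freq l z t i) = (t - cnj t) * other_factor l z t"
proof -
  have rest: "(\<Prod>i\<in>(- {l}) \<times> UNIV. t - pair_freq l z t' i) = other_factor l z t" for t'
    unfolding other_factor_def prod.cartesian_product[symmetric, where g = "\<lambda>x y. t - pair_freq l z t' (x, y)", simplified]
    by (intro prod.cong) (auto simp: UNIV_bool mult.commute)
  have U1: "UNIV = insert (l, True) (insert (l, False) ((- {l}) \<times> UNIV))"
    and U2: "UNIV - {(l, True)} = insert (l, False) ((- {l}) \<times> UNIV)" by auto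
  show "(\<Prod>i\<in>UNIV. t - pair_freq l z t' i) = (t - t') * (t - cnj t') * other_factor l z t"
    unfolding U1 by (subst prod.insert, simp, simp, subst prod.insert, simp, simp) (simp add: rest mult.assoc)
  show "(\<Prod>i\<in>UNIV - {(l, True)}. t - pair_freq l z t i) = (t - cnj t) * other_factor l z t"
    unfolding U2 by (subst prod.insert, simp, simp) (simp add: rest)
qed

text \<open>The arc is truncated away from the real axis and from the fixed frequencies and their
  conjugates; as \<eta> decreases to 0, these sets exhaust the admissible parameters.\<close>

definition pair_params :: "'s::finite \<Rightarrow> ('s \<Rightarrow> complex) \<Rightarrow> real \<Rightarrow> real \<Rightarrow> complex set" where
  "pair_params l z \<theta> \<eta> = {t \<in> (\<lambda>w. of_real \<theta> * w) ` T_plus. \<eta> \<le> Im t \<and> \<eta> \<le> cmod (other_factor l z t)}"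

definition pair_class :: "'s::finite \<Rightarrow> ('s \<Rightarrow> complex) \<Rightarrow> real \<Rightarrow> real \<Rightarrow> real \<Rightarrow> (complex \<times> (nat \<Rightarrow> real)) set" where
  "pair_class l z \<theta> \<eta> M = {(t, y). t \<in> pair_params l z \<theta> \<eta> \<and>
     (\<exists>b. (\<forall>n. of_real (y n) = (\<Sum>i\<in>UNIV. b i * pair_freq l z t i ^ n)) \<and> \<eta> \<le> cmod (b (l, True))) \<and>
     (\<forall>n<2 * card (UNIV :: ('s \<times> bool) set). \<bar>y n\<bar> \<le> M)}"

text \<open>The imaginary part of \<open>t - cnj t'\<close> is \<open>Im t + Im t'\<close>, so
  besides \<open>t - t'\<close> there remain two factors of modulus at least \<eta>; hence \<kappa>
  is \<open>\<eta>\<^sup>2\<close>, which is also below the bound \<eta> for the coefficient of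
  t.\<close>

lemma hausdorff_null_pair_class:
  fixes l :: "'s::finite"
  assumes z: "\<And>k. cmod (z k) \<le> \<theta>" and \<theta>: "1 < \<theta>" and \<eta>: "0 < \<eta>" "\<eta> \<le> 1" and \<tau>: "0 < \<tau>"
  shows "hausdorff_null \<tau> (\<Inter>k. {t. \<exists>\<^sub>\<infinity>N. \<exists>y. (t, y) \<in> pair_class l z \<theta> \<eta> M \<and> rarely_bad k N y})"
proof (rule erdos_kahane[where I = UNIV and U = "{(l, True)}" and P = "pair_params l z \<theta> \<eta>"
      and lam = "pair_freq l z" and R = \<theta> and L = \<theta> and \<kappa> = "\<eta>\<^sup>2" and M = M])
  have norm_t: "cmod t = \<theta>" if "t \<in> pair_params l z \<theta> \<eta>" for t
    using that \<theta> by (auto simp: pair_params_def T_plus_def norm_mult)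
  show "cmod (pair_freq l z t i) \<le> \<theta>" if "t \<in> pair_params l z \<theta> \<eta>" for t i
    using norm_t[OF that] z by (cases i) (auto simp: pair_freq_def Let_def)
  show "\<theta> \<le> cmod (pair_freq l z t u)" if "t \<in> pair_params l z \<theta> \<eta>" "u \<in> {(l, True)}" for t u
    using norm_t that by auto
  have conj: "\<eta> \<le> cmod (t - cnj t')" if "t \<in> pair_params l z \<theta> \<eta>" "t' \<in> pair_params l z \<theta> \<eta>" for t t'
  proof -
    have "\<eta> \<le> Im (t - cnj t')" using that \<eta> by (auto simp: pair_params_def)
    then show ?thesis using abs_Im_le_cmod[of "t - cnj t'"] by linarith
  qed
  have other: "\<eta> \<le> cmod (other_factor l z t)" if "t \<in> pair_params l z \<theta> \<eta>" for t
    using that by (simp add: pair_params_def)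
  show "\<eta>\<^sup>2 * dist t t' \<le> cmod (\<Prod>i\<in>UNIV. pair_freq l z t u - pair_freq l z t' i)"
    if t: "t \<in> pair_params l z \<theta> \<eta>" "t' \<in> pair_params l z \<theta> \<eta>" and u: "u \<in> {(l, True)}" for t t' u
  proof -
    have "(\<eta> * \<eta>) * dist t t' \<le> (cmod (t - cnj t') * cmod (other_factor l z t)) * dist t t'"
      using conj[OF t] other[OF t(1)] \<eta> by (intro mult_right_mono mult_mono) auto
    then show ?thesis using u by (simp add: prod_pair_freq norm_mult dist_norm power2_eq_square mult_ac)
  qed
  show "\<eta>\<^sup>2 \<le> cmod (\<Prod>i\<in>UNIV - {u}. pair_freq l z t u - pair_freq l z t i)"
    if t: "t \<in> pair_params l z \<theta> \<eta>" and u: "u \<in> {(l, True)}" for t u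
  proof -
    have "\<eta> * \<eta> \<le> cmod (t - cnj t) * cmod (other_factor l z t)"
      using conj[OF t t] other[OF t] \<eta> by (intro mult_mono) auto
    then show ?thesis using u by (simp add: prod_pair_freq norm_mult power2_eq_square)
  qed
  have "\<eta>\<^sup>2 \<le> \<eta>" using \<eta> by (simp add: power2_eq_square mult_left_le)
  then show "\<exists>b. (\<forall>n. of_real (y n) = (\<Sum>i\<in>UNIV. b i * pair_freq l z t i ^ n)) \<and> (\<exists>u\<in>{(l, True)}. \<eta>\<^sup>2 \<le> cmod (b u))"
    if "(t, y) \<in> pair_class l z \<theta> \<eta> M" for t y
    using that unfolding pair_class_def by (auto intro: order_trans)
qed (use \<theta> \<eta> \<tau> in \<open>auto simp: pair_class_def\<close>)

lemma rotation_power_nth: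
  "((\<lambda>x. \<theta> *\<^sub>R (rotation_diag \<alpha> *v x)) ^^ n) \<zeta> $ k = cnj (of_real \<theta> * cis (2 * pi * \<alpha> k)) ^ n * \<zeta> $ k"
proof (induction n)
  case (Suc n)
  have "(\<theta> *\<^sub>R (rotation_diag \<alpha> *v x)) $ k = cnj (of_real \<theta> * cis (2 * pi * \<alpha> k)) * x $ k" for x
    unfolding vector_scaleR_component rotation_diag_mult_nth by (simp add: scaleR_conv_of_real cis_cnj)
  then show ?case using Suc by (simp only: funpow.simps o_apply power_Suc mult.assoc)
qed simp

text \<open>The real inner product of complex x and y is half of
  \<open>x * cnj y + cnj x * y\<close>. As \<open>rotation_diag\<close> turns by the negative angle,
  the orbit coordinate carries the conjugate frequency, so the frequency itself comes with
  \<open>cnj (\<zeta> $ k) * a $ k / 2\<close>.\<close>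

lemma rotation_orbit_expansion:
  fixes \<zeta> a :: "complex ^ 's::finite"
  assumes z: "\<And>k. pair_freq l z t (k, True) = of_real \<theta> * cis (2 * pi * \<alpha> k)"
  shows "of_real (((\<lambda>x. \<theta> *\<^sub>R (rotation_diag \<alpha> *v x)) ^^ n) \<zeta> \<bullet> a)
    = (\<Sum>i\<in>UNIV. (case i of (k, s) \<Rightarrow> (if s then cnj (\<zeta> $ k) * a $ k else \<zeta> $ k * cnj (a $ k)) / 2)
        * pair_freq l z t i ^ n)" (is "?L = (\<Sum>i\<in>UNIV. ?b i * _)")
proof -
  let ?w = "\<lambda>k. of_real \<theta> * cis (2 * pi * \<alpha> k)"
  have z': "pair_freq l z t (k, False) = cnj (?w k)" for k
    using z[of k] by (auto simp: pair_freq_def Let_def)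
  have inner: "of_real (x \<bullet> y) = (x * cnj y + cnj x * y) / (2 :: complex)" for x y :: complex
    by (simp add: complex_eq_iff inner_complex_def)
  have "?L = (\<Sum>k\<in>UNIV. \<Sum>s\<in>UNIV. ?b (k, s) * pair_freq l z t (k, s) ^ n)"
    unfolding inner_vec_def of_real_sum rotation_power_nth
    by (intro sum.cong refl) (simp only: inner UNIV_bool, simp add: z z' field_simps)
  also have "\<dots> = (\<Sum>i\<in>UNIV. ?b i * pair_freq l z t i ^ n)"
    unfolding UNIV_Times_UNIV[symmetric] sum.cartesian_product by (intro sum.cong) auto
  finally show ?thesis .
qed

theorem rotation_decay:
  fixes \<theta> :: real and a :: "nat \<Rightarrow> complex ^ 's::finite" and l :: 's
  assumes \<theta>: "1 < \<theta>" and a: "a 0 = 0" and p: "positive_prob_vector m p"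
    and \<alpha>: "inj_on \<alpha> (- {l})" "\<alpha> ` (- {l}) \<subseteq> {0<..<1/2}"
  shows "\<exists>E. E \<subseteq> (\<lambda>z. of_real \<theta> * z) ` T_plus \<and> hausdorff_dim E = 0 \<and>
      (\<forall>\<beta>\<in>{0<..<1/2}.
         \<beta> \<notin> \<alpha> ` (- {l}) \<and> cis (2 * pi * \<beta>) \<notin> (\<lambda>z. of_real (1/\<theta>) * z) ` E \<and>
         cyclic_for (similitude (1/\<theta>) (rotation_diag (\<alpha>(l := \<beta>)))) (a ` {..m})
         \<longrightarrow> (\<forall>\<mu>. is_self_similar_measure (similitude (1/\<theta>) (rotation_diag (\<alpha>(l := \<beta>)))) m a p \<mu>
               \<longrightarrow> (\<exists>C>0. \<exists>\<gamma>>0. \<forall>\<xi>. cmod (\<xi> $ l) = (MAX j. cmod (\<xi> $ j)) \<and> norm \<xi> \<ge> 1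
                      \<longrightarrow> cmod (fourier \<mu> \<xi>) \<le> C * norm \<xi> powr (-\<gamma>))))"
proof -
  define z where "z k = of_real \<theta> * cis (2 * pi * \<alpha> k)" for k
  \<comment> \<open>One q bounds sizes by q and nondegeneracy by 1 / (q + 1), so every admissible
    orbit falls into the class of some q.\<close>
  define Y where "Y q = pair_class l z \<theta> (1 / (real q + 1)) (real q)" for q :: nat
  define E where "E = (\<Union>q. \<Inter>k. {t. \<exists>\<^sub>\<infinity>N. \<exists>y. (t, y) \<in> Y q \<and> rarely_bad k N y})"
  have nz: "cmod (z k) \<le> \<theta>" for k using \<theta> by (simp add: z_def norm_mult)
  have "hausdorff_null \<tau> E" if "0 < \<tau>" for \<tau>
    unfolding E_def Y_def using that
    by (intro hausdorff_null_UN hausdorff_null_pair_class nz \<theta>) auto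
  then have dim: "hausdorff_dim E = 0" by (rule hausdorff_dim_eq_0_if_null)
  have sub: "E \<subseteq> (\<lambda>z. of_real \<theta> * z) ` T_plus"
  proof
    fix t assume "t \<in> E"
    then obtain q where "\<exists>\<^sub>\<infinity>N. \<exists>y. (t, y) \<in> Y q \<and> rarely_bad 0 N y" by (auto simp: E_def)
    then obtain N y where "(t, y) \<in> Y q" by (auto dest: INFM_EX)
    then show "t \<in> (\<lambda>z. of_real \<theta> * z) ` T_plus" by (auto simp: Y_def pair_class_def pair_params_def)
  qed
  have "\<exists>C>0. \<exists>\<gamma>>0. \<forall>\<xi>. cmod (\<xi> $ l) = (MAX j. cmod (\<xi> $ j)) \<and> norm \<xi> \<ge> 1
          \<longrightarrow> cmod (fourier \<mu> \<xi>) \<le> C * norm \<xi> powr (-\<gamma>)"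
    if \<beta>: "\<beta> \<in> {0<..<1/2}" "\<beta> \<notin> \<alpha> ` (- {l})" "cis (2 * pi * \<beta>) \<notin> (\<lambda>z. of_real (1/\<theta>) * z) ` E"
      and cyc: "cyclic_for (similitude (1/\<theta>) (rotation_diag (\<alpha>(l := \<beta>)))) (a ` {..m})"
      and ss: "is_self_similar_measure (similitude (1/\<theta>) (rotation_diag (\<alpha>(l := \<beta>)))) m a p \<mu>" for \<beta> \<mu>
  proof -
    define \<alpha>' where "\<alpha>' = \<alpha>(l := \<beta>)"
    define t where "t = of_real \<theta> * cis (2 * pi * \<beta>)"
    \<comment> \<open>This cone is preserved in both directions, because the scaled rotation
      multiplies the moduli of all coordinates by \<theta>.\<close>
    define Z :: "(complex ^ 's) set" where "Z = {\<xi>. \<forall>j. cmod (\<xi> $ j) \<le> cmod (\<xi> $ l)}"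
    have "inj \<alpha>'" using \<alpha>(1) \<beta>(2) by (auto simp: \<alpha>'_def inj_on_def)
    moreover have "range \<alpha>' \<subseteq> {0<..<1/2}" using \<alpha>(2) \<beta>(1) by (auto simp: \<alpha>'_def)
    ultimately have "\<forall>k. \<exists>j\<in>{1..m}. a j $ k \<noteq> 0"
      using cyc cyclic_rotation_iff[of \<alpha>' \<theta> a m] \<theta> a unfolding \<alpha>'_def by simp
    then obtain j where j: "j \<le> m" "a j $ l \<noteq> 0" by (meson atLeastAtMost_iff)
    have tT: "t \<in> (\<lambda>z. of_real \<theta> * z) ` T_plus" using \<beta>(1) by (auto simp: t_def T_plus_def)
    have Im_t: "0 < Im t" using Im_cis_2pi_pos[OF \<beta>(1)] \<theta> by (simp add: t_def)
    have "other_factor l z t \<noteq> 0"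
    proof -
      have "t \<noteq> z k \<and> t \<noteq> cnj (z k)" if "k \<noteq> l" for k
      proof -
        have ak: "\<alpha> k \<in> {0<..<1/2}" "\<beta> \<noteq> \<alpha> k" using \<alpha>(2) \<beta>(2) that by auto
        have "0 < Im (z k)" using Im_cis_2pi_pos[OF ak(1)] \<theta> by (simp add: z_def)
        then have "t \<noteq> cnj (z k)" using Im_t by (auto simp: complex_eq_iff)
        moreover have "t \<noteq> z k" using cis_2pi_eq_iff[OF \<beta>(1) ak(1)] ak(2) \<theta> by (simp add: t_def z_def)
        ultimately show ?thesis by blast
      qed
      then show ?thesis by (auto simp: other_factor_def)
    qed
    then have other: "0 < cmod (other_factor l z t)" by simp
    \<comment> \<open>On Z the l-th component is the largest, so \<open>1 \<le> norm \<zeta>\<close>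
      makes its modulus at least \<open>1 / CARD('s)\<close>; b0 is the resulting lower bound for
      the coefficient of t.\<close>
    define b0 where "b0 = cmod (a j $ l) / (2 * real CARD('s))"
    have b0: "0 < b0" using j by (simp add: b0_def)
    define M where "M = \<theta> ^ (2 * card (UNIV :: ('s \<times> bool) set)) * \<theta> * norm (a j)"
    define \<eta>0 where "\<eta>0 = min b0 (min (Im t) (cmod (other_factor l z t)))"
    have \<eta>0: "0 < \<eta>0" using b0 Im_t other by (simp add: \<eta>0_def)
    obtain q :: nat where q: "max M (1 / \<eta>0) \<le> real q" using real_arch_simple by blast
    have "1 / (real q + 1) \<le> \<eta>0"
    proof -
      have "1 \<le> real q * \<eta>0" using q \<eta>0 by (simp add: divide_le_eq)
      then have "1 \<le> (real q + 1) * \<eta>0" using \<eta>0 by (simp add: algebra_simps)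
      then show ?thesis by (simp add: divide_le_eq mult.commute)
    qed
    then have \<eta>: "1 / (real q + 1) \<le> b0" "1 / (real q + 1) \<le> Im t" "1 / (real q + 1) \<le> cmod (other_factor l z t)"
      by (auto simp: \<eta>0_def)
    have "t \<notin> E"
    proof
      assume "t \<in> E"
      then have "of_real (1/\<theta>) * t \<in> (\<lambda>z. of_real (1/\<theta>) * z) ` E" by (rule imageI)
      moreover have "of_real (1/\<theta>) * t = cis (2 * pi * \<beta>)" using \<theta> by (simp add: t_def)
      ultimately show False using \<beta>(3) by simp
    qed
    then obtain k where "\<not> (\<exists>\<^sub>\<infinity>N. \<exists>y. (t, y) \<in> Y q \<and> rarely_bad k N y)" by (auto simp: E_def)
    then obtain N0 where N0: "\<And>N y. N0 \<le> N \<Longrightarrow> (t, y) \<in> Y q \<Longrightarrow> \<not> rarely_bad k N y"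
      by (auto simp: INFM_nat_le)
    let ?B = "\<lambda>x. \<theta> *\<^sub>R (rotation_diag \<alpha>' *v x)"
    have normB: "norm (?B x) = \<theta> * norm x" for x
      using \<theta> orthogonal_transformation_norm[OF orthogonal_transformation_rotation_diag, of \<alpha>' x] by simp
    have normBn: "norm ((?B ^^ n) x) = \<theta> ^ n * norm x" for n x
      by (induction n) (simp_all only: funpow.simps o_apply normB id_apply power.simps mult.assoc mult_1)
    have inY: "(t, \<lambda>n. (?B ^^ n) \<zeta> \<bullet> a j) \<in> Y q" if \<zeta>: "\<zeta> \<in> Z" "1 \<le> norm \<zeta>" "norm \<zeta> \<le> \<theta>" for \<zeta>
    proof -
      have pf: "pair_freq l z t (k, True) = of_real \<theta> * cis (2 * pi * \<alpha>' k)" for k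
        by (simp add: pair_freq_def t_def z_def \<alpha>'_def)
      have "norm \<zeta> \<le> (\<Sum>k\<in>UNIV. cmod (\<zeta> $ k))" unfolding norm_vec_def by (rule L2_set_le_sum) simp
      also have "\<dots> \<le> (\<Sum>k\<in>(UNIV :: 's set). cmod (\<zeta> $ l))" using \<zeta>(1) by (intro sum_mono) (auto simp: Z_def)
      finally have "1 \<le> real CARD('s) * cmod (\<zeta> $ l)" using \<zeta>(2) by simp
      then have "1 * cmod (a j $ l) \<le> real CARD('s) * cmod (\<zeta> $ l) * cmod (a j $ l)" by (intro mult_right_mono) auto
      then have "b0 \<le> cmod (\<zeta> $ l) * cmod (a j $ l) / 2" by (simp add: b0_def field_simps)
      then have b: "1 / (real q + 1) \<le> cmod ((if True then cnj (\<zeta> $ l) * a j $ l else \<zeta> $ l * cnj (a j $ l)) / 2)"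
        using \<eta>(1) by (simp add: norm_mult)
      have "\<bar>(?B ^^ n) \<zeta> \<bullet> a j\<bar> \<le> real q" if "n < 2 * card (UNIV :: ('s \<times> bool) set)" for n
      proof -
        have "\<bar>(?B ^^ n) \<zeta> \<bullet> a j\<bar> \<le> norm ((?B ^^ n) \<zeta>) * norm (a j)" by (rule Cauchy_Schwarz_ineq2)
        also have "\<dots> \<le> M"
          unfolding M_def normBn using \<theta> \<zeta> that by (intro mult_right_mono mult_mono power_increasing) auto
        finally show ?thesis using q by simp
      qed
      then show ?thesis
        unfolding Y_def pair_class_def pair_params_def using tT \<eta> b rotation_orbit_expansion[OF pf, of _ \<zeta> "a j"]
        by (auto intro!: exI[of _ "\<lambda>(k, s). (if s then cnj (\<zeta> $ k) * a j $ k else \<zeta> $ k * cnj (a j $ k)) / 2"])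
    qed
    have "\<exists>C>0. \<exists>\<gamma>>0. \<forall>\<xi>\<in>Z. 1 \<le> norm \<xi> \<longrightarrow> cmod (fourier \<mu> \<xi>) \<le> C * norm \<xi> powr (- \<gamma>)"
    proof (rule fourier_decay_if_not_rarely_bad[where M = "(*v) (rotation_diag \<alpha>')" and a = a,
          OF orthogonal_transformation_rotation_diag \<theta> _ p a])
      show "is_self_similar_measure (\<lambda>x. (1 / \<theta>) *\<^sub>R (rotation_diag \<alpha>' *v x)) m a p \<mu>"
        using ss by (simp add: similitude_def \<alpha>'_def)
      show "x \<in> Z" if "\<theta> *\<^sub>R (rotation_diag \<alpha>' *v x) \<in> Z" for x
        using that \<theta> by (simp add: Z_def rotation_diag_mult_nth norm_mult)
      show "\<exists>j\<le>m. \<not> rarely_bad k N (\<lambda>n. (?B ^^ n) \<zeta> \<bullet> a j)"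
        if "N0 \<le> N" "\<zeta> \<in> Z" "1 \<le> norm \<zeta>" "norm \<zeta> \<le> \<theta>" for N \<zeta>
        using N0[OF that(1) inY[OF that(2-4)]] j(1) by blast
    qed
    moreover have "\<xi> \<in> Z" if "cmod (\<xi> $ l) = (MAX j. cmod (\<xi> $ j))" for \<xi>
    proof -
      have "cmod (\<xi> $ j) \<le> (MAX j. cmod (\<xi> $ j))" for j by (rule Max_ge) auto
      then show ?thesis by (simp add: Z_def that)
    qed
    ultimately show ?thesis by blast
  qed
  then show ?thesis using sub dim by (intro exI[of _ E] conjI) auto
qed


section \<open>Conjugation to diagonal form\<close>

lemma linear_adjoint_bounded_below:
  fixes L :: "'a::euclidean_space \<Rightarrow> 'b::euclidean_space"
  assumes "linear L" "surj L"
  obtains c where "0 < c" "\<And>\<xi>. c * norm \<xi> \<le> norm (adjoint L \<xi>)"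
proof -
  have "inj (adjoint L)"
    unfolding linear_injective_0[OF adjoint_linear[OF assms(1)]]
  proof (intro allI impI)
    fix \<xi> assume 0: "adjoint L \<xi> = 0"
    obtain x where "L x = \<xi>" using assms(2) by (metis surjD)
    then have "\<xi> \<bullet> \<xi> = x \<bullet> adjoint L \<xi>" by (simp add: adjoint_works[OF assms(1)])
    then show "\<xi> = 0" using 0 by simp
  qed
  then show thesis using linear_inj_bounded_below_pos[OF adjoint_linear[OF assms(1)]] that by blast
qed

lemma linear_borel_measurable:
  fixes L :: "'a::euclidean_space \<Rightarrow> 'b::euclidean_space"
  shows "linear L \<Longrightarrow> L \<in> borel_measurable borel"
  by (intro borel_measurable_continuous_onI linear_continuous_on) (simp add: linear_conv_bounded_linear)

text \<open>The transform of the image measure at \<xi> is that of \<mu> at the adjoint image of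
  \<xi>. Surjectivity of L makes the adjoint injective, hence bounded below, and the power of the
  lower bound is absorbed by the constant.\<close>

lemma power_decay_distr:
  fixes L :: "'a::euclidean_space \<Rightarrow> 'b::euclidean_space"
  assumes L: "linear L" "surj L" and \<mu>: "\<mu> \<in> power_decay_measures"
  shows "distr \<mu> borel L \<in> power_decay_measures"
proof -
  have fin: "finite_measure \<mu>" and sets\<mu>: "sets \<mu> = sets borel" using \<mu> by (auto simp: power_decay_measures_def)
  have Lm: "L \<in> \<mu> \<rightarrow>\<^sub>M borel"
    using linear_borel_measurable[OF L(1)] measurable_cong_sets[OF sets\<mu> refl] by blast
  have F: "fourier (distr \<mu> borel L) \<xi> = fourier \<mu> (adjoint L \<xi>)" for \<xi>
  proof -
    have "(\<lambda>x. cis (- (2 * pi * (\<xi> \<bullet> x)))) \<in> borel_measurable borel" unfolding cis_conv_exp by measurable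
    then show ?thesis
      unfolding fourier_eq_cis
      by (subst integral_distr[OF Lm]) (simp_all add: adjoint_works[OF L(1)] inner_commute)
  qed
  obtain \<gamma> where \<gamma>: "0 < \<gamma>" and O: "(\<lambda>\<xi>. cmod (fourier \<mu> \<xi>)) \<in> O[at_infinity](\<lambda>\<xi>. norm \<xi> powr (-\<gamma>))"
    using \<mu> by (auto simp: power_decay_measures_def)
  obtain K where K: "0 < K" and ev: "\<forall>\<^sub>F \<xi> in at_infinity. norm (cmod (fourier \<mu> \<xi>)) \<le> K * norm (norm \<xi> powr (-\<gamma>))"
    using landau_o.bigE[OF O] by blast
  then obtain b where b: "\<And>\<xi>. b \<le> norm \<xi> \<Longrightarrow> cmod (fourier \<mu> \<xi>) \<le> K * norm \<xi> powr (-\<gamma>)"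
    by (auto simp: eventually_at_infinity)
  obtain c where c: "0 < c" "\<And>\<xi>. c * norm \<xi> \<le> norm (adjoint L \<xi>)" using linear_adjoint_bounded_below[OF L] by blast
  have "cmod (fourier (distr \<mu> borel L) \<xi>) \<le> K * c powr (-\<gamma>) * norm \<xi> powr (-\<gamma>)" if \<xi>: "max 1 (b / c) \<le> norm \<xi>" for \<xi>
  proof -
    have "b \<le> c * norm \<xi>" using \<xi> c by (simp add: divide_le_eq mult.commute)
    then have "cmod (fourier \<mu> (adjoint L \<xi>)) \<le> K * norm (adjoint L \<xi>) powr (-\<gamma>)"
      using c(2)[of \<xi>] by (intro b) linarith
    also have "\<dots> \<le> K * (c * norm \<xi>) powr (-\<gamma>)"
    proof (rule mult_left_mono[OF powr_mono2'])
      show "0 < c * norm \<xi>" using c(1) \<xi> by (intro mult_pos_pos) linarith+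
    qed (use K c(2)[of \<xi>] \<gamma> in auto)
    finally show ?thesis using c by (simp add: F powr_mult)
  qed
  then have "\<forall>\<^sub>F \<xi> in at_infinity. norm (cmod (fourier (distr \<mu> borel L) \<xi>)) \<le> K * c powr (-\<gamma>) * norm (norm \<xi> powr (-\<gamma>))"
    unfolding eventually_at_infinity by (intro exI[of _ "max 1 (b / c)"]) simp
  then have "(\<lambda>\<xi>. cmod (fourier (distr \<mu> borel L) \<xi>)) \<in> O[at_infinity](\<lambda>\<xi>. norm \<xi> powr (-\<gamma>))" by (rule bigoI)
  then show ?thesis
    using finite_measure.finite_measure_distr[OF fin Lm] \<gamma> by (auto simp: power_decay_measures_def)
qed

lemma power_decay_distr_iff:
  fixes L :: "'a::euclidean_space \<Rightarrow> 'b::euclidean_space"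
  assumes L: "linear L" "bij L" and sets\<mu>: "sets \<mu> = sets borel"
  shows "\<mu> \<in> power_decay_measures \<longleftrightarrow> distr \<mu> borel L \<in> power_decay_measures"
proof
  assume D: "distr \<mu> borel L \<in> power_decay_measures"
  obtain g where g: "linear g" "g \<circ> L = id"
    using linear_injective_left_inverse[OF L(1) bij_is_inj[OF L(2)]] by blast
  have "surj g" using g(2) by (metis comp_apply id_apply surj_def)
  then have "distr (distr \<mu> borel L) borel g \<in> power_decay_measures" by (rule power_decay_distr[OF g(1) _ D])
  moreover have "distr (distr \<mu> borel L) borel g = distr \<mu> borel (g \<circ> L)"
    using linear_borel_measurable[OF g(1)] linear_borel_measurable[OF L(1)] measurable_cong_sets[OF sets\<mu> refl]
    by (intro distr_distr) auto
  moreover have "distr \<mu> borel id = \<mu>" using sets\<mu> by (intro measure_eqI) (auto simp: emeasure_distr measurable_cong_sets[OF sets\<mu> refl] sets_eq_imp_space_eq[OF sets\<mu>])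
  ultimately show "\<mu> \<in> power_decay_measures" using g(2) by simp
qed (rule power_decay_distr[OF L(1) bij_is_surj[OF L(2)]])

lemma cyclic_for_conj_iff:
  fixes L :: "'a::real_vector \<Rightarrow> 'b::real_vector"
  assumes L: "linear L" "bij L" and conj: "\<And>x. L (A x) = A' (L x)"
  shows "cyclic_for A D \<longleftrightarrow> cyclic_for A' (L ` D)"
proof
  assume cyc: "cyclic_for A D"
  show "cyclic_for A' (L ` D)"
    unfolding cyclic_for_def
  proof (intro allI impI, elim conjE)
    fix S assume S: "subspace S" "A' ` S \<subseteq> S" "L ` D \<subseteq> S"
    have "subspace (L -` S)" using linear_subspace_vimage[OF L(1) S(1)] .
    moreover have "A ` (L -` S) \<subseteq> L -` S" using S(2) by (auto simp: conj)
    moreover have "D \<subseteq> L -` S" using S(3) by auto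
    ultimately have "L -` S = UNIV" using cyc unfolding cyclic_for_def by blast
    then show "S = UNIV" using bij_is_surj[OF L(2)] by (metis surj_image_vimage_eq)
  qed
next
  assume cyc: "cyclic_for A' (L ` D)"
  show "cyclic_for A D"
    unfolding cyclic_for_def
  proof (intro allI impI, elim conjE)
    fix S assume S: "subspace S" "A ` S \<subseteq> S" "D \<subseteq> S"
    have "subspace (L ` S)" using linear_subspace_image[OF L(1) S(1)] .
    moreover have "A' ` (L ` S) \<subseteq> L ` S" using S(2) by (auto simp flip: conj)
    moreover have "L ` D \<subseteq> L ` S" using S(3) by auto
    ultimately have "L ` S = UNIV" using cyc unfolding cyclic_for_def by blast
    then show "S = UNIV" using bij_is_inj[OF L(2)] by (metis inj_vimage_image_eq vimage_UNIV)
  qed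
qed

lemma self_similar_distr:
  fixes L :: "'a::euclidean_space \<Rightarrow> 'b::euclidean_space"
  assumes L: "linear L" and conj: "\<And>x. L (A x) = A' (L x)" and A': "A' \<in> borel_measurable borel"
    and ss: "is_self_similar_measure A m a p \<mu>"
  shows "is_self_similar_measure A' m (L \<circ> a) p (distr \<mu> borel L)"
proof -
  have prob: "prob_space \<mu>" and sets\<mu>: "sets \<mu> = sets borel"
    and eq: "\<And>B. B \<in> sets borel \<Longrightarrow> measure \<mu> B = (\<Sum>j\<le>m. p j * measure \<mu> ((\<lambda>x. A x + a j) -` B))"
    using ss by (auto simp: is_self_similar_measure_def)
  have Lb: "L \<in> borel \<rightarrow>\<^sub>M borel" by (rule linear_borel_measurable[OF L])
  then have Lm: "L \<in> \<mu> \<rightarrow>\<^sub>M borel" using measurable_cong_sets[OF sets\<mu> refl] by blast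
  have md: "measure (distr \<mu> borel L) B = measure \<mu> (L -` B)" if "B \<in> sets borel" for B
    using measure_distr[OF Lm that] sets_eq_imp_space_eq[OF sets\<mu>] by simp
  show ?thesis
    unfolding is_self_similar_measure_def
  proof (intro conjI ballI)
    show "prob_space (distr \<mu> borel L)" by (rule prob_space.prob_space_distr[OF prob Lm])
    fix B :: "'b set" assume B: "B \<in> sets borel"
    have "L -` B \<in> sets borel" using measurable_sets[OF Lb B] by simp
    then have "measure (distr \<mu> borel L) B = (\<Sum>j\<le>m. p j * measure \<mu> ((\<lambda>x. A x + a j) -` (L -` B)))"
      unfolding md[OF B] by (rule eq)
    also have "\<dots> = (\<Sum>j\<le>m. p j * measure (distr \<mu> borel L) ((\<lambda>x. A' x + (L \<circ> a) j) -` B))"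
    proof (rule sum.cong)
      fix j
      have "(\<lambda>x. A' x + (L \<circ> a) j) \<in> borel_measurable borel" using A' by simp
      from measurable_sets[OF this B] have "(\<lambda>x. A' x + (L \<circ> a) j) -` B \<in> sets borel" by simp
      moreover have "(\<lambda>x. A x + a j) -` (L -` B) = L -` ((\<lambda>x. A' x + (L \<circ> a) j) -` B)"
        by (auto simp: linear_add[OF L] conj)
      ultimately show "p j * measure \<mu> ((\<lambda>x. A x + a j) -` (L -` B))
          = p j * measure (distr \<mu> borel L) ((\<lambda>x. A' x + (L \<circ> a) j) -` B)" by (simp add: md)
    qed simp
    finally show "measure (distr \<mu> borel L) B
        = (\<Sum>j\<le>m. p j * measure (distr \<mu> borel L) ((\<lambda>x. A' x + (L \<circ> a) j) -` B))" .
  qed simp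
qed

section \<open>Complexified real matrices and pairings with eigenvectors\<close>

abbreviation complex_matrix :: "real ^ 'n ^ 'm \<Rightarrow> complex ^ 'n ^ 'm" where
  "complex_matrix \<equiv> map_matrix complex_of_real"

lemma complex_matrix_mult_mult:
  fixes A :: "real ^ 'm ^ 'l" and B :: "real ^ 'n ^ 'm"
  shows "complex_matrix A *v (complex_matrix B *v v) = complex_matrix (A ** B) *v v"
proof -
  have "complex_matrix A ** complex_matrix B = complex_matrix (A ** B)"
    by (simp add: vec_eq_iff matrix_matrix_mult_def map_matrix_def)
  then show ?thesis by (simp add: matrix_vector_mul_assoc)
qed

lemma complex_matrix_1 [simp]: "complex_matrix (mat 1 :: real ^ 'n ^ 'n) *v v = v"
proof -
  have "complex_matrix (mat 1 :: real ^ 'n ^ 'n) = mat 1" by (simp add: vec_eq_iff mat_def map_matrix_def)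
  then show ?thesis by simp
qed

text \<open>Bilinear, without the conjugation of a Hermitian product, so that a real matrix moves
  across as its transpose and acts on the eigenvector itself.\<close>

definition real_pairing :: "complex ^ 'n \<Rightarrow> real ^ 'n \<Rightarrow> complex" where
  "real_pairing v x = (\<Sum>i\<in>UNIV. v $ i * of_real (x $ i))"

lemma real_pairing_matrix:
  fixes Q :: "real ^ 'n ^ 'm"
  shows "real_pairing v (Q *v x) = real_pairing (complex_matrix (transpose Q) *v v) x"
proof -
  have "real_pairing v (Q *v x) = (\<Sum>i\<in>UNIV. \<Sum>j\<in>UNIV. v $ i * of_real (Q $ i $ j) * of_real (x $ j))"
    by (simp add: real_pairing_def matrix_vector_mult_def sum_distrib_left mult.assoc)
  also have "\<dots> = (\<Sum>j\<in>UNIV. \<Sum>i\<in>UNIV. v $ i * of_real (Q $ i $ j) * of_real (x $ j))" by (rule sum.swap)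
  also have "\<dots> = real_pairing (complex_matrix (transpose Q) *v v) x"
    by (simp add: real_pairing_def matrix_vector_mult_def sum_distrib_left sum_distrib_right transpose_def map_matrix_def mult_ac)
  finally show ?thesis .
qed

lemma orthogonal_eigenvector_transpose:
  fixes Q :: "real ^ 'n ^ 'n"
  assumes "orthogonal_matrix Q" "complex_matrix Q *v v = z *s v" "z \<noteq> 0"
  shows "complex_matrix (transpose Q) *v v = inverse z *s v"
proof -
  have "v = complex_matrix (transpose Q) *v (complex_matrix Q *v v)"
    using assms(1) by (simp add: complex_matrix_mult_mult orthogonal_matrix_def)
  also have "\<dots> = z *s (complex_matrix (transpose Q) *v v)"
    by (simp add: assms(2) vec.scale)
  finally have "inverse z *s v = inverse z *s (z *s (complex_matrix (transpose Q) *v v))" by simp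
  then show ?thesis using assms(3) by (simp add: vector_smult_assoc)
qed

text \<open>The coordinates of \<open>L\<close> are the pairings with eigenvectors of \<open>Q\<close>; surjectivity comes from the
  fact that \<open>range L\<close> is a rotation-invariant subspace contained in no coordinate hyperplane.\<close>

lemma orthogonal_conj_rotation:
  fixes Q :: "real ^ 'n ^ 'n" and \<alpha> :: "'s::finite \<Rightarrow> real"
  assumes card: "CARD('n) = 2 * CARD('s)" and Q: "orthogonal_matrix Q"
    and \<alpha>: "inj \<alpha>" "range \<alpha> \<subseteq> {0<..<1/2}" and ev: "\<And>j. cis (2 * pi * \<alpha> j) \<in> complex_eigenvalues Q"
  obtains L :: "real ^ 'n \<Rightarrow> complex ^ 's" where "linear L" "bij L" "\<And>x. L (Q *v x) = rotation_diag \<alpha> *v L x"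
proof -
  have "\<exists>v. v \<noteq> 0 \<and> complex_matrix Q *v v = cis (2 * pi * \<alpha> j) *s v" for j
    using ev[of j] by (simp add: complex_eigenvalues_def)
  then obtain v where v: "\<And>j. v j \<noteq> 0" "\<And>j. complex_matrix Q *v v j = cis (2 * pi * \<alpha> j) *s v j" by metis
  define L :: "real ^ 'n \<Rightarrow> complex ^ 's" where "L x = (\<chi> j. real_pairing (v j) x)" for x
  have lin: "linear L"
    by (rule linearI) (simp_all add: L_def real_pairing_def vec_eq_iff algebra_simps sum.distrib
        sum_distrib_left scaleR_conv_of_real[where 'a = complex])
  \<comment> \<open>Moving Q across the pairing gives its transpose, that is its inverse, so the
    eigenvalue \<open>cis (2 * pi * \<alpha> j)\<close> becomes the entry
    \<open>cis (- (2 * pi * \<alpha> j))\<close> of \<open>rotation_diag\<close>.\<close>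
  have conj: "L (Q *v x) = rotation_diag \<alpha> *v L x" for x
  proof -
    have "real_pairing (v j) (Q *v x) = cis (- (2 * pi * \<alpha> j)) * real_pairing (v j) x" for j
      unfolding real_pairing_matrix orthogonal_eigenvector_transpose[OF Q v(2) cis_neq_zero]
      by (simp add: real_pairing_def sum_distrib_left mult.assoc)
    then show ?thesis by (simp add: L_def vec_eq_iff rotation_diag_mult_nth)
  qed
  have "range L = UNIV"
  proof (rule rotation_invariant_subspace_eq_UNIV[OF \<alpha>])
    show "subspace (range L)" using linear_subspace_image[OF lin subspace_UNIV] .
    show "rotation_diag \<alpha> *v y \<in> range L" if "y \<in> range L" for y
      using that by (auto simp flip: conj)
    show "\<exists>y\<in>range L. y $ k \<noteq> 0" for k
    proof -
      obtain i where i: "v k $ i \<noteq> 0" using v(1)[of k] by (auto simp: vec_eq_iff)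
      have "real_pairing (v k) (axis i 1) = v k $ i"
        by (simp add: real_pairing_def axis_def if_distrib[of "\<lambda>x. _ * of_real x"] cong: if_cong)
      then show ?thesis using i by (intro bexI[of _ "L (axis i 1)"]) (auto simp: L_def)
    qed
  qed
  \<comment> \<open>Both sides have real dimension \<open>2 * CARD('s)\<close>, so surjectivity
    implies injectivity.\<close>
  moreover have "inj L" using lin \<open>range L = UNIV\<close>
    by (intro linear_surjective_imp_injective) (simp_all add: card)
  ultimately have "bij L" by (simp add: bij_def)
  from that[OF lin this conj] show thesis .
qed

theorem orthogonal_conj_rotation_measures:
  fixes Q :: "real ^ 'n ^ 'n" and \<alpha> :: "'s::finite \<Rightarrow> real"
  assumes card: "CARD('n) = 2 * CARD('s)" and Q: "orthogonal_matrix Q"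
    and \<alpha>: "inj \<alpha>" "range \<alpha> \<subseteq> {0<..<1/2}" and ev: "\<And>j. cis (2 * pi * \<alpha> j) \<in> complex_eigenvalues Q"
  shows "\<exists>L :: real ^ 'n \<Rightarrow> complex ^ 's.
              linear L \<and> bij L \<and> (\<forall>x. L (Q *v x) = rotation_diag \<alpha> *v L x) \<and>
              (\<forall>(\<theta>::real) (m::nat) a p \<mu>.
                 \<theta> > 1 \<and> m \<ge> 1 \<and> a 0 = 0 \<and> positive_prob_vector m p \<and>
                 is_self_similar_measure (similitude (1/\<theta>) Q) m a p \<mu>
                 \<longrightarrow> (cyclic_for (similitude (1/\<theta>) Q) (a ` {..m}) \<longleftrightarrow>
                        cyclic_for (similitude (1/\<theta>) (rotation_diag \<alpha>)) ((L \<circ> a) ` {..m})) \<and>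
                     is_self_similar_measure (similitude (1/\<theta>) (rotation_diag \<alpha>)) m (L \<circ> a) p
                       (distr \<mu> borel L) \<and>
                     (\<mu> \<in> power_decay_measures \<longleftrightarrow> distr \<mu> borel L \<in> power_decay_measures))"
proof -
  obtain L :: "real ^ 'n \<Rightarrow> complex ^ 's" where L: "linear L" "bij L"
    and conj: "\<And>x. L (Q *v x) = rotation_diag \<alpha> *v L x"
    using orthogonal_conj_rotation[OF card Q \<alpha> ev] by metis
  have conj': "L (similitude r Q x) = similitude r (rotation_diag \<alpha>) (L x)" for r x
    by (simp add: similitude_def conj linear_scale[OF L(1)])
  have meas: "similitude r (rotation_diag \<alpha>) \<in> borel_measurable borel" for r
  proof -
    have "linear (similitude r (rotation_diag \<alpha>))"
      unfolding similitude_def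
      by (intro linear_compose_scale_right) (rule orthogonal_transformation_linear[OF orthogonal_transformation_rotation_diag])
    then show ?thesis by (rule linear_borel_measurable)
  qed
  show ?thesis
  proof (rule exI[of _ L], intro conjI allI impI)
    fix \<theta> :: real and m :: nat and a p \<mu>
    assume *: "\<theta> > 1 \<and> m \<ge> 1 \<and> a 0 = 0 \<and> positive_prob_vector m p \<and>
                 is_self_similar_measure (similitude (1/\<theta>) Q) m a p \<mu>"
    show "cyclic_for (similitude (1/\<theta>) Q) (a ` {..m}) \<longleftrightarrow>
        cyclic_for (similitude (1/\<theta>) (rotation_diag \<alpha>)) ((L \<circ> a) ` {..m})"
      using cyclic_for_conj_iff[where A = "similitude (1/\<theta>) Q" and A' = "similitude (1/\<theta>) (rotation_diag \<alpha>)",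
          OF L conj', of "a ` {..m}"] by (simp only: image_comp)
    show "is_self_similar_measure (similitude (1/\<theta>) (rotation_diag \<alpha>)) m (L \<circ> a) p (distr \<mu> borel L)"
      using * by (intro self_similar_distr[where A = "similitude (1/\<theta>) Q", OF L(1) conj' meas]) blast
    show "\<mu> \<in> power_decay_measures \<longleftrightarrow> distr \<mu> borel L \<in> power_decay_measures"
      using * by (intro power_decay_distr_iff[OF L]) (auto simp: is_self_similar_measure_def)
  qed (simp_all only: L conj)
qed


section \<open>Orbits of orthogonal matrices\<close>

text \<open>The vector p(Q) x, evaluated by Horner's scheme.\<close>

definition poly_act :: "complex ^ 'n ^ 'n \<Rightarrow> complex poly \<Rightarrow> complex ^ 'n \<Rightarrow> complex ^ 'n" where
  "poly_act Q p x = fold_coeffs (\<lambda>c y. c *s x + Q *v y) p 0"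

lemma poly_act_0 [simp]: "poly_act Q 0 x = 0"
  by (simp add: poly_act_def)

lemma poly_act_pCons [simp]: "poly_act Q (pCons c p) x = c *s x + Q *v poly_act Q p x"
proof (cases "c = 0 \<and> p = 0")
  case False
  then show ?thesis
    unfolding poly_act_def by (cases "p = 0") (simp_all add: fold_coeffs_pCons_coeff_not_0_eq fold_coeffs_pCons_not_0_0_eq)
qed simp

lemma poly_act_add: "poly_act Q (p + q) x = poly_act Q p x + poly_act Q q x"
proof (induction p arbitrary: q)
  case (pCons c p)
  obtain d r where q: "q = pCons d r" by (cases q)
  show ?case
    using pCons.IH[of r] by (simp add: q algebra_simps vec.scale_left_distrib matrix_vector_right_distrib)
qed simp

lemma poly_act_smult: "poly_act Q (smult c p) x = c *s poly_act Q p x"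
  by (induction p) (simp_all add: vec.scale_right_distrib vec.scale vector_smult_assoc)

lemma poly_act_monom: "poly_act Q (monom c k) x = c *s (((*v) Q) ^^ k) x"
  by (induction k) (simp_all add: monom_0 monom_Suc vec.scale)

lemma poly_act_sum: "finite K \<Longrightarrow> poly_act Q (\<Sum>k\<in>K. p k) x = (\<Sum>k\<in>K. poly_act Q (p k) x)"
  by (induction K rule: finite_induct) (simp_all add: poly_act_add)

text \<open>The iterates of x of orders 0 to N outnumber the real dimension N, so they satisfy a
  linear relation. A repetition among them is treated apart, since the set of iterates would then be
  too small for the dimension count.\<close>

lemma ex_annihilating_poly:
  fixes Q :: "complex ^ 'n ^ 'n"
  shows "\<exists>p. p \<noteq> 0 \<and> poly_act Q p x = 0"
proof -
  define N where "N = DIM(complex ^ 'n)"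
  let ?f = "\<lambda>k. (((*v) Q) ^^ k) x"
  show ?thesis
  proof (cases "inj_on ?f {..N}")
    case False
    then obtain i j where ij: "i \<noteq> j" "?f i = ?f j" by (auto simp: inj_on_def)
    define p where "p = monom (1::complex) i + monom (- 1) j"
    have "coeff p i = 1" using ij by (simp add: p_def)
    then have "p \<noteq> 0" by auto
    moreover have "poly_act Q p x = 0" using ij by (simp add: p_def poly_act_add poly_act_monom)
    ultimately show ?thesis by blast
  next
    case True
    have c: "card (?f ` {..N}) = Suc N" by (simp add: card_image[OF True])
    have "dependent (?f ` {..N})" by (rule dependent_biggerset) (simp, unfold c, simp add: N_def)
    then obtain u v where u: "v \<in> ?f ` {..N}" "u v \<noteq> 0" "(\<Sum>v\<in>?f ` {..N}. u v *\<^sub>R v) = 0"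
      using dependent_finite[of "?f ` {..N}"] by auto
    then obtain k where k: "k \<le> N" "u (?f k) \<noteq> 0" by auto
    define p where "p = (\<Sum>k\<le>N. monom (complex_of_real (u (?f k))) k)"
    have "coeff p k = of_real (u (?f k))" using k by (simp add: p_def coeff_sum)
    then have "p \<noteq> 0" using k by auto
    moreover have "poly_act Q p x = (\<Sum>k\<le>N. u (?f k) *\<^sub>R ?f k)"
      unfolding p_def by (simp add: poly_act_sum poly_act_monom vec_eq_iff scaleR_conv_of_real[where 'a = complex])
    then have "poly_act Q p x = 0" using u(3) by (simp add: sum.reindex[OF True])
    ultimately show ?thesis by blast
  qed
qed

text \<open>Split a root off an annihilating polynomial, p = (X - z) r: either r(Q) x is nonzero and
  hence an eigenvector for z, or r annihilates x and has smaller degree.\<close>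

lemma ex_eigenvector_in_invariant:
  fixes Q :: "complex ^ 'n ^ 'n"
  assumes S: "\<And>x y. x \<in> S \<Longrightarrow> y \<in> S \<Longrightarrow> x + y \<in> S" "\<And>c x. x \<in> S \<Longrightarrow> c *s x \<in> S" "\<And>x. x \<in> S \<Longrightarrow> Q *v x \<in> S"
    and x: "x \<in> S" "x \<noteq> 0"
  shows "\<exists>w\<in>S. w \<noteq> 0 \<and> (\<exists>z. Q *v w = z *s w)"
proof -
  have "0 \<in> S" using S(2)[OF x(1), of 0] by simp
  have act: "poly_act Q p x \<in> S" for p by (induction p) (use S x \<open>0 \<in> S\<close> in auto)
  have "\<exists>w\<in>S. w \<noteq> 0 \<and> (\<exists>z. Q *v w = z *s w)" if "p \<noteq> 0" "poly_act Q p x = 0" for p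
    using that
  proof (induction "degree p" arbitrary: p rule: less_induct)
    case less
    have "degree p \<noteq> 0"
    proof
      assume "degree p = 0"
      then obtain c where "p = [:c:]" by (rule degree_eq_zeroE)
      then show False using less.prems x by simp
    qed
    then obtain z where "poly p z = 0"
      using fundamental_theorem_of_algebra[of p] by (auto simp: constant_degree)
    then obtain r where p: "p = [:- z, 1:] * r" by (auto simp: poly_eq_0_iff_dvd elim: dvdE)
    have r: "r \<noteq> 0" using less.prems p by auto
    have "p = smult (- z) r + pCons 0 r" by (simp add: p)
    then have eq: "Q *v poly_act Q r x = z *s poly_act Q r x"
    proof -
      have "poly_act Q p x = (- z) *s poly_act Q r x + Q *v poly_act Q r x"
        unfolding \<open>p = smult (- z) r + pCons 0 r\<close> poly_act_add poly_act_smult by simp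
      then show ?thesis using less.prems(2) by (simp add: vec_eq_iff)
    qed
    show ?case
    proof (cases "poly_act Q r x = 0")
      case True
      have "degree r < degree p" using r by (simp add: p degree_mult_eq del: mult_pCons_left)
      then show ?thesis using less.hyps r True by blast
    next
      case False
      then show ?thesis using eq act by blast
    qed
  qed
  then show ?thesis using ex_annihilating_poly by blast
qed

lemma inner_complex_matrix:
  fixes A :: "real ^ 'n ^ 'm"
  shows "(complex_matrix A *v x) \<bullet> y = x \<bullet> (complex_matrix (transpose A) *v y)"
proof -
  have "(complex_matrix A *v x) \<bullet> y = (\<Sum>i\<in>UNIV. \<Sum>k\<in>UNIV. A $ i $ k * (x $ k \<bullet> y $ i))"
    by (simp add: inner_vec_def matrix_vector_mult_def map_matrix_def inner_sum_left flip: scaleR_conv_of_real)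
  also have "\<dots> = (\<Sum>k\<in>UNIV. \<Sum>i\<in>UNIV. A $ i $ k * (x $ k \<bullet> y $ i))" by (rule sum.swap)
  also have "\<dots> = x \<bullet> (complex_matrix (transpose A) *v y)"
    by (simp add: inner_vec_def matrix_vector_mult_def map_matrix_def transpose_def inner_sum_right flip: scaleR_conv_of_real)
  finally show ?thesis .
qed

lemma inner_vector_smult: "((c::complex) *s x) \<bullet> y = x \<bullet> (cnj c *s y)"
  by (simp add: inner_vec_def inner_complex_def algebra_simps)

lemma orthogonal_eigenvalue_unimodular:
  fixes Q :: "real ^ 'n ^ 'n"
  assumes Q: "orthogonal_matrix Q" and w: "complex_matrix Q *v w = z *s w" "w \<noteq> 0"
  shows "cmod z = 1"
proof -
  have "w \<bullet> w = (complex_matrix Q *v w) \<bullet> (complex_matrix Q *v w)"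
    using Q by (simp add: inner_complex_matrix complex_matrix_mult_mult orthogonal_matrix_def)
  also have "\<dots> = w \<bullet> ((cnj z * z) *s w)"
    by (simp add: w inner_vector_smult vector_smult_assoc)
  also have "(cnj z * z) *s w = (cmod z)\<^sup>2 *\<^sub>R w"
    by (simp add: vec_eq_iff scaleR_conv_of_real[where 'a = complex] mult.commute flip: complex_norm_square)
  finally have "(cmod z)\<^sup>2 = 1" using w(2) by simp
  then show ?thesis using norm_ge_zero[of z] by (auto simp: power2_eq_1_iff simp del: norm_ge_zero)
qed

text \<open>The orthogonal complement of the eigenvectors is invariant; were it nonzero, it would contain
  an eigenvector.\<close>

lemma span_eigenvectors_orthogonal:
  fixes Q :: "real ^ 'n ^ 'n"
  assumes Q: "orthogonal_matrix Q"
  shows "span {w. \<exists>z. cmod z = 1 \<and> complex_matrix Q *v w = z *s w} = UNIV"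
proof (rule ccontr)
  let ?V = "{w. \<exists>z. cmod z = 1 \<and> complex_matrix Q *v w = z *s w}"
  assume "span ?V \<noteq> UNIV"
  then have "dim ?V < DIM(complex ^ 'n)" using dim_eq_full[of ?V] dim_subset_UNIV[of ?V] by simp
  then obtain x where x: "x \<noteq> 0" "\<And>y. y \<in> span ?V \<Longrightarrow> orthogonal x y"
    using orthogonal_to_subspace_exists by blast
  \<comment> \<open>The complement is taken for the real inner product; it is nevertheless closed
    under complex scalars, because the set of eigenvectors is.\<close>
  define S where "S = {x. \<forall>w\<in>?V. x \<bullet> w = 0}"
  have smult: "c *s w \<in> ?V" if "w \<in> ?V" for c w
    using that by (auto simp: vec.scale vector_smult_assoc mult.commute)
  have "x \<in> S" using x(2) by (auto simp: S_def orthogonal_def intro: span_base)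
  moreover have "x + y \<in> S" if "x \<in> S" "y \<in> S" for x y using that by (auto simp: S_def inner_add_left)
  moreover have "c *s x \<in> S" if "x \<in> S" for c x
    using that smult unfolding S_def by (auto simp: inner_vector_smult)
  moreover have "complex_matrix Q *v x \<in> S" if "x \<in> S" for x
    unfolding S_def
  proof (intro CollectI ballI)
    fix w assume w: "w \<in> ?V"
    then obtain z where z: "cmod z = 1" "complex_matrix Q *v w = z *s w" by blast
    then have "complex_matrix (transpose Q) *v w = inverse z *s w"
      by (intro orthogonal_eigenvector_transpose[OF Q]) auto
    then show "(complex_matrix Q *v x) \<bullet> w = 0"
      using that smult[OF w, of "inverse z"] by (auto simp: inner_complex_matrix S_def)
  qed
  ultimately obtain w z where w: "w \<in> S" "w \<noteq> 0" "complex_matrix Q *v w = z *s w"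
    using ex_eigenvector_in_invariant[of S "complex_matrix Q" x] x(1) by blast
  then have "w \<in> ?V" using orthogonal_eigenvalue_unimodular[OF Q w(3,2)] by blast
  then have "w \<bullet> w = 0" using w(1) by (auto simp: S_def)
  then show False using w(2) by simp
qed

text \<open>Each standard basis vector is expanded once in eigenvectors, so F depends on Q alone
  while \<eta> and a enter only through the coefficients. Terms with equal eigenvalue are merged,
  because separation of frequencies requires them to be distinct.\<close>

lemma orthogonal_orbit_expansion:
  fixes Q :: "real ^ 'n ^ 'n"
  assumes Q: "orthogonal_matrix Q"
  obtains F :: "complex set" where "finite F" "\<And>u. u \<in> F \<Longrightarrow> cmod u = 1"
    "\<And>\<eta> a. \<exists>b. \<forall>n. complex_of_real ((((*v) Q) ^^ n) \<eta> \<bullet> a) = (\<Sum>u\<in>F. b u * u ^ n)"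
proof -
  let ?Qc = "complex_matrix Q"
  let ?V = "{w. \<exists>z. cmod z = 1 \<and> ?Qc *v w = z *s w}"
  define z where "z w = (SOME z. cmod z = 1 \<and> ?Qc *v w = z *s w)" for w
  have z: "cmod (z w) = 1 \<and> ?Qc *v w = z w *s w" if "w \<in> ?V" for w
    unfolding z_def using that by (intro someI_ex[of "\<lambda>z. cmod z = 1 \<and> ?Qc *v w = z *s w"]) blast
  have ex: "\<exists>t r. finite t \<and> t \<subseteq> ?V \<and> axis i 1 = (\<Sum>w\<in>t. r w *\<^sub>R w)" for i
  proof -
    have "axis i 1 \<in> span ?V" using span_eigenvectors_orthogonal[OF Q] by simp
    then show ?thesis unfolding span_explicit by blast
  qed
  from choice[OF allI[OF ex]]
  obtain t where t': "\<forall>i. \<exists>r. finite (t i) \<and> t i \<subseteq> ?V \<and> axis i 1 = (\<Sum>w\<in>t i. r w *\<^sub>R w)" ..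
  from choice[OF t']
  obtain r where r: "\<forall>i. finite (t i) \<and> t i \<subseteq> ?V \<and> axis i 1 = (\<Sum>w\<in>t i. r i w *\<^sub>R w)" ..
  have t: "finite (t i)" "t i \<subseteq> ?V" "axis i 1 = (\<Sum>w\<in>t i. r i w *\<^sub>R w)" for i
    using spec[OF r, of i] by (simp_all only:)
  define J where "J = Sigma UNIV t"
  have J: "finite J" using t(1) by (simp add: J_def)
  define F where "F = (\<lambda>(i, w). z w) ` J"
  have expansion: "\<exists>b. \<forall>n. complex_of_real ((((*v) Q) ^^ n) \<eta> \<bullet> a) = (\<Sum>u\<in>F. b u * u ^ n)" for \<eta> a
  proof -
    define c where "c = (\<lambda>(i, w). of_real (\<eta> $ i) * of_real (r i w) * real_pairing w a)"
    define e :: "real ^ 'n \<Rightarrow> complex ^ 'n" where "e x = (\<chi> i. of_real (x $ i))" for x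
    have e_orbit: "(((*v) ?Qc) ^^ n) (e \<eta>) = e ((((*v) Q) ^^ n) \<eta>)" for n
    proof (induction n)
      case (Suc n)
      have "?Qc *v e x = e (Q *v x)" for x
        by (simp add: e_def vec_eq_iff matrix_vector_mult_def map_matrix_def)
      then show ?case using Suc by simp
    qed simp
    have lin1: "linear ((*v) ?Qc)" by (rule linearI) (simp_all add: vec_eq_iff
          matrix_vector_mult_def scaleR_sum_right distrib_left sum.distrib)
    have lin: "linear (\<lambda>x. real_pairing ((((*v) ?Qc) ^^ n) x) a)" for n
    proof -
      have l: "linear (((*v) ?Qc) ^^ n)"
      proof (induction n)
        case (Suc n)
        then show ?case using linear_compose[OF Suc lin1] by (simp add: o_def)
      qed (simp add: linear_iff)
      show ?thesis
        by (rule linearI) (simp_all add: linear_add[OF l] linear_scale[OF l] real_pairing_def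
            algebra_simps sum.distrib scaleR_sum_right)
    qed
    have eig: "(((*v) ?Qc) ^^ n) w = z w ^ n *s w" if "w \<in> ?V" for n w
      by (induction n) (simp_all add: vec.scale z[OF that] vector_smult_assoc mult.commute)
    have "complex_of_real ((((*v) Q) ^^ n) \<eta> \<bullet> a) = (\<Sum>j\<in>J. c j * (case j of (i, w) \<Rightarrow> z w) ^ n)" for n
    proof -
      have "complex_of_real ((((*v) Q) ^^ n) \<eta> \<bullet> a) = real_pairing ((((*v) ?Qc) ^^ n) (e \<eta>)) a"
        unfolding e_orbit by (simp add: real_pairing_def inner_vec_def e_def)
      also have "e \<eta> = (\<Sum>i\<in>UNIV. \<eta> $ i *\<^sub>R axis i 1)"
        by (simp add: e_def vec_eq_iff axis_def scaleR_conv_of_real[where 'a = complex]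
            if_distrib[of "\<lambda>x. _ * x"] cong: if_cong)
      also have "real_pairing ((((*v) ?Qc) ^^ n) (\<Sum>i\<in>UNIV. \<eta> $ i *\<^sub>R axis i 1)) a
          = (\<Sum>i\<in>UNIV. \<eta> $ i *\<^sub>R (\<Sum>w\<in>t i. r i w *\<^sub>R real_pairing ((((*v) ?Qc) ^^ n) w) a))"
        unfolding t(3) by (simp only: linear_sum[OF lin] linear_scale[OF lin])
      also have "\<dots> = (\<Sum>i\<in>UNIV. \<Sum>w\<in>t i. c (i, w) * z w ^ n)"
        unfolding scaleR_sum_right
      proof (intro sum.cong refl)
        fix i w assume "w \<in> t i"
        then have "(((*v) ?Qc) ^^ n) w = z w ^ n *s w" using t(2) by (intro eig) blast
        then show "\<eta> $ i *\<^sub>R r i w *\<^sub>R real_pairing ((((*v) ?Qc) ^^ n) w) a = c (i, w) * z w ^ n"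
          by (simp add: c_def real_pairing_def scaleR_conv_of_real sum_distrib_left mult_ac)
      qed
      also have "\<dots> = (\<Sum>j\<in>J. c j * (case j of (i, w) \<Rightarrow> z w) ^ n)"
        unfolding J_def using t(1) by (subst sum.Sigma) (auto intro!: sum.cong)
      finally show ?thesis .
    qed
    also have "(\<Sum>j\<in>J. c j * (case j of (i, w) \<Rightarrow> z w) ^ n)
        = (\<Sum>u\<in>F. (\<Sum>j\<in>{j \<in> J. (case j of (i, w) \<Rightarrow> z w) = u}. c j) * u ^ n)" for n
      unfolding F_def sum.image_gen[OF J, where h = "\<lambda>j. c j * (case j of (i, w) \<Rightarrow> z w) ^ n" and g = "\<lambda>(i, w). z w"]
      by (simp add: sum_distrib_right)
    finally show ?thesis by (intro exI allI)
  qed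
  have "cmod u = 1" if uF: "u \<in> F" for u
  proof -
    obtain i w where "w \<in> t i" "u = z w" using uF by (auto simp: F_def J_def)
    then show ?thesis using z[OF subsetD[OF t(2)]] by blast
  qed
  moreover have "finite F" using J by (simp add: F_def)
  ultimately show thesis using expansion by (intro that[of F]) simp_all
qed


section \<open>Almost every contraction ratio\<close>

text \<open>Points of the unit circle do not come closer when pushed outwards along their rays,
  since the nearest-point projection to the closed disc is nonexpansive. This makes the separation
  of distinct frequencies uniform in both ratios.\<close>

lemma norm_diff_unimodular_le:
  fixes u v :: complex and s s' :: real
  assumes "cmod u = 1" "cmod v = 1" "1 \<le> s" "1 \<le> s'"
  shows "cmod (u - v) \<le> cmod (of_real s * u - of_real s' * v)"
proof -
  define c where "c = Re u * Re v + Im u * Im v"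
  define k where "k = s * s' * (1 - c)"
  have u: "(Re u)\<^sup>2 + (Im u)\<^sup>2 = 1" and v: "(Re v)\<^sup>2 + (Im v)\<^sup>2 = 1"
    using assms by (simp_all flip: cmod_power2)
  have "(cmod (u - v))\<^sup>2 = ((Re u)\<^sup>2 + (Im u)\<^sup>2) + ((Re v)\<^sup>2 + (Im v)\<^sup>2) - 2 * c"
    unfolding cmod_power2 c_def by (simp add: power2_eq_square algebra_simps)
  then have uv: "(cmod (u - v))\<^sup>2 = 2 - 2 * c" using u v by simp
  have "(cmod (of_real s * u - of_real s' * v))\<^sup>2
      = s\<^sup>2 * ((Re u)\<^sup>2 + (Im u)\<^sup>2) + s'\<^sup>2 * ((Re v)\<^sup>2 + (Im v)\<^sup>2) - 2 * (s * s') * c"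
    unfolding cmod_power2 c_def by (simp add: power2_eq_square algebra_simps)
  also have "\<dots> = (s - s')\<^sup>2 + 2 * k"
    unfolding u v k_def by (simp add: power2_eq_square algebra_simps)
  finally have suv: "(cmod (of_real s * u - of_real s' * v))\<^sup>2 = (s - s')\<^sup>2 + 2 * k" .
  have "c \<le> 1" using zero_le_power2[of "cmod (u - v)"] uv by linarith
  moreover have "1 * 1 \<le> s * s'" using assms by (intro mult_mono) auto
  ultimately have "1 * (1 - c) \<le> k" unfolding k_def by (intro mult_right_mono) auto
  then have "2 - 2 * c \<le> 0 + 2 * k" by simp
  also have "\<dots> \<le> (s - s')\<^sup>2 + 2 * k" by (rule add_right_mono) simp
  finally have "(cmod (u - v))\<^sup>2 \<le> (cmod (of_real s * u - of_real s' * v))\<^sup>2" unfolding uv suv .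
  then show ?thesis by (rule power2_le_imp_le) simp
qed

text \<open>The vectors \<eta> and a range over whole balls, which frees the class from any digit
  set. Nondegeneracy is expressed by a value of the orbit, not by a coefficient of its expansion:
  the expansion need not depend continuously on Q, whereas this condition is closed in all
  variables.\<close>

definition orbit_class :: "nat \<Rightarrow> real ^ 'n ^ 'n \<Rightarrow> (real \<times> (nat \<Rightarrow> real)) set" where
  "orbit_class q Q = {(r, y). 1 / (real q + 1) \<le> r \<and> r \<le> 1 - 1 / (real q + 1) \<and>
     (\<exists>\<eta> a. norm \<eta> \<le> real q \<and> norm a \<le> real q \<and> (\<exists>n<q. 1 / (real q + 1) \<le> \<bar>(((*v) Q) ^^ n) \<eta> \<bullet> a\<bar>) \<and>
       y = (\<lambda>n. (1 / r) ^ n * ((((*v) Q) ^^ n) \<eta> \<bullet> a)))}"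

lemma norm_orthogonal_funpow:
  fixes Q :: "real ^ 'n ^ 'n"
  assumes "orthogonal_matrix Q"
  shows "norm ((((*v) Q) ^^ n) x) = norm x"
proof (induction n)
  case (Suc n)
  have "orthogonal_transformation ((*v) Q)"
    using assms by (simp add: orthogonal_transformation_matrix)
  then show ?case using Suc by (simp add: orthogonal_transformation_norm)
qed simp

text \<open>Every frequency \<open>u / r\<close> moves with r, so each may separate parameters (U =
  I), and \<open>\<bar>1 / r - 1 / r'\<bar>\<close> dominates the distance of ratios below 1. Some
  coefficient has size at least \<kappa>: \<open>card F\<close> terms below \<kappa> cannot add up
  to an orbit value of size c.\<close>

lemma hausdorff_null_orbit_class:
  fixes Q :: "real ^ 'n ^ 'n"
  assumes Q: "orthogonal_matrix Q" and \<tau>: "0 < \<tau>"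
  shows "hausdorff_null \<tau> (\<Inter>k. {r. \<exists>\<^sub>\<infinity>N. \<exists>y. (r, y) \<in> orbit_class q Q \<and> rarely_bad k N y})"
proof -
  obtain F :: "complex set" where F: "finite F" "\<And>u. u \<in> F \<Longrightarrow> cmod u = 1"
    "\<And>\<eta> a. \<exists>b. \<forall>n. complex_of_real ((((*v) Q) ^^ n) \<eta> \<bullet> a) = (\<Sum>u\<in>F. b u * u ^ n)"
    by (rule orthogonal_orbit_expansion[OF Q]) (rule that)
  define c where "c = 1 / (real q + 1)"
  have c: "0 < c" by (simp add: c_def)
  define P where "P = {r. c \<le> r \<and> r \<le> 1 - c}"
  \<comment> \<open>The element 1 keeps \<open>Min\<close> applied to a nonempty set.\<close>
  define s where "s = Min (insert 1 ((\<lambda>u. cmod (\<Prod>v\<in>F - {u}. u - v)) ` F))"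
  have s: "0 < s" "\<And>u. u \<in> F \<Longrightarrow> s \<le> cmod (\<Prod>v\<in>F - {u}. u - v)"
    using F(1) by (auto simp: s_def)
  define \<kappa> where "\<kappa> = min s (c / (real (card F) + 1))"
  have \<kappa>: "0 < \<kappa>" "\<kappa> \<le> s" "\<kappa> \<le> c / (real (card F) + 1)" using s(1) c by (auto simp: \<kappa>_def)
  define M where "M = (1 / c) ^ (2 * card F) * (real q * real q)"
  have P: "0 < r" "1 + c \<le> 1 / r" "1 / r \<le> 1 / c" if "r \<in> P" for r
  proof -
    show r: "0 < r" using that c by (auto simp: P_def)
    have "(1 + c) * r \<le> (1 + c) * (1 - c)" using that c by (intro mult_left_mono) (auto simp: P_def)
    also have "\<dots> \<le> 1" by (simp add: algebra_simps)
    finally show "1 + c \<le> 1 / r" using r by (simp add: pos_le_divide_eq)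
    show "1 / r \<le> 1 / c" using that c by (intro divide_left_mono) (auto simp: P_def)
  qed
  have others: "\<kappa> \<le> cmod (\<Prod>v\<in>F - {u}. of_real (1 / r) * u - of_real (1 / r') * v)"
    if "r \<in> P" "r' \<in> P" "u \<in> F" for r r' u
  proof -
    have "\<kappa> \<le> cmod (\<Prod>v\<in>F - {u}. u - v)" using s(2)[OF that(3)] \<kappa>(2) by linarith
    also have "\<dots> \<le> cmod (\<Prod>v\<in>F - {u}. of_real (1 / r) * u - of_real (1 / r') * v)"
      unfolding prod_norm[symmetric]
    proof (rule prod_mono, intro conjI)
      fix v assume "v \<in> F - {u}"
      then show "cmod (u - v) \<le> cmod (of_real (1 / r) * u - of_real (1 / r') * v)"
        using F(2) that P(2)[OF that(1)] P(2)[OF that(2)] c by (intro norm_diff_unimodular_le) auto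
    qed simp
    finally show ?thesis .
  qed
  show ?thesis
  proof (rule erdos_kahane[where I = F and U = F and P = P and lam = "\<lambda>r u. of_real (1 / r) * u"
        and R = "1 / c" and L = "1 + c" and \<kappa> = \<kappa> and M = M])
    show "cmod (of_real (1 / r) * u) \<le> 1 / c" if "r \<in> P" "u \<in> F" for r u
      using P[OF that(1)] F(2)[OF that(2)] by (simp add: norm_mult norm_divide)
    show "1 + c \<le> cmod (of_real (1 / r) * u)" if "r \<in> P" "u \<in> F" for r u
      using P[OF that(1)] F(2)[OF that(2)] by (simp add: norm_mult norm_divide)
    show "\<kappa> * dist r r' \<le> cmod (\<Prod>v\<in>F. of_real (1 / r) * u - of_real (1 / r') * v)"
      if r: "r \<in> P" "r' \<in> P" and u: "u \<in> F" for r r' u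
    proof -
      have "dist r r' \<le> \<bar>1 / r - 1 / r'\<bar>"
      proof -
        have "1 \<le> 1 / r" "1 \<le> 1 / r'" using P(2)[OF r(1)] P(2)[OF r(2)] c by linarith+
        then have "1 * 1 \<le> (1 / r) * (1 / r')" using P(1)[OF r(1)] by (intro mult_mono) auto
        then have "1 * dist r r' \<le> (1 / r) * (1 / r') * dist r r'" by (intro mult_right_mono) auto
        also have "\<dots> = \<bar>(1 / r) * (1 / r') * (r' - r)\<bar>"
          using P(1)[OF r(1)] P(1)[OF r(2)] by (simp add: abs_mult dist_real_def abs_minus_commute)
        also have "(1 / r) * (1 / r') * (r' - r) = 1 / r - 1 / r'"
          using P(1)[OF r(1)] P(1)[OF r(2)] by (simp add: field_simps)
        finally show ?thesis by simp
      qed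
      also have "\<dots> = cmod (of_real (1 / r) * u - of_real (1 / r') * u)"
        using F(2)[OF u] by (simp add: norm_mult flip: left_diff_distrib of_real_diff of_real_divide del: of_real_divide)
      finally have "dist r r' * \<kappa> \<le> cmod (of_real (1 / r) * u - of_real (1 / r') * u)
          * cmod (\<Prod>v\<in>F - {u}. of_real (1 / r) * u - of_real (1 / r') * v)"
        using others[OF r u] \<kappa>(1) by (intro mult_mono) auto
      then show ?thesis by (simp only: prod.remove[OF F(1) u] norm_mult mult.commute[of \<kappa>])
    qed
    show "\<kappa> \<le> cmod (\<Prod>v\<in>F - {u}. of_real (1 / r) * u - of_real (1 / r) * v)" if "r \<in> P" "u \<in> F" for r u
      using others that by blast
    fix r y assume "(r, y) \<in> orbit_class q Q"
    then obtain \<eta> a n0 where r: "r \<in> P" and \<eta>: "norm \<eta> \<le> real q" "norm a \<le> real q"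
      and n0: "c \<le> \<bar>(((*v) Q) ^^ n0) \<eta> \<bullet> a\<bar>" and y: "y = (\<lambda>n. (1 / r) ^ n * ((((*v) Q) ^^ n) \<eta> \<bullet> a))"
      by (auto simp: orbit_class_def P_def c_def)
    show "r \<in> P" by (rule r)
    obtain b where b: "\<And>n. complex_of_real ((((*v) Q) ^^ n) \<eta> \<bullet> a) = (\<Sum>u\<in>F. b u * u ^ n)" using F(3) by blast
    have "\<exists>u\<in>F. \<kappa> \<le> cmod (b u)"
    proof (rule ccontr)
      assume "\<not> ?thesis"
      then have less: "cmod (b u) \<le> \<kappa>" if "u \<in> F" for u using that by force
      have "c \<le> cmod (\<Sum>u\<in>F. b u * u ^ n0)" using n0 unfolding b[symmetric] by simp
      also have "\<dots> \<le> (\<Sum>u\<in>F. \<kappa>)"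
        using F(2) less by (intro sum_norm_le) (simp add: norm_mult norm_power)
      also have "\<dots> = real (card F) * \<kappa>" by simp
      also have "\<dots> < (real (card F) + 1) * \<kappa>" using \<kappa>(1) by simp
      also have "\<dots> \<le> c" using \<kappa>(3) by (simp add: field_simps)
      finally show False by simp
    qed
    moreover have "of_real (y n) = (\<Sum>u\<in>F. b u * (of_real (1 / r) * u) ^ n)" for n
    proof -
      have "of_real (y n) = of_real ((1 / r) ^ n) * (\<Sum>u\<in>F. b u * u ^ n)"
        unfolding y of_real_mult b ..
      also have "\<dots> = (\<Sum>u\<in>F. b u * (of_real (1 / r) * u) ^ n)"
        unfolding sum_distrib_left by (simp add: power_mult_distrib power_divide mult_ac)
      finally show ?thesis .
    qed
    ultimately show "\<exists>b. (\<forall>n. of_real (y n) = (\<Sum>u\<in>F. b u * (of_real (1 / r) * u) ^ n)) \<and> (\<exists>u\<in>F. \<kappa> \<le> cmod (b u))"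
      by blast
    show "\<bar>y n\<bar> \<le> M" if n: "n < 2 * card F" for n
    proof -
      have "\<bar>y n\<bar> \<le> (1 / r) ^ n * (norm ((((*v) Q) ^^ n) \<eta>) * norm a)"
        unfolding y abs_mult using P(1)[OF r] by (intro mult_mono Cauchy_Schwarz_ineq2) auto
      also have "\<dots> \<le> (1 / c) ^ (2 * card F) * (real q * real q)"
      proof (intro mult_mono)
        have "(1 / r) ^ n \<le> (1 / r) ^ (2 * card F)" using P(2)[OF r] c n by (intro power_increasing) auto
        also have "\<dots> \<le> (1 / c) ^ (2 * card F)" using P[OF r] by (intro power_mono) auto
        finally show "(1 / r) ^ n \<le> (1 / c) ^ (2 * card F)" .
      qed (use \<eta> c norm_orthogonal_funpow[OF Q] in auto)
      finally show ?thesis by (simp add: M_def)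
    qed
  qed (use F c \<kappa> \<tau> in auto)
qed

section \<open>Closedness of the exceptional conditions in the pair (r, Q)\<close>

lemma continuous_on_matrix_vector_mult:
  fixes Q :: "'x::topological_space \<Rightarrow> real ^ 'n ^ 'm"
  assumes "continuous_on X Q" "continuous_on X x"
  shows "continuous_on X (\<lambda>w. Q w *v x w)"
  unfolding matrix_vector_mult_def using assms by (intro continuous_intros)

lemma continuous_on_funpow_matrix:
  fixes Q :: "'x::topological_space \<Rightarrow> real ^ 'n ^ 'n"
  assumes "continuous_on X Q" "continuous_on X x"
  shows "continuous_on X (\<lambda>w. (((*v) (Q w)) ^^ n) (x w))"
proof (induction n)
  case (Suc n)
  have "continuous_on X (\<lambda>w. Q w *v (((*v) (Q w)) ^^ n) (x w))"
    by (rule continuous_on_matrix_vector_mult[OF assms(1) Suc])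
  then show ?case by simp
qed (use assms in simp)

text \<open>The bad set must lie in one of finitely many small sets S; for fixed S, the cosines
  outside S reaching the threshold is a finite intersection of closed conditions.\<close>

lemma closed_rarely_bad:
  fixes y :: "'x::real_normed_vector \<Rightarrow> nat \<Rightarrow> real"
  assumes "\<And>n. continuous_on UNIV (\<lambda>x. y x n)"
  shows "closed {x. rarely_bad k N (y x)}"
proof -
  let ?\<kappa> = "1 - 1 / (real k + 1)"
  let ?\<S> = "{S. S \<subseteq> {..<N} \<and> real (card S) \<le> real N / (real k + 1)}"
  have "{x. rarely_bad k N (y x)} = (\<Union>S\<in>?\<S>. \<Inter>n\<in>{..<N} - S. {x. ?\<kappa> \<le> cos (2 * pi * y x n)})"
  proof (intro equalityI subsetI)
    fix x assume x: "x \<in> {x. rarely_bad k N (y x)}"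
    have "bad_indices ?\<kappa> N (y x) \<in> ?\<S>" using x by (auto simp: rarely_bad_def bad_indices_def)
    moreover have "x \<in> (\<Inter>n\<in>{..<N} - bad_indices ?\<kappa> N (y x). {x. ?\<kappa> \<le> cos (2 * pi * y x n)})"
      by (auto simp: bad_indices_def not_less)
    ultimately show "x \<in> (\<Union>S\<in>?\<S>. \<Inter>n\<in>{..<N} - S. {x. ?\<kappa> \<le> cos (2 * pi * y x n)})" by blast
  next
    fix x assume "x \<in> (\<Union>S\<in>?\<S>. \<Inter>n\<in>{..<N} - S. {x. ?\<kappa> \<le> cos (2 * pi * y x n)})"
    then obtain S where S: "S \<subseteq> {..<N}" "real (card S) \<le> real N / (real k + 1)"
      "\<forall>n\<in>{..<N} - S. ?\<kappa> \<le> cos (2 * pi * y x n)" by blast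
    have "bad_indices ?\<kappa> N (y x) \<subseteq> S" using S(3) by (force simp: bad_indices_def)
    then have "card (bad_indices ?\<kappa> N (y x)) \<le> card S"
      using S(1) by (intro card_mono) (auto intro: finite_subset)
    then show "x \<in> {x. rarely_bad k N (y x)}" using S(2) by (simp add: rarely_bad_def)
  qed
  moreover have "finite ?\<S>" by (rule finite_subset[of _ "Pow {..<N}"]) auto
  moreover have "continuous_on UNIV (\<lambda>x. cos (2 * pi * y x n))" for n
    by (intro continuous_on_cos continuous_on_mult continuous_on_const assms)
  ultimately show ?thesis
    by (auto intro!: closed_UN closed_INT closed_Collect_le continuous_on_const)
qed

text \<open>The existential quantifiers over \<eta> and a project a closed set along a compact
  product of balls, and such projections are closed. This supplies the measurability behind
  Fubini.\<close>

lemma closed_orbit_class: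
  "closed {(r, Q :: real ^ 'n ^ 'n). \<exists>y. (r, y) \<in> orbit_class q Q \<and> rarely_bad k N y}"
proof -
  define c where "c = 1 / (real q + 1)"
  have c: "0 < c" by (simp add: c_def)
  define K :: "((real ^ 'n) \<times> (real ^ 'n)) set" where "K = cball 0 (real q) \<times> cball 0 (real q)"
  \<comment> \<open>The maximum with c makes y continuous on the whole space; on T it gives the true
    sequence, because r is at least c there.\<close>
  define y :: "((real ^ 'n) \<times> (real ^ 'n)) \<times> (real \<times> (real ^ 'n ^ 'n)) \<Rightarrow> nat \<Rightarrow> real"
    where "y x n = (1 / max c (fst (snd x))) ^ n * ((((*v) (snd (snd x))) ^^ n) (fst (fst x)) \<bullet> snd (fst x))" for x n
  define T :: "(((real ^ 'n) \<times> (real ^ 'n)) \<times> (real \<times> (real ^ 'n ^ 'n))) set"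
    where "T = {x. c \<le> fst (snd x)} \<inter> {x. fst (snd x) \<le> 1 - c} \<inter> {x. rarely_bad k N (y x)} \<inter>
      (\<Union>n\<in>{..<q}. {x. c \<le> \<bar>(((*v) (snd (snd x))) ^^ n) (fst (fst x)) \<bullet> snd (fst x)\<bar>})"
  have cont: "continuous_on UNIV (\<lambda>x :: ((real ^ 'n) \<times> (real ^ 'n)) \<times> (real \<times> (real ^ 'n ^ 'n)).
      (((*v) (snd (snd x))) ^^ n) (fst (fst x)) \<bullet> snd (fst x))" for n
    by (rule continuous_on_inner,
        rule continuous_on_funpow_matrix[where Q = "\<lambda>x. snd (snd x)" and x = "\<lambda>x. fst (fst x)"])
      (intro continuous_intros)+
  have "max c r \<noteq> 0" for r using c by (simp add: max_def)
  then have "continuous_on UNIV (\<lambda>x. y x n)" for n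
    unfolding y_def by (intro continuous_on_mult[OF _ cont] continuous_intros ballI)
  then have "closed {x. rarely_bad k N (y x)}" by (rule closed_rarely_bad)
  moreover have "closed {x :: ((real ^ 'n) \<times> (real ^ 'n)) \<times> (real \<times> (real ^ 'n ^ 'n)). c \<le> \<bar>(((*v) (snd (snd x))) ^^ n) (fst (fst x)) \<bullet> snd (fst x)\<bar>}" for n
    by (rule closed_Collect_le[OF continuous_on_const continuous_on_rabs[OF cont]])
  ultimately have "closed T"
    unfolding T_def by (intro closed_Int closed_UN closed_Collect_le continuous_intros) auto
  moreover have "compact K" by (simp add: K_def compact_Times)
  ultimately have "closed {z. \<exists>x. x \<in> K \<and> (x, z) \<in> T}" by (intro closed_compact_projection)
  moreover have "{(r, Q :: real ^ 'n ^ 'n). \<exists>y. (r, y) \<in> orbit_class q Q \<and> rarely_bad k N y}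
      = {z. \<exists>x. x \<in> K \<and> (x, z) \<in> T}"
  proof -
    have "(\<exists>y. (r, y) \<in> orbit_class q Q \<and> rarely_bad k N y) \<longleftrightarrow> (\<exists>x. x \<in> K \<and> (x, (r, Q)) \<in> T)"
      for r and Q :: "real ^ 'n ^ 'n"
    proof
      assume "\<exists>y. (r, y) \<in> orbit_class q Q \<and> rarely_bad k N y"
      then obtain \<eta> a n where h: "c \<le> r" "r \<le> 1 - c" "norm \<eta> \<le> real q" "norm a \<le> real q" "n < q"
        "c \<le> \<bar>(((*v) Q) ^^ n) \<eta> \<bullet> a\<bar>" "rarely_bad k N (\<lambda>n. (1 / r) ^ n * ((((*v) Q) ^^ n) \<eta> \<bullet> a))"
        by (auto simp: orbit_class_def c_def)
      have "y ((\<eta>, a), (r, Q)) = (\<lambda>n. (1 / r) ^ n * ((((*v) Q) ^^ n) \<eta> \<bullet> a))"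
        using h(1) by (simp add: y_def fun_eq_iff)
      then show "\<exists>x. x \<in> K \<and> (x, (r, Q)) \<in> T"
        using h by (intro exI[of _ "(\<eta>, a)"]) (auto simp: K_def T_def)
    next
      assume "\<exists>x. x \<in> K \<and> (x, (r, Q)) \<in> T"
      then obtain \<eta> a n where h: "c \<le> r" "r \<le> 1 - c" "norm \<eta> \<le> real q" "norm a \<le> real q" "n < q"
        "c \<le> \<bar>(((*v) Q) ^^ n) \<eta> \<bullet> a\<bar>" "rarely_bad k N (y ((\<eta>, a), (r, Q)))"
        by (auto simp: K_def T_def)
      have "y ((\<eta>, a), (r, Q)) = (\<lambda>n. (1 / r) ^ n * ((((*v) Q) ^^ n) \<eta> \<bullet> a))"
        using h(1) by (simp add: y_def fun_eq_iff)
      then have "(r, y ((\<eta>, a), (r, Q))) \<in> orbit_class q Q"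
        using h unfolding orbit_class_def c_def by blast
      then show "\<exists>y. (r, y) \<in> orbit_class q Q \<and> rarely_bad k N y" using h(7) by blast
    qed
    then show ?thesis by (auto simp: set_eq_iff)
  qed
  ultimately show ?thesis by simp
qed

text \<open>The vectors orthogonal to a forward orbit form a subspace invariant under \<open>Q\<^sup>T\<close>, hence, by
  finite dimension, under \<open>Q\<close>.\<close>

lemma cyclic_orbit_not_orthogonal:
  fixes Q :: "real ^ 'n ^ 'n"
  assumes Q: "orthogonal_matrix Q" and cyc: "cyclic_for (similitude r Q) (a ` {..m})"
    and 0: "\<And>n j. j \<le> m \<Longrightarrow> (((*v) Q) ^^ n) \<zeta> \<bullet> a j = 0"
  shows "\<zeta> = 0"
proof -
  define S where "S = {x. \<forall>n. (((*v) Q) ^^ n) \<zeta> \<bullet> x = 0}"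
  let ?T = "(*v) (transpose Q)"
  have S: "subspace S" by (auto simp: S_def subspace_def inner_add_right)
  have Tinv: "?T ` S \<subseteq> S"
  proof clarify
    fix x assume x: "x \<in> S"
    have "(((*v) Q) ^^ n) \<zeta> \<bullet> (transpose Q *v x) = (((*v) Q) ^^ Suc n) \<zeta> \<bullet> x" for n
      by (simp add: dot_lmul_matrix[symmetric] vector_transpose_matrix inner_commute)
    moreover have "(((*v) Q) ^^ Suc n) \<zeta> \<bullet> x = 0" for n using x unfolding S_def by blast
    ultimately show "transpose Q *v x \<in> S" unfolding S_def by simp
  qed
  have QT: "transpose Q *v (Q *v x) = x" "Q *v (transpose Q *v x) = x" for x
    using Q[unfolded orthogonal_matrix_def] by (simp_all only: matrix_vector_mul_assoc matrix_vector_mul_lid)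
  have "inj ?T" by (rule injI) (metis QT(2))
  then have "inj_on ?T (span S)" by (rule inj_on_subset) simp
  then have dim: "dim (?T ` S) = dim S" by (rule dim_image_eq[OF matrix_vector_mul_linear])
  have "?T ` S = S"
    by (rule subspace_dim_equal[OF linear_subspace_image[OF matrix_vector_mul_linear S] S Tinv]) (simp only: dim order_refl)
  then have "Q *v x \<in> S" if "x \<in> S" for x using that QT(2) by (metis imageE)
  then have "similitude r Q ` S \<subseteq> S" using subspace_scale[OF S] by (auto simp: similitude_def)
  moreover have "a ` {..m} \<subseteq> S" using 0 by (auto simp: S_def)
  ultimately have "S = UNIV" using S by (intro cyc[unfolded cyclic_for_def, rule_format, of S] conjI)
  then have "\<zeta> \<in> S" by simp
  then have "\<forall>n. (((*v) Q) ^^ n) \<zeta> \<bullet> \<zeta> = 0" unfolding S_def by (rule CollectD)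
  from spec[OF this, of 0] show ?thesis by simp
qed

text \<open>Otherwise counterexamples for all q would, by compactness of the annulus, accumulate at
  a vector whose forward orbit is orthogonal to every digit; by
  \<open>cyclic_orbit_not_orthogonal\<close> it would be 0, which is outside the annulus.\<close>

lemma cyclic_orbit_lower_bound:
  fixes Q :: "real ^ 'n ^ 'n"
  assumes Q: "orthogonal_matrix Q" and cyc: "cyclic_for (similitude r Q) (a ` {..m})"
  shows "\<exists>q. \<forall>\<zeta>. 1 \<le> norm \<zeta> \<and> norm \<zeta> \<le> \<theta> \<longrightarrow> (\<exists>j\<le>m. \<exists>n<q. 1 / (real q + 1) \<le> \<bar>(((*v) Q) ^^ n) \<zeta> \<bullet> a j\<bar>)"
proof (rule ccontr)
  assume "\<not> ?thesis"
  then have "\<forall>q. \<exists>\<zeta>. 1 \<le> norm \<zeta> \<and> norm \<zeta> \<le> \<theta> \<and> (\<forall>j\<le>m. \<forall>n<q. \<bar>(((*v) Q) ^^ n) \<zeta> \<bullet> a j\<bar> < 1 / (real q + 1))"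
    by (force simp: not_le)
  from choice[OF this] obtain \<zeta> where \<zeta>: "\<forall>q. 1 \<le> norm (\<zeta> q) \<and> norm (\<zeta> q) \<le> \<theta> \<and>
      (\<forall>j\<le>m. \<forall>n<q. \<bar>(((*v) Q) ^^ n) (\<zeta> q) \<bullet> a j\<bar> < 1 / (real q + 1))" ..
  have "compact (cball 0 \<theta> - ball 0 1 :: (real ^ 'n) set)" by (intro compact_diff) auto
  then have "seq_compact (cball 0 \<theta> - ball 0 1 :: (real ^ 'n) set)" by (simp add: compact_eq_seq_compact_metric)
  moreover have "\<zeta> q \<in> cball 0 \<theta> - ball 0 1" for q using \<zeta> by (auto simp: not_less)
  ultimately obtain z \<rho> where z: "z \<in> cball 0 \<theta> - ball 0 1" and \<rho>: "strict_mono \<rho>" "(\<zeta> \<circ> \<rho>) \<longlonglongrightarrow> z"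
    unfolding seq_compact_def by metis
  have "(((*v) Q) ^^ n) z \<bullet> a j = 0" if j: "j \<le> m" for n j
  proof -
    have "continuous_on UNIV (\<lambda>x. (((*v) Q) ^^ n) x \<bullet> a j)"
      by (rule continuous_on_inner, rule continuous_on_funpow_matrix[where Q = "\<lambda>x. Q" and x = "\<lambda>x. x"])
        (intro continuous_intros)+
    then have "isCont (\<lambda>x. (((*v) Q) ^^ n) x \<bullet> a j) z" by (simp add: continuous_on_eq_continuous_at)
    then have lim: "(\<lambda>i. (((*v) Q) ^^ n) (\<zeta> (\<rho> i)) \<bullet> a j) \<longlonglongrightarrow> (((*v) Q) ^^ n) z \<bullet> a j"
      using \<rho>(2) by (intro isCont_tendsto_compose[where g = "\<lambda>x. (((*v) Q) ^^ n) x \<bullet> a j"]) (auto simp: o_def)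
    have "\<bar>(((*v) Q) ^^ n) (\<zeta> (\<rho> i)) \<bullet> a j\<bar> \<le> 1 / (real i + 1)" if i: "n < i" for i
    proof -
      have "i \<le> \<rho> i" using \<rho>(1) by (rule seq_suble)
      then have "\<bar>(((*v) Q) ^^ n) (\<zeta> (\<rho> i)) \<bullet> a j\<bar> < 1 / (real (\<rho> i) + 1)" using \<zeta> i j by auto
      also have "\<dots> \<le> 1 / (real i + 1)" using \<open>i \<le> \<rho> i\<close> by (intro divide_left_mono) auto
      finally show ?thesis by simp
    qed
    then have "\<forall>\<^sub>F i in sequentially. norm ((((*v) Q) ^^ n) (\<zeta> (\<rho> i)) \<bullet> a j) \<le> 1 / (real i + 1)"
      by (intro eventually_mono[OF eventually_gt_at_top[of n]]) simp
    moreover have "(\<lambda>i. 1 / (real i + 1)) \<longlonglongrightarrow> 0"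
      using LIMSEQ_inverse_real_of_nat by (simp add: inverse_eq_divide add.commute)
    ultimately have "(\<lambda>i. (((*v) Q) ^^ n) (\<zeta> (\<rho> i)) \<bullet> a j) \<longlonglongrightarrow> 0" by (rule Lim_null_comparison)
    then show ?thesis using lim LIMSEQ_unique by blast
  qed
  then have "z = 0" by (rule cyclic_orbit_not_orthogonal[OF Q cyc])
  then show False using z by simp
qed

lemma power_decay_if_not_exceptional:
  fixes Q :: "real ^ 'n ^ 'n"
  assumes r: "0 < r" "r < 1" and Q: "orthogonal_matrix Q"
    and good: "\<And>q. \<exists>k. \<not> (\<exists>\<^sub>\<infinity>N. \<exists>y. (r, y) \<in> orbit_class q Q \<and> rarely_bad k N y)"
    and a: "a 0 = 0" and cyc: "cyclic_for (similitude r Q) (a ` {..m})" and p: "positive_prob_vector m p"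
    and ss: "is_self_similar_measure (similitude r Q) m a p \<mu>"
  shows "\<mu> \<in> power_decay_measures"
proof -
  define \<theta> where "\<theta> = 1 / r"
  have \<theta>: "1 < \<theta>" using r by (simp add: \<theta>_def)
  obtain q0 where q0: "\<And>\<zeta>. 1 \<le> norm \<zeta> \<Longrightarrow> norm \<zeta> \<le> \<theta> \<Longrightarrow>
      \<exists>j\<le>m. \<exists>n<q0. 1 / (real q0 + 1) \<le> \<bar>(((*v) Q) ^^ n) \<zeta> \<bullet> a j\<bar>"
    using cyclic_orbit_lower_bound[OF Q cyc, of \<theta>] by blast
  \<comment> \<open>The entry \<theta> bounds r from below and \<open>norm \<zeta>\<close> from
    above, and \<open>1 / (1 - r)\<close> keeps r away from 1.\<close>
  define B where "B = Max (insert (real q0) (insert \<theta> (insert (1 / (1 - r)) ((\<lambda>j. norm (a j)) ` {..m}))))"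
  obtain q :: nat where "B \<le> real q" using real_arch_simple by blast
  then have q: "real q0 \<le> real q" "\<theta> \<le> real q" "1 / (1 - r) \<le> real q" "\<And>j. j \<le> m \<Longrightarrow> norm (a j) \<le> real q"
    by (auto simp: B_def)
  have qr: "1 / (real q + 1) \<le> r" "r \<le> 1 - 1 / (real q + 1)"
  proof -
    have "1 \<le> real q * r" "1 \<le> real q * (1 - r)" using q(2,3) r by (auto simp: \<theta>_def divide_le_eq)
    then have "1 \<le> (real q + 1) * r" "1 \<le> (real q + 1) * (1 - r)" using r by (auto simp: algebra_simps)
    then show "1 / (real q + 1) \<le> r" "r \<le> 1 - 1 / (real q + 1)" by (auto simp: field_simps)
  qed
  obtain k where "\<not> (\<exists>\<^sub>\<infinity>N. \<exists>y. (r, y) \<in> orbit_class q Q \<and> rarely_bad k N y)" using good by blast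
  then obtain N0 where N0: "\<And>N y. N0 \<le> N \<Longrightarrow> (r, y) \<in> orbit_class q Q \<Longrightarrow> \<not> rarely_bad k N y"
    by (auto simp: INFM_nat_le)
  have orth: "orthogonal_transformation ((*v) Q)" using Q by (simp add: orthogonal_transformation_matrix)
  have pow: "((\<lambda>x. \<theta> *\<^sub>R (Q *v x)) ^^ n) \<zeta> = (1 / r) ^ n *\<^sub>R (((*v) Q) ^^ n) \<zeta>" for n \<zeta>
    by (induction n) (simp_all add: \<theta>_def matrix_vector_mult_scaleR)
  have "\<exists>C>0. \<exists>\<gamma>>0. \<forall>\<xi>\<in>UNIV. 1 \<le> norm \<xi> \<longrightarrow> cmod (fourier \<mu> \<xi>) \<le> C * norm \<xi> powr (- \<gamma>)"
  proof (rule fourier_decay_if_not_rarely_bad[where M = "(*v) Q" and a = a, OF orth \<theta> _ p a])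
    show "is_self_similar_measure (\<lambda>x. (1 / \<theta>) *\<^sub>R (Q *v x)) m a p \<mu>"
      using ss by (simp add: similitude_def \<theta>_def)
    show "\<exists>j\<le>m. \<not> rarely_bad k N (\<lambda>n. ((\<lambda>x. \<theta> *\<^sub>R (Q *v x)) ^^ n) \<zeta> \<bullet> a j)"
      if N: "N0 \<le> N" and \<zeta>: "1 \<le> norm \<zeta>" "norm \<zeta> \<le> \<theta>" for N \<zeta>
    proof -
      obtain j n where j: "j \<le> m" "n < q0" "1 / (real q0 + 1) \<le> \<bar>(((*v) Q) ^^ n) \<zeta> \<bullet> a j\<bar>"
        using q0[OF \<zeta>] by blast
      have "1 / (real q + 1) \<le> 1 / (real q0 + 1)" using q(1) by (intro divide_left_mono) auto
      then have n: "n < q \<and> 1 / (real q + 1) \<le> \<bar>(((*v) Q) ^^ n) \<zeta> \<bullet> a j\<bar>" using j q(1) by linarith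
      have "\<exists>\<eta> a'. norm \<eta> \<le> real q \<and> norm a' \<le> real q \<and>
          (\<exists>n<q. 1 / (real q + 1) \<le> \<bar>(((*v) Q) ^^ n) \<eta> \<bullet> a'\<bar>) \<and>
          (\<lambda>n. (1 / r) ^ n * ((((*v) Q) ^^ n) \<zeta> \<bullet> a j)) = (\<lambda>n. (1 / r) ^ n * ((((*v) Q) ^^ n) \<eta> \<bullet> a'))"
        by (rule exI[of _ \<zeta>], rule exI[of _ "a j"], use n q(2) q(4)[OF j(1)] \<zeta> in auto)
      then have "(r, \<lambda>n. (1 / r) ^ n * ((((*v) Q) ^^ n) \<zeta> \<bullet> a j)) \<in> orbit_class q Q"
        unfolding orbit_class_def using qr by simp
      then show ?thesis using N0[OF N] j(1) by (auto simp: pow)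
    qed
  qed auto
  then show ?thesis by (intro power_decay_measuresI[OF ss]) simp
qed

theorem AE_power_decay:
  fixes H :: "(real ^ 'n ^ 'n) measure"
  assumes H: "is_haar_orthogonal H"
  shows "AE (r, Q) in restrict_space lborel {0<..<1::real} \<Otimes>\<^sub>M H.
      \<forall>(m::nat) (a :: nat \<Rightarrow> real ^ 'n) (p :: nat \<Rightarrow> real) \<mu>.
        m \<ge> 1 \<and> a 0 = 0 \<and> cyclic_for (similitude r Q) (a ` {..m}) \<and> positive_prob_vector m p \<and>
        is_self_similar_measure (similitude r Q) m a p \<mu> \<longrightarrow> \<mu> \<in> power_decay_measures"
proof -
  define M1 where "M1 = restrict_space lborel {0<..<1::real}"
  define A where "A q k N = {(r, Q :: real ^ 'n ^ 'n). \<exists>y. (r, y) \<in> orbit_class q Q \<and> rarely_bad k N y}" for q k N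
  \<comment> \<open>The condition "infinitely many N" is spelled out by quantifiers over natural
    numbers, so X is a countable combination of measurable sets.\<close>
  define X where "X = {x \<in> space (M1 \<Otimes>\<^sub>M H). \<exists>q. \<forall>k. \<forall>m. \<exists>N\<ge>m. x \<in> A q k N}"
  interpret H: prob_space H using H by (simp add: is_haar_orthogonal_def)
  have setsH: "sets H = sets (restrict_space borel {Q. orthogonal_matrix Q})"
    using H by (simp add: is_haar_orthogonal_def)
  then have spaceH: "space H = {Q. orthogonal_matrix Q}"
    using sets_eq_imp_space_eq[OF setsH] by (simp add: space_restrict_space)
  interpret M1: sigma_finite_measure M1
    unfolding M1_def by (rule sigma_finite_measure_restrict_space) (auto intro: lborel.sigma_finite_measure_axioms)
  interpret P: pair_sigma_finite M1 H ..
  have spaceM1: "space M1 = {0<..<1}" by (simp add: M1_def space_restrict_space)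
  have id_borel: "(\<lambda>x. x) \<in> M1 \<Otimes>\<^sub>M H \<rightarrow>\<^sub>M borel"
  proof -
    have "(\<lambda>x. x) \<in> M1 \<rightarrow>\<^sub>M borel" unfolding M1_def by (rule measurable_restrict_space1) simp
    moreover have "(\<lambda>x. x) \<in> H \<rightarrow>\<^sub>M borel"
      using measurable_cong_sets[OF setsH refl] measurable_restrict_space1[of "\<lambda>x. x" borel borel] by auto
    ultimately have "(\<lambda>x. (fst x, snd x)) \<in> M1 \<Otimes>\<^sub>M H \<rightarrow>\<^sub>M borel"
      by (intro borel_measurable_Pair measurable_compose[OF measurable_fst] measurable_compose[OF measurable_snd])
    then show ?thesis by simp
  qed
  have [measurable]: "Measurable.pred (M1 \<Otimes>\<^sub>M H) (\<lambda>x. x \<in> A q k N)" for q k N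
  proof -
    have "A q k N \<in> sets borel" unfolding A_def by (intro borel_closed closed_orbit_class)
    from measurable_sets[OF id_borel this] show ?thesis
      unfolding pred_def by (simp add: Collect_conj_eq Int_commute vimage_def)
  qed
  have X: "X \<in> sets (M1 \<Otimes>\<^sub>M H)" unfolding X_def by measurable
  \<comment> \<open>For orthogonal Q the section lies in a set of vanishing content at exponent 1,
    hence is Lebesgue null; for other Q it is empty.\<close>
  have "emeasure M1 ((\<lambda>r. (r, Q)) -` X) = 0" for Q
  proof (cases "Q \<in> space H")
    case True
    then have Q: "orthogonal_matrix Q" by (simp add: spaceH)
    let ?E = "(\<lambda>r. (r, Q)) -` X"
    have E: "?E \<in> sets M1" using X by (rule sets_Pair2)
    then have E': "?E \<subseteq> {0<..<1}" "?E \<in> sets lborel"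
      using sets.sets_into_space[OF E] by (auto simp: spaceM1 M1_def sets_restrict_space_iff)
    have "hausdorff_null 1 (\<Union>q. \<Inter>k. {r. \<exists>\<^sub>\<infinity>N. \<exists>y. (r, y) \<in> orbit_class q Q \<and> rarely_bad k N y})"
      by (intro hausdorff_null_UN hausdorff_null_orbit_class Q) simp
    moreover have "?E \<subseteq> (\<Union>q. \<Inter>k. {r. \<exists>\<^sub>\<infinity>N. \<exists>y. (r, y) \<in> orbit_class q Q \<and> rarely_bad k N y})"
    proof
      fix r assume "r \<in> ?E"
      then have "\<exists>q. \<forall>k m. \<exists>N\<ge>m. (r, Q) \<in> A q k N" by (simp add: X_def)
      then obtain q where "\<forall>k m. \<exists>N\<ge>m. (r, Q) \<in> A q k N" ..
      then have "r \<in> (\<Inter>k. {r. \<exists>\<^sub>\<infinity>N. \<exists>y. (r, y) \<in> orbit_class q Q \<and> rarely_bad k N y})"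
        by (simp add: A_def INFM_nat_le)
      then show "r \<in> (\<Union>q. \<Inter>k. {r. \<exists>\<^sub>\<infinity>N. \<exists>y. (r, y) \<in> orbit_class q Q \<and> rarely_bad k N y})"
        by (rule UN_I[OF UNIV_I])
    qed
    ultimately have "hausdorff_null 1 ?E" by (rule hausdorff_null_subset)
    then have "emeasure lborel ?E = 0" using E'(2) by (rule emeasure_lborel_eq_0_if_null)
    then show ?thesis using E' by (simp add: M1_def emeasure_restrict_space)
  next
    case False
    then have "(\<lambda>r. (r, Q)) -` X = {}" by (auto simp: X_def space_pair_measure)
    then show ?thesis by simp
  qed
  then have "emeasure (M1 \<Otimes>\<^sub>M H) X = 0" by (simp add: P.emeasure_pair_measure_alt2[OF X])
  then have "AE x in M1 \<Otimes>\<^sub>M H. x \<notin> X" using X by (intro AE_not_in) auto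
  then have "AE (r, Q) in M1 \<Otimes>\<^sub>M H.
      \<forall>(m::nat) (a :: nat \<Rightarrow> real ^ 'n) (p :: nat \<Rightarrow> real) \<mu>.
        m \<ge> 1 \<and> a 0 = 0 \<and> cyclic_for (similitude r Q) (a ` {..m}) \<and> positive_prob_vector m p \<and>
        is_self_similar_measure (similitude r Q) m a p \<mu> \<longrightarrow> \<mu> \<in> power_decay_measures"
  proof (rule AE_mp, intro AE_I2 impI)
    fix x assume x: "x \<in> space (M1 \<Otimes>\<^sub>M H)" "x \<notin> X"
    obtain r Q where rQ: "x = (r, Q)" by (cases x)
    have r: "0 < r" "r < 1" and Q: "orthogonal_matrix Q"
      using x(1) by (auto simp: rQ space_pair_measure spaceM1 spaceH)
    have good: "\<exists>k. \<not> (\<exists>\<^sub>\<infinity>N. \<exists>y. (r, y) \<in> orbit_class q Q \<and> rarely_bad k N y)" for q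
    proof -
      have "\<not> (\<forall>k m. \<exists>N\<ge>m. x \<in> A q k N)" using x unfolding X_def by blast
      then show ?thesis by (simp add: rQ A_def INFM_nat_le)
    qed
    show "case x of (r, Q) \<Rightarrow> \<forall>(m::nat) (a :: nat \<Rightarrow> real ^ 'n) (p :: nat \<Rightarrow> real) \<mu>.
        m \<ge> 1 \<and> a 0 = 0 \<and> cyclic_for (similitude r Q) (a ` {..m}) \<and> positive_prob_vector m p \<and>
        is_self_similar_measure (similitude r Q) m a p \<mu> \<longrightarrow> \<mu> \<in> power_decay_measures"
      unfolding rQ prod.case
      by (intro allI impI, elim conjE) (rule power_decay_if_not_exceptional[OF r Q good])
  qed
  then show ?thesis unfolding M1_def .
qed


theorem theorem1p3:
  fixes H :: "(real ^ 'n ^ 'n) measure"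
  shows
    "(even CARD('n) \<and> is_haar_orthogonal H \<longrightarrow>
       (AE (r, Q) in restrict_space lborel {0<..<1::real} \<Otimes>\<^sub>M H.
          \<forall>(m::nat) (a :: nat \<Rightarrow> real ^ 'n) (p :: nat \<Rightarrow> real) \<mu>.
            m \<ge> 1 \<and> a 0 = 0 \<and> cyclic_for (similitude r Q) (a ` {..m}) \<and> positive_prob_vector m p \<and>
            is_self_similar_measure (similitude r Q) m a p \<mu>
            \<longrightarrow> \<mu> \<in> power_decay_measures))
     \<and>
     (\<forall>(Q :: real ^ 'n ^ 'n) (\<alpha> :: 's::finite \<Rightarrow> real).
        CARD('n) = 2 * CARD('s) \<and> orthogonal_matrix Q \<and> inj \<alpha> \<and> range \<alpha> \<subseteq> {0<..<1/2} \<and>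
        complex_eigenvalues Q = (\<Union>j. {cis (2 * pi * \<alpha> j), cis (- (2 * pi * \<alpha> j))})
        \<longrightarrow> (\<exists>L :: real ^ 'n \<Rightarrow> complex ^ 's.
              linear L \<and> bij L \<and> (\<forall>x. L (Q *v x) = rotation_diag \<alpha> *v L x) \<and>
              (\<forall>(\<theta>::real) (m::nat) a p \<mu>.
                 \<theta> > 1 \<and> m \<ge> 1 \<and> a 0 = 0 \<and> positive_prob_vector m p \<and>
                 is_self_similar_measure (similitude (1/\<theta>) Q) m a p \<mu>
                 \<longrightarrow> (cyclic_for (similitude (1/\<theta>) Q) (a ` {..m}) \<longleftrightarrow>
                        cyclic_for (similitude (1/\<theta>) (rotation_diag \<alpha>)) ((L \<circ> a) ` {..m})) \<and>
                     is_self_similar_measure (similitude (1/\<theta>) (rotation_diag \<alpha>)) m (L \<circ> a) p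
                       (distr \<mu> borel L) \<and>
                     (\<mu> \<in> power_decay_measures \<longleftrightarrow> distr \<mu> borel L \<in> power_decay_measures))))
     \<and>
     (\<forall>(\<theta>::real) (m::nat) (a :: nat \<Rightarrow> complex ^ 's) (\<alpha> :: 's \<Rightarrow> real).
        \<theta> > 1 \<and> m \<ge> 1 \<and> a 0 = 0 \<and> inj \<alpha> \<and> range \<alpha> \<subseteq> {0<..<1/2}
        \<longrightarrow> (cyclic_for (similitude (1/\<theta>) (rotation_diag \<alpha>)) (a ` {..m}) \<longleftrightarrow>
              (\<forall>k. \<exists>j\<in>{1..m}. a j $ k \<noteq> 0)))
     \<and>
     (\<forall>(\<theta>::real) (m::nat) (a :: nat \<Rightarrow> complex ^ 's) (p :: nat \<Rightarrow> real) (l::'s) (\<alpha> :: 's \<Rightarrow> real).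
        \<theta> > 1 \<and> m \<ge> 1 \<and> a 0 = 0 \<and> positive_prob_vector m p \<and>
        inj_on \<alpha> (- {l}) \<and> \<alpha> ` (- {l}) \<subseteq> {0<..<1/2}
        \<longrightarrow> (\<exists>E. E \<subseteq> (\<lambda>z. of_real \<theta> * z) ` T_plus \<and> hausdorff_dim E = 0 \<and>
              (\<forall>\<beta>\<in>{0<..<1/2}.
                 \<beta> \<notin> \<alpha> ` (- {l}) \<and> cis (2 * pi * \<beta>) \<notin> (\<lambda>z. of_real (1/\<theta>) * z) ` E \<and>
                 cyclic_for (similitude (1/\<theta>) (rotation_diag (\<alpha>(l := \<beta>)))) (a ` {..m})
                 \<longrightarrow> (\<forall>\<mu>. is_self_similar_measure
                            (similitude (1/\<theta>) (rotation_diag (\<alpha>(l := \<beta>)))) m a p \<mu>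
                       \<longrightarrow> (\<exists>C>0. \<exists>\<gamma>>0. \<forall>\<xi>. cmod (\<xi> $ l) = (MAX j. cmod (\<xi> $ j)) \<and> norm \<xi> \<ge> 1
                              \<longrightarrow> cmod (fourier \<mu> \<xi>) \<le> C * norm \<xi> powr (-\<gamma>))))))"
proof (intro conjI, goal_cases)
  case 1
  show ?case by (intro impI AE_power_decay) (erule conjunct2)
next
  case 2
  show ?case by (intro allI impI, elim conjE) (rule orthogonal_conj_rotation_measures; auto)
next
  case 3
  show ?case by (intro allI impI, elim conjE) (rule cyclic_rotation_iff; simp)
next
  case 4
  show ?case by (intro allI impI, elim conjE) (rule rotation_decay; assumption)
qed

end
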